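(* Let $m\ge2$ be an integer and let $\boxplus=\boxplus(m)\subset[0,1]^2$ be the self-similar set defined in the context. Then $$D_*(\alpha,\boxplus)=D_{\underline{B}*}(\alpha,\boxplus)=\frac1m\qquad\text{for every } 0<\alpha<\frac1m.$$
   Context: Definition of $\boxplus(m)$: consider the tiling of $[0,1]^2$ by $2^{2m}$ closed squares of side length $2^{-m}$. Omit a square of the tiling if its boundary intersects at least one of the two midsegments of $[0,1]^2$ (the segments $\{1/2\}\times[0,1]$ and $[0,1]\times\{1/2\}$) but does not intersect the sides of $[0,1]^2$. Let $\mathcal{F}_1$ be the set of remaining squares. The maps $z\mapsto 2^{-m}z+v$ taking $[0,1]^2$ onto the squares of $\mathcal{F}_1$ form an iterated function system, and $\boxplus(m)$ is its attractor. For compact $F\subset\mathbb{R}^p$ and $0<\alpha\le1$, $C_1^\alpha(F)$ is the set of $f:F\to\mathbb{R}$ with $|f(a)-f(b)|\le|a-b|^\alpha$ for all $a,b\in F$, with the topology of the supremum norm. For $f:F\to\mathbb{R}$ put $$D_*^f(F)=\sup\{d:\lambda(\{r:\dim_H(f^{-1}(r))\ge d\})>0\},\qquad D_{\underline{B}*}^f(F)=\sup\{d:\lambda(\{r:\underline{\dim}_B(f^{-1}(r))\ge d\})>0\},$$ where $\lambda$ is one-dimensional Lebesgue measure, $\dim_H$ is Hausdorff dimension and $\underline{\dim}_B$ is lower box dimension. Let $\mathfrak{G}_{1,\alpha}(F)$ be the collection of dense $G_\delta$ subsets of $C_1^\alpha(F)$, and $$D_*(\alpha,F)=\sup_{\mathcal{G}\in\mathfrak{G}_{1,\alpha}(F)}\inf\{D_*^f(F):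 f\in\mathcal{G}\},\qquad D_{\underline{B}*}(\alpha,F)=\sup_{\mathcal{G}\in\mathfrak{G}_{1,\alpha}(F)}\inf\{D_{\underline{B}*}^f(F): f\in\mathcal{G}\}.$$ *)

theory Defs
  imports "HOL-Analysis.Analysis"
begin

section \<open>Hausdorff dimension and lower box dimension\<close>

text \<open>
  The convention \<open>0\<^sup>0 = 1\<close> (so that the \<open>0\<close>-dimensional Hausdorff measure counts points) is
  built in explicitly, because \<open>0 powr 0 = 0\<close> in the library.
\<close>

definition diam_pow :: "real \<Rightarrow> 'a::metric_space set \<Rightarrow> ennreal" where
  "diam_pow s U = (if U = {} then 0 else if s = 0 then 1 else ennreal (diameter U powr s))"

text \<open>
  Boundedness of the covering sets has to be required separately, as \<^const>\<open>diameter\<close> is real-valued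
  and unspecified on unbounded sets.
\<close>

definition hausdorff_premeasure :: "real \<Rightarrow> real \<Rightarrow> 'a::metric_space set \<Rightarrow> ennreal" where
  "hausdorff_premeasure s \<delta> A =
     (INF U \<in> {U :: nat \<Rightarrow> 'a set. A \<subseteq> (\<Union>i. U i) \<and> (\<forall>i. bounded (U i) \<and> diameter (U i) \<le> \<delta>)}.
        \<Sum>i. diam_pow s (U i))"

definition hausdorff_measure :: "real \<Rightarrow> 'a::metric_space set \<Rightarrow> ennreal" where
  "hausdorff_measure s A = (SUP \<delta> \<in> {0<..}. hausdorff_premeasure s \<delta> A)"

definition hausdorff_dim :: "'a::metric_space set \<Rightarrow> ereal" where
  "hausdorff_dim A = Inf {ereal s | s. 0 \<le> s \<and> hausdorff_measure s A = 0}"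

text \<open>
  The smallest number of sets of diameter at most \<open>\<delta>\<close> covering \<open>A\<close>; only meaningful for totally
  bounded \<open>A\<close> and \<open>\<delta> > 0\<close>. Since \<open>ln 0 = 0\<close>, the empty set gets lower box dimension \<open>0\<close>,
  in accordance with \<open>hausdorff_dim {} = 0\<close>.
\<close>

definition covering_number :: "real \<Rightarrow> 'a::metric_space set \<Rightarrow> nat" where
  "covering_number \<delta> A =
     (LEAST n. \<exists>\<C>. finite \<C> \<and> card \<C> = n \<and> A \<subseteq> \<Union>\<C> \<and> (\<forall>U\<in>\<C>. bounded U \<and> diameter U \<le> \<delta>))"

definition lower_box_dim :: "'a::metric_space set \<Rightarrow> ereal" where
  "lower_box_dim A =
     Liminf (at_right 0) (\<lambda>\<delta>. ereal (ln (real (covering_number \<delta> A)) / - ln \<delta>))"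


section \<open>Generic level sets of Hoelder functions\<close>

text \<open>
  Functions \<open>F \<rightarrow> \<real>\<close> are represented by their extensional representatives, as in \<^const>\<open>funspace\<close>.
\<close>

definition holder1 :: "real \<Rightarrow> 'a::metric_space set \<Rightarrow> ('a \<Rightarrow> real) set" where
  "holder1 \<alpha> F = {f \<in> extensional F. \<forall>a\<in>F. \<forall>b\<in>F. \<bar>f a - f b\<bar> \<le> dist a b powr \<alpha>}"

text \<open>\<^const>\<open>funspace\<close> carries the supremum metric.\<close>

definition holder1_topology :: "real \<Rightarrow> 'a::metric_space set \<Rightarrow> ('a \<Rightarrow> real) topology" where
  "holder1_topology \<alpha> F = subtopology (mtopology_of (funspace F euclidean_metric)) (holder1 \<alpha> F)"

definition dense_gdeltas :: "real \<Rightarrow> 'a::metric_space set \<Rightarrow> ('a \<Rightarrow> real) set set" where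
  "dense_gdeltas \<alpha> F =
     {G. gdelta_in (holder1_topology \<alpha> F) G \<and>
         holder1_topology \<alpha> F closure_of G = topspace (holder1_topology \<alpha> F)}"

text \<open>The parameter \<open>dm\<close> is the notion of dimension that is used for the level sets.\<close>

definition level_set_dim ::
  "('a set \<Rightarrow> ereal) \<Rightarrow> 'a set \<Rightarrow> ('a \<Rightarrow> real) \<Rightarrow> ereal" where
  "level_set_dim dm F f =
     Sup {d. emeasure lebesgue {r. dm {x \<in> F. f x = r} \<ge> d} > 0}"

definition generic_level_set_dim ::
  "('a::metric_space set \<Rightarrow> ereal) \<Rightarrow> real \<Rightarrow> 'a set \<Rightarrow> ereal" where
  "generic_level_set_dim dm \<alpha> F = (SUP G \<in> dense_gdeltas \<alpha> F. INF f \<in> G. level_set_dim dm F f)"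

definition D_star :: "real \<Rightarrow> 'a::metric_space set \<Rightarrow> ereal" where
  "D_star = generic_level_set_dim hausdorff_dim"

definition D_lbox_star :: "real \<Rightarrow> 'a::metric_space set \<Rightarrow> ereal" where
  "D_lbox_star = generic_level_set_dim lower_box_dim"


section \<open>The fractal\<close>

definition is_attractor :: "('a::metric_space \<Rightarrow> 'a) set \<Rightarrow> 'a set \<Rightarrow> bool" where
  "is_attractor \<Phi> K \<longleftrightarrow> compact K \<and> K \<noteq> {} \<and> K = (\<Union>\<phi>\<in>\<Phi>. \<phi> ` K)"

definition attractor :: "('a::metric_space \<Rightarrow> 'a) set \<Rightarrow> 'a set" where
  "attractor \<Phi> = (THE K. is_attractor \<Phi> K)"

text \<open>The plane is \<^typ>\<open>real \<times> real\<close>, whose library metric is the Euclidean one.\<close>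

definition unit_square :: "(real \<times> real) set" where
  "unit_square = {0..1} \<times> {0..1}"

definition midsegments :: "(real \<times> real) set" where
  "midsegments = {1/2} \<times> {0..1} \<union> {0..1} \<times> {1/2}"

definition tiling :: "nat \<Rightarrow> (real \<times> real) set set" where
  "tiling m = {{real i / 2^m .. real (i+1) / 2^m} \<times> {real j / 2^m .. real (j+1) / 2^m} | i j.
                 i < 2^m \<and> j < 2^m}"

definition boxplus_squares :: "nat \<Rightarrow> (real \<times> real) set set" where
  "boxplus_squares m =
     {Q \<in> tiling m. \<not> (frontier Q \<inter> midsegments \<noteq> {} \<and> frontier Q \<inter> frontier unit_square = {})}"

definition boxplus_ifs :: "nat \<Rightarrow> (real \<times> real \<Rightarrow> real \<times> real) set" where
  "boxplus_ifs m =
     {\<phi>. \<exists>v. \<phi> = (\<lambda>z. (1 / 2^m) *\<^sub>R z + v) \<and> \<phi> ` unit_square \<in> boxplus_squares m}"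

definition boxplus :: "nat \<Rightarrow> (real \<times> real) set" where
  "boxplus m = attractor (boxplus_ifs m)"

text \<open>The \<^const>\<open>attractor\<close> of this iterated function system exists and is unique.\<close>

lemma attractor_subset:
  fixes \<Phi> :: "('a::euclidean_space \<Rightarrow> 'a) set"
  assumes \<Phi>: "\<And>\<phi>. \<phi> \<in> \<Phi> \<Longrightarrow> \<exists>v. \<phi> = (\<lambda>z. c *\<^sub>R z + v)" and c: "0 \<le> c" "c < 1"
    and K: "is_attractor \<Phi> K" and L: "is_attractor \<Phi> L"
  shows "K \<subseteq> L"
proof -
  have K': "compact K" "K \<noteq> {}" "K = (\<Union>\<phi>\<in>\<Phi>. \<phi> ` K)"
    and L': "compact L" "L \<noteq> {}" "L = (\<Union>\<phi>\<in>\<Phi>. \<phi> ` L)"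
    using K L by (auto simp: is_attractor_def)
  have "continuous_on K (\<lambda>x. infdist x L)"
    by (intro continuous_intros)
  from continuous_attains_sup[OF K'(1,2) this]
  obtain x where x: "x \<in> K" "\<And>y. y \<in> K \<Longrightarrow> infdist y L \<le> infdist x L" by blast
  from x(1) K'(3) obtain \<phi> y where y: "\<phi> \<in> \<Phi>" "y \<in> K" "x = \<phi> y" by blast
  obtain v where v: "\<phi> = (\<lambda>z. c *\<^sub>R z + v)" using \<Phi> y(1) by blast
  obtain l where l: "l \<in> L" "infdist y L = dist y l"
    using infdist_attains_inf[of L y] L' compact_imp_closed by blast
  have "\<phi> l \<in> L" using L'(3) l(1) y(1) by blast
  then have "infdist x L \<le> dist (\<phi> y) (\<phi> l)" using y(3) by (simp add: infdist_le)
  also have "\<dots> = c * dist y l"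
    using c by (simp add: v dist_norm flip: scaleR_diff_right)
  also have "\<dots> \<le> c * infdist x L"
    using l x(2)[OF y(2)] c by (simp add: mult_left_mono)
  finally have "(1 - c) * infdist x L \<le> 0" by (simp add: algebra_simps)
  then have "infdist x L = 0"
    using c infdist_nonneg[of x L] by (simp add: mult_le_0_iff)
  then have "infdist y L = 0" if "y \<in> K" for y
    using x(2)[OF that] infdist_nonneg[of y L] by linarith
  then show ?thesis
    using in_closed_iff_infdist_zero[of L] L' compact_imp_closed by blast
qed

lemma attractor_exists:
  fixes \<Phi> :: "('a::euclidean_space \<Rightarrow> 'a) set"
  assumes \<Phi>: "\<And>\<phi>. \<phi> \<in> \<Phi> \<Longrightarrow> \<exists>v. \<phi> = (\<lambda>z. c *\<^sub>R z + v)" and fin: "finite \<Phi>" and ne: "\<Phi> \<noteq> {}"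
    and S: "compact S" "S \<noteq> {}" "\<And>\<phi>. \<phi> \<in> \<Phi> \<Longrightarrow> \<phi> ` S \<subseteq> S"
  shows "\<exists>K. is_attractor \<Phi> K"
proof -
  define T where "T A = (\<Union>\<phi>\<in>\<Phi>. \<phi> ` A)" for A
  define X where "X n = (T ^^ n) S" for n
  have X0: "X 0 = S" and XS: "X (Suc n) = T (X n)" for n by (simp_all add: X_def)
  have cont: "continuous_on A \<phi>" if "\<phi> \<in> \<Phi>" for A \<phi>
    using \<Phi>[OF that] by (auto intro!: continuous_intros)
  have comp: "compact (X n)" for n
  proof (induction n)
    case (Suc n)
    then show ?case unfolding XS T_def
      using fin cont by (intro compact_UN) (auto intro: compact_continuous_image)
  qed (simp add: X0 S)
  have nonempty: "X n \<noteq> {}" for n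
    by (induction n) (use ne S in \<open>auto simp: X0 XS T_def\<close>)
  have "T A \<subseteq> T B" if "A \<subseteq> B" for A B using that unfolding T_def by blast
  moreover have "T S \<subseteq> S" using S(3) unfolding T_def by blast
  ultimately have dec: "X (Suc n) \<subseteq> X n" for n
    by (induction n) (simp_all add: X0 XS)
  have dec': "X n \<subseteq> X k" if "k \<le> n" for k n
    using that by (induction rule: dec_induct) (use dec in auto)
  define K where "K = (\<Inter>n. X n)"
  have K: "compact K" "K \<noteq> {}"
    unfolding K_def using comp nonempty dec'
    by (auto intro!: compact_Inter simp: compact_nest)
  have "K \<subseteq> T K"
  proof
    fix x assume x: "x \<in> K"
    have "\<exists>\<phi>\<in>\<Phi>. x \<in> \<phi> ` X n" for n
      using x XS[of n] unfolding K_def T_def by blast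
    then obtain g where g: "\<And>n. g n \<in> \<Phi>" "\<And>n. x \<in> g n ` X n" by metis
    have "finite (range g)" using fin g(1) by (meson finite_subset image_subsetI)
    then obtain n0 where inf: "infinite {n. g n = g n0}"
      using pigeonhole_infinite[of "UNIV :: nat set" g] by auto
    let ?\<phi> = "g n0"
    have all: "x \<in> ?\<phi> ` X n" for n
    proof -
      obtain k where k: "k \<ge> n" "g k = ?\<phi>"
        using inf unfolding infinite_nat_iff_unbounded_le by blast
      then show ?thesis using g(2)[of k] dec'[of n k] by auto
    qed
    define Y where "Y n = X n \<inter> ?\<phi> -` {x}" for n
    have "compact (Y n)" for n
    proof -
      have "closed (?\<phi> -` {x})"
        using cont[OF g(1)] by (intro closed_vimage) auto
      then show ?thesis unfolding Y_def using comp by blast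
    qed
    moreover have "Y n \<noteq> {}" for n using all[of n] unfolding Y_def by blast
    moreover have "Y n \<subseteq> Y k" if "k \<le> n" for k n using dec'[OF that] unfolding Y_def by blast
    ultimately have "(\<Inter>n. Y n) \<noteq> {}" by (rule compact_nest)
    then show "x \<in> T K" unfolding T_def K_def Y_def using g(1)[of n0] by auto
  qed
  moreover have "T K \<subseteq> K"
  proof -
    have "T K \<subseteq> X n" for n
    proof -
      have "T K \<subseteq> T (X n)" unfolding T_def K_def by blast
      then show ?thesis using XS[of n] dec[of n] by blast
    qed
    then show ?thesis unfolding K_def by blast
  qed
  ultimately have "is_attractor \<Phi> K" using K unfolding is_attractor_def T_def by blast
  then show ?thesis by blast
qed

lemma is_attractor_boxplus:
  assumes "m \<ge> 1"
  shows "is_attractor (boxplus_ifs m) (boxplus m)"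
proof -
  let ?c = "1 / 2^m :: real"
  have c: "0 \<le> ?c" "?c < 1" using assms by auto
  have form: "\<exists>v. \<phi> = (\<lambda>z. ?c *\<^sub>R z + v)" if "\<phi> \<in> boxplus_ifs m" for \<phi>
    using that by (auto simp: boxplus_ifs_def)
  have tile: "Q \<subseteq> unit_square" if "Q \<in> tiling m" for Q
  proof -
    obtain i j where ij: "Q = {real i / 2^m .. real (i+1) / 2^m} \<times> {real j / 2^m .. real (j+1) / 2^m}"
      "i < 2^m" "j < 2^m" using \<open>Q \<in> tiling m\<close> by (auto simp: tiling_def)
    have "real (k+1) / 2^m \<le> 1" if "k < 2^m" for k
    proof -
      have "real (k+1) \<le> real (2^m)" using that by (simp only: of_nat_le_iff)
      then show ?thesis by simp
    qed
    moreover have "0 \<le> real k / 2^m" for k by simp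
    ultimately have "{real k / 2^m .. real (k+1) / 2^m} \<subseteq> {0..1}" if "k < 2^m" for k
      using that by (meson atLeastatMost_subset_iff)
    then show ?thesis
      unfolding ij(1) unit_square_def using ij(2,3) by (intro Sigma_mono) blast+
  qed
  have sq: "\<phi> ` unit_square \<subseteq> unit_square" if "\<phi> \<in> boxplus_ifs m" for \<phi>
    using that tile by (auto simp: boxplus_ifs_def boxplus_squares_def)
  have fin: "finite (boxplus_ifs m)"
  proof (rule inj_on_finite[where f = "\<lambda>\<phi>. \<phi> ` unit_square" and B = "tiling m"])
    show "inj_on (\<lambda>\<phi>. \<phi> ` unit_square) (boxplus_ifs m)"
    proof (rule inj_onI)
      have *: "v = w" if eq: "(\<lambda>z. ?c *\<^sub>R z + v) ` unit_square = (\<lambda>z. ?c *\<^sub>R z + w) ` unit_square"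
        for v w :: "real \<times> real"
      proof -
        have le: "fst w \<le> fst v \<and> snd w \<le> snd v"
          if "(\<lambda>z. ?c *\<^sub>R z + v) ` unit_square = (\<lambda>z. ?c *\<^sub>R z + w) ` unit_square" for v w :: "real \<times> real"
        proof -
          have "(0,0) \<in> unit_square" by (simp add: unit_square_def)
          then have "(\<lambda>z. ?c *\<^sub>R z + v) (0,0) \<in> (\<lambda>z. ?c *\<^sub>R z + w) ` unit_square"
            using that by blast
          then obtain a b where "0 \<le> a" "0 \<le> b" "?c *\<^sub>R (0,0) + v = ?c *\<^sub>R (a,b) + w"
            by (auto simp: unit_square_def simp del: scaleR_Pair)
          then have "v = ?c *\<^sub>R (a,b) + w" by (simp add: zero_prod_def[symmetric])
          then show ?thesis using \<open>0 \<le> a\<close> \<open>0 \<le> b\<close> by simp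
        qed
        show ?thesis using le[OF eq] le[OF eq[symmetric]] by (simp add: prod_eq_iff)
      qed
      fix \<phi> \<psi> assume "\<phi> \<in> boxplus_ifs m" "\<psi> \<in> boxplus_ifs m" and e: "\<phi> ` unit_square = \<psi> ` unit_square"
      then obtain v w where vw: "\<phi> = (\<lambda>z. ?c *\<^sub>R z + v)" "\<psi> = (\<lambda>z. ?c *\<^sub>R z + w)"
        using form by meson
      show "\<phi> = \<psi>" using *[of v w] e unfolding vw by simp
    qed
    show "(\<lambda>\<phi>. \<phi> ` unit_square) ` boxplus_ifs m \<subseteq> tiling m"
      by (auto simp: boxplus_ifs_def boxplus_squares_def)
    have "tiling m = (\<lambda>(i,j). {real i / 2^m .. real (i+1) / 2^m} \<times> {real j / 2^m .. real (j+1) / 2^m}) `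
            ({..<2^m} \<times> {..<2^m})" by (auto simp: tiling_def image_iff)
    then show "finite (tiling m)" by simp
  qed
  have ne: "boxplus_ifs m \<noteq> {}"
  proof -
    let ?Q = "{0..?c} \<times> {0..?c}"
    have "?Q \<in> tiling m" unfolding tiling_def by (rule CollectI, rule exI[of _ 0], rule exI[of _ 0]) simp
    moreover have "(0,0) \<in> frontier ({0..a} \<times> {0..a})" if "a > 0" for a :: real
      using that by (auto simp: frontier_def closure_Times interior_Times)
    from this[of 1] this[of ?c] have "frontier ?Q \<inter> frontier unit_square \<noteq> {}"
      unfolding unit_square_def by auto
    ultimately have Q: "?Q \<in> boxplus_squares m" by (auto simp: boxplus_squares_def)
    have "(\<lambda>z. ?c *\<^sub>R z + 0) ` unit_square = ?Q"
    proof -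
      have "(a, b) \<in> (\<lambda>z. ?c *\<^sub>R z + 0) ` unit_square" if "(a,b) \<in> ?Q" for a b
        by (rule image_eqI[of _ _ "(2^m * a, 2^m * b)"]) (use that in \<open>auto simp: unit_square_def field_simps\<close>)
      then show ?thesis by (auto simp: unit_square_def divide_right_mono)
    qed
    then have "(\<lambda>z. ?c *\<^sub>R z + 0) \<in> boxplus_ifs m"
      unfolding boxplus_ifs_def using Q by (intro CollectI exI[of _ 0]) (simp only: simp_thms)
    then show ?thesis by blast
  qed
  have "compact unit_square" "unit_square \<noteq> {}"
    by (auto simp: unit_square_def intro: compact_Times)
  then have "\<exists>K. is_attractor (boxplus_ifs m) K"
    using attractor_exists[OF form fin ne] sq by blast
  then have "\<exists>!K. is_attractor (boxplus_ifs m) K"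
    using attractor_subset[OF form c] by (metis subset_antisym)
  then show ?thesis unfolding boxplus_def attractor_def by (rule theI')
qed

end

theory Submission
  imports Defs
begin

text \<open>
  Put \<open>N = 2 ^ m\<close>. Lower bound: the fractal contains every horizontal segment \<open>[0,1] \<times> {y}\<close> where \<open>y\<close>
  has only the base \<open>N\<close> digits \<open>0\<close> and \<open>N - 1\<close>; these \<open>y\<close> form a Cantor set of dimension \<open>1/m\<close>. If
  \<open>f (0,0) \<noteq> f (1,0)\<close>, which is an open dense condition, then for all \<open>r\<close> in some interval the level set
  of \<open>r\<close> meets all such segments near the bottom side, and it projects onto a piece of the Cantor set.
  Level sets depend measurably on \<open>r\<close> because the dimensions can be computed with open covers.

  Upper bound: at every scale, the left and right halves of a cell are joined only inside the top and bottom
  rows of its squares.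
  Hence there is a staircase function of one coordinate with Hoelder exponent \<open>1/m\<close> which varies, within a
  cell, on \<open>4 ^ k\<close> of the squares of side \<open>N powr - k\<close> only, by about \<open>2 powr - k\<close> on each of them. Applying
  it to both coordinates in each cell of a fine grid collapses the fractal to a one-dimensional set. As
  \<open>\<alpha> < 1/m\<close>, a Lipschitz approximation of a given function composed with the collapse is still \<open>\<alpha>\<close>-Hoelder
  with constant \<open>1\<close>, and by Markov's inequality all of its level sets, except for a set of values
  of small measure, are covered by a constant times \<open>2 ^ k\<close> of the small squares. The same cover serves all
  nearby functions, and Baire's theorem applies.
\<close>

text \<open>The obstacle in the upper bound is that the perturbed function must stay in
  \<open>holder1\<close>, whose constant is exactly 1. Starting from a Lipschitz function, the
  distortion by the collapse carries a factor \<open>M powr (\<alpha> - 1)\<close>, small on a fine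
  grid of mesh \<open>1 / M\<close>, and a factor \<open>1 - \<epsilon>\<close> pays for it at
  larger distances. These bounds are uniform in the depth \<open>k\<close> of the staircase. Hence
  the choices can be made in the order Lipschitz constant \<open>K\<close>, mesh, depth, radius of
  the neighbourhood, and growing \<open>k\<close> beats every constant that depends on
  \<open>K\<close>, \<open>M\<close> and \<open>n\<close>.

  The exponent arises as follows: of the order of 4^k squares with oscillation of order 2^(-k) fill
  a total length of order 2^k in the range, so a typical value meets about 2^k of them, and 2^k is
  the power 1/m of the inverse side length 2^(m k). The far more numerous other squares contribute
  one value each, and finitely many values have neighbourhoods of small total length.

  As the Hausdorff dimension of a compact set is at most its lower box dimension, the lower bound is
  proved for the former and the upper bound for the latter.\<close>

lemma diameter_le_dist:
  fixes S :: "'a::metric_space set"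
  assumes "0 \<le> \<delta>" "\<And>x y. x \<in> S \<Longrightarrow> y \<in> S \<Longrightarrow> dist x y \<le> \<delta>"
  shows "diameter S \<le> \<delta>"
  using assms by (auto simp: diameter_def intro: cSUP_least)

section \<open>Hausdorff measure zero and Hausdorff dimension\<close>

lemma hausdorff_measure_eq_0D:
  assumes "hausdorff_measure s A = 0" "\<epsilon> > 0" "\<delta> > 0"
  obtains U :: "nat \<Rightarrow> 'a::metric_space set"
  where "A \<subseteq> (\<Union>i. U i)" "\<And>i. bounded (U i)" "\<And>i. diameter (U i) \<le> \<delta>"
    "(\<Sum>i. diam_pow s (U i)) < ennreal \<epsilon>"
proof -
  have "hausdorff_premeasure s \<delta> A \<le> hausdorff_measure s A"
    unfolding hausdorff_measure_def using assms by (intro SUP_upper) auto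
  then have "hausdorff_premeasure s \<delta> A < ennreal \<epsilon>" using assms by simp
  then show ?thesis
    unfolding hausdorff_premeasure_def INF_less_iff using that by auto
qed

text \<open>For \<open>s > 0\<close> the bound on the diameters comes for free: a sum below
  \<open>\<delta> powr s\<close> forces every single diameter to be at most
  \<open>\<delta>\<close>.\<close>

lemma hausdorff_measure_eq_0I:
  fixes A :: "'a::metric_space set"
  assumes s: "s > 0"
    and U: "\<And>\<epsilon>. \<epsilon> > 0 \<Longrightarrow> \<exists>U :: nat \<Rightarrow> 'a set. A \<subseteq> (\<Union>i. U i) \<and> (\<forall>i. bounded (U i)) \<and>
          (\<Sum>i. diam_pow s (U i)) < ennreal \<epsilon>"
  shows "hausdorff_measure s A = 0"
proof -
  have "hausdorff_premeasure s \<delta> A \<le> 0" if \<delta>: "\<delta> > 0" for \<delta>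
  proof (rule ennreal_le_epsilon)
    fix e :: real assume e: "0 < e"
    define e' where "e' = min e (\<delta> powr s)"
    have "e' > 0" using e \<delta> by (simp add: e'_def)
    from U[OF this] obtain U :: "nat \<Rightarrow> 'a set" where
      U: "A \<subseteq> (\<Union>i. U i)" "\<And>i. bounded (U i)" "(\<Sum>i. diam_pow s (U i)) < ennreal e'" by blast
    have "diameter (U i) \<le> \<delta>" for i
    proof (cases "U i = {}")
      case True then show ?thesis using \<delta> by simp
    next
      case False
      have "diam_pow s (U i) \<le> (\<Sum>i. diam_pow s (U i))"
        using sum_le_suminf[of "\<lambda>i. diam_pow s (U i)" "{i}"] by simp
      with U(3) have "diam_pow s (U i) < ennreal e'" by order
      then have "diameter (U i) powr s < \<delta> powr s"
        using False s by (simp add: diam_pow_def ennreal_less_iff e'_def)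
      then show ?thesis
        using s \<delta> by (meson less_eq_real_def not_le powr_mono2)
    qed
    then have "hausdorff_premeasure s \<delta> A \<le> (\<Sum>i. diam_pow s (U i))"
      unfolding hausdorff_premeasure_def using U by (intro INF_lower) auto
    also have "\<dots> \<le> ennreal e" 
      using U(3) by (simp add: e'_def) (meson ennreal_leI less_imp_le min.cobounded1 order_trans)
    finally show "hausdorff_premeasure s \<delta> A \<le> 0 + ennreal e" by simp
  qed
  then show ?thesis unfolding hausdorff_measure_def
    by (metis (no_types, lifting) SUP_least greaterThan_iff le_zero_eq)
qed

lemma open_enlargement:
  fixes U :: "'a::metric_space set"
  assumes "bounded U" "\<eta> > 0"
  obtains V where "open V" "bounded V" "U \<subseteq> V" "diameter V \<le> diameter U + \<eta>" "U = {} \<Longrightarrow> V = {}"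
proof
  let ?V = "\<Union>x\<in>U. ball x (\<eta>/2)"
  show "open ?V" by auto
  show "U \<subseteq> ?V" using assms by auto
  have d: "dist y z \<le> diameter U + \<eta>" if yz: "y \<in> ?V" "z \<in> ?V" for y z
  proof -
    obtain u v where uv: "u \<in> U" "v \<in> U" "dist u y < \<eta>/2" "dist v z < \<eta>/2"
      using yz by auto
    have "dist u v \<le> diameter U" using diameter_bounded_bound assms uv by blast
    moreover have "dist y z \<le> dist u y + dist u v + dist v z"
      using dist_triangle[of y z u] dist_triangle[of u z v] by (simp add: dist_commute)
    ultimately show ?thesis using uv by linarith
  qed
  show "bounded ?V"
  proof (cases "?V = {}")
    case False
    then obtain x where "x \<in> ?V" by blast
    then show ?thesis unfolding bounded_def using d by meson
  next
    case True
    then show ?thesis by (metis bounded_empty)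
  qed
  show "diameter ?V \<le> diameter U + \<eta>"
    using d assms diameter_ge_0[of U] by (intro diameter_le_dist) auto
  show "U = {} \<Longrightarrow> ?V = {}" by simp
qed

text \<open>Continuity from the right of \<open>x \<mapsto> x powr s\<close> at
  \<open>diameter U\<close>, which for \<open>s > 0\<close> includes diameter 0.\<close>

lemma open_enlargement_diam_pow:
  fixes U :: "'a::metric_space set"
  assumes "bounded U" "\<eta> > 0" "s > 0"
  obtains V where "open V" "bounded V" "U \<subseteq> V" "diam_pow s V \<le> diam_pow s U + ennreal \<eta>"
proof -
  let ?D = "diameter U"
  have D: "?D \<ge> 0" using assms diameter_ge_0 by blast
  have "((\<lambda>k. (?D + k) powr s) \<longlongrightarrow> (?D + 0) powr s) (at_right 0)"
    using assms D by (intro tendsto_powr' tendsto_intros) 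
      (auto simp: eventually_at_right_less intro!: eventually_at_rightI[of 0 1])
  then have "\<forall>\<^sub>F k in at_right 0. (?D + k) powr s < ?D powr s + \<eta>"
    using assms by (intro order_tendstoD) auto
  then obtain b where b: "b > 0" "\<And>k. 0 < k \<Longrightarrow> k < b \<Longrightarrow> (?D + k) powr s < ?D powr s + \<eta>"
    unfolding eventually_at_right_field by auto
  have k: "0 < b/2" "b/2 < b" using b(1) by auto
  obtain V where V: "open V" "bounded V" "U \<subseteq> V" "diameter V \<le> ?D + b/2" "U = {} \<Longrightarrow> V = {}"
    using open_enlargement[OF assms(1) k(1)] by blast
  have "diameter V powr s \<le> (?D + b/2) powr s"
    using V assms diameter_ge_0 by (intro powr_mono2) auto
  then have "diameter V powr s \<le> ?D powr s + \<eta>" using b(2)[OF k] by linarith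
  then have "ennreal (diameter V powr s) \<le> ennreal (?D powr s) + ennreal \<eta>"
    using assms by (simp add: ennreal_leI flip: ennreal_plus)
  then have "diam_pow s V \<le> diam_pow s U + ennreal \<eta>"
    using V assms by (auto simp: diam_pow_def)
  with V that show ?thesis by blast
qed

text \<open>Raising the exponent from \<open>s\<close> to \<open>t\<close> makes it positive even
  for \<open>s = 0\<close>, where single points cost 1; at a positive exponent sets can be enlarged
  to open ones at arbitrarily small cost.\<close>

lemma hausdorff_measure_eq_0_open_cover:
  fixes A :: "'a::metric_space set"
  assumes H: "hausdorff_measure s A = 0" and "s < t" "0 \<le> s" "\<epsilon> > 0"
  shows "\<exists>U :: nat \<Rightarrow> 'a set. A \<subseteq> (\<Union>i. U i) \<and> (\<forall>i. open (U i) \<and> bounded (U i)) \<and>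
    (\<Sum>i. diam_pow t (U i)) < ennreal \<epsilon>"
proof -
  obtain U :: "nat \<Rightarrow> 'a set"
    where U: "A \<subseteq> (\<Union>i. U i)" "\<And>i. bounded (U i)" "\<And>i. diameter (U i) \<le> 1"
      "(\<Sum>i. diam_pow s (U i)) < ennreal (\<epsilon>/2)"
    using hausdorff_measure_eq_0D[OF H, of "\<epsilon>/2" 1] assms by auto
  \<comment> \<open>The costs \<open>\<epsilon>/2 * (1/2)^Suc i\<close> of the enlargements add up
    to \<open>\<epsilon>/2\<close>.\<close>
  have "\<exists>V. open V \<and> bounded V \<and> U i \<subseteq> V \<and> diam_pow t V \<le> diam_pow t (U i) + ennreal (\<epsilon>/2 * (1/2)^Suc i)" for i
  proof -
    have "\<epsilon>/2 * (1/2)^Suc i > 0" "t > 0" using assms by auto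
    then show ?thesis
      using open_enlargement_diam_pow[OF U(2)[of i]] by (metis (no_types, lifting))
  qed
  then obtain V where V: "\<And>i. open (V i)" "\<And>i. bounded (V i)" "\<And>i. U i \<subseteq> V i"
    "\<And>i. diam_pow t (V i) \<le> diam_pow t (U i) + ennreal (\<epsilon>/2 * (1/2)^Suc i)" by metis
  have le: "diam_pow t (U i) \<le> diam_pow s (U i)" for i
  proof -
    have "diameter (U i) powr t \<le> diameter (U i) powr s"
      using U(3)[of i] assms diameter_ge_0[OF U(2)] by (intro powr_mono') auto
    moreover have "diameter (U i) powr t \<le> 1"
      using U(3)[of i] assms diameter_ge_0[OF U(2)] by (simp add: powr_le1)
    ultimately show ?thesis
      using assms by (auto simp: diam_pow_def intro!: ennreal_leI)
  qed
  have "(\<Sum>i. diam_pow t (V i)) \<le> (\<Sum>i. diam_pow s (U i) + ennreal (\<epsilon>/2 * (1/2)^Suc i))"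
    using order_trans[OF V(4) add_right_mono[OF le]] by (intro suminf_le) auto
  also have "\<dots> = (\<Sum>i. diam_pow s (U i)) + (\<Sum>i. ennreal (\<epsilon>/2 * (1/2)^Suc i))"
    by (intro suminf_add[symmetric]) auto
  also have "(\<Sum>i. ennreal (\<epsilon>/2 * (1/2)^Suc i)) = ennreal (\<epsilon>/2 * 1)"
    using assms by (intro suminf_ennreal_eq sums_mult power_half_series) auto
  also have "(\<Sum>i. diam_pow s (U i)) + ennreal (\<epsilon>/2 * 1) < ennreal (\<epsilon>/2) + ennreal (\<epsilon>/2*1)"
    using U(4) using assms by (simp add: add.commute ennreal_add_left_cancel_less) 
  also have "\<dots> = ennreal \<epsilon>" using assms by (simp flip: ennreal_plus)
  finally have "(\<Sum>i. diam_pow t (V i)) < ennreal \<epsilon>" .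
  moreover have "A \<subseteq> (\<Union>i. V i)"
  proof
    fix x assume "x \<in> A"
    then obtain i where "x \<in> U i" using U(1) by blast
    then show "x \<in> (\<Union>i. V i)" using V(3)[of i] by blast
  qed
  ultimately show ?thesis using V(1,2) by (intro exI[of _ V] conjI allI)
qed

text \<open>The right hand side is built for measurability in the level: apart from the choice of an
  open cover all quantifiers range over countable sets.\<close>

lemma hausdorff_dim_less_iff:
  fixes A :: "'a::metric_space set"
  shows "hausdorff_dim A < ereal d \<longleftrightarrow> (\<exists>t\<in>\<rat>. 0 < t \<and> t < d \<and> (\<forall>n. \<exists>U :: nat \<Rightarrow> 'a set.
     A \<subseteq> (\<Union>i. U i) \<and> (\<forall>i. open (U i) \<and> bounded (U i)) \<and>
     (\<Sum>i. diam_pow t (U i)) < ennreal (1 / real (Suc n))))" (is "?L \<longleftrightarrow> ?R")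
proof
  assume ?L
  then obtain s where s: "0 \<le> s" "hausdorff_measure s A = 0" "s < d"
    unfolding hausdorff_dim_def Inf_less_iff by auto
  obtain t where t: "t \<in> \<rat>" "s < t" "t < d" using Rats_dense_in_real[OF s(3)] by blast
  have "\<exists>U :: nat \<Rightarrow> 'a set. A \<subseteq> (\<Union>i. U i) \<and> (\<forall>i. open (U i) \<and> bounded (U i)) \<and>
     (\<Sum>i. diam_pow t (U i)) < ennreal (1 / real (Suc n))" for n
    using hausdorff_measure_eq_0_open_cover[OF s(2) t(2) s(1)] by simp
  then show ?R using t s(1) by (intro bexI[of _ t] conjI allI) simp_all
next
  assume ?R
  then obtain t where t: "0 < t" "t < d" and U: "\<And>n. \<exists>U :: nat \<Rightarrow> 'a set.
     A \<subseteq> (\<Union>i. U i) \<and> (\<forall>i. open (U i) \<and> bounded (U i)) \<and>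
     (\<Sum>i. diam_pow t (U i)) < ennreal (1 / real (Suc n))" by blast
  have "hausdorff_measure t A = 0"
  proof (rule hausdorff_measure_eq_0I[OF t(1)])
    fix e :: real assume "e > 0"
    then obtain n where "1 / real (Suc n) < e" using nat_approx_posE by blast
    then have "ennreal (1 / real (Suc n)) \<le> ennreal e" by (intro ennreal_leI) auto
    then show "\<exists>U :: nat \<Rightarrow> 'a set. A \<subseteq> (\<Union>i. U i) \<and> (\<forall>i. bounded (U i)) \<and>
          (\<Sum>i. diam_pow t (U i)) < ennreal e"
      using U[of n] by (meson order_less_le_trans)
  qed
  then have "hausdorff_dim A \<le> ereal t"
    unfolding hausdorff_dim_def using t by (intro Inf_lower) auto
  also have "\<dots> < ereal d" using t by simp
  finally show ?L .
qed

text \<open>The mass distribution principle with the mass pulled back to an interval: a cover of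
  \<open>A\<close> yields a cover of \<open>{0..<\<tau>}\<close> by intervals of lengths
  \<open>2 * C * diameter (U i) powr \<beta>\<close>, whose sum is too small if
  \<open>s < \<beta>\<close>. The map \<open>p\<close> may be an arbitrary selection of
  points.\<close>

lemma hausdorff_dim_ge_of_holder:
  fixes A :: "'a::metric_space set" and p :: "real \<Rightarrow> 'a"
  assumes \<tau>: "0 < \<tau>" and C: "0 < C"
    and pA: "\<And>t. t \<in> {0..<\<tau>} \<Longrightarrow> p t \<in> A"
    and hol: "\<And>s t. s \<in> {0..<\<tau>} \<Longrightarrow> t \<in> {0..<\<tau>} \<Longrightarrow> \<bar>s - t\<bar> \<le> C * dist (p s) (p t) powr \<beta>"
  shows "ereal \<beta> \<le> hausdorff_dim A"
  unfolding hausdorff_dim_def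
proof (rule Inf_greatest, clarify)
  fix s :: real assume s: "0 \<le> s" "hausdorff_measure s A = 0"
  show "ereal \<beta> \<le> ereal s"
  proof (rule ccontr)
    assume "\<not> ereal \<beta> \<le> ereal s"
    then have sb: "s < \<beta>" by simp
    \<comment> \<open>With this bound on the sum the intervals below have total length at most
      \<open>\<tau>/2\<close>.\<close>
    have "\<tau> / (4*C) > 0" using \<tau> C by simp
    from hausdorff_measure_eq_0D[OF s(2) this, of 1]
    obtain U :: "nat \<Rightarrow> 'a set"
      where U: "A \<subseteq> (\<Union>i. U i)" "\<And>i. bounded (U i)" "\<And>i. diameter (U i) \<le> 1"
        "(\<Sum>i. diam_pow s (U i)) < ennreal (\<tau> / (4*C))" by auto
    define V where "V i = {t\<in>{0..<\<tau>}. p t \<in> U i}" for i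
    \<comment> \<open>\<open>V i\<close> may fail to be measurable, so it is enclosed in an interval
      around one of its points.\<close>
    define W where "W i = (if V i = {} then {} else
      {(SOME t. t \<in> V i) - C * diameter (U i) powr \<beta> .. (SOME t. t \<in> V i) + C * diameter (U i) powr \<beta>})" for i
    have VW: "V i \<subseteq> W i" for i
    proof
      fix t assume t: "t \<in> V i"
      define u where "u = (SOME t. t \<in> V i)"
      have u: "u \<in> V i" using t unfolding u_def by (rule someI)
      have "\<bar>u - t\<bar> \<le> C * dist (p u) (p t) powr \<beta>"
        using u t unfolding V_def by (intro hol) auto
      also have "\<dots> \<le> C * diameter (U i) powr \<beta>"
        using u t C sb s unfolding V_def
        by (intro mult_left_mono powr_mono2 diameter_bounded_bound U) auto
      finally show "t \<in> W i" using t by (auto simp: W_def u_def[symmetric])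
    qed
    have W: "W i \<in> sets lborel" for i by (auto simp: W_def)
    have eW: "emeasure lborel (W i) \<le> ennreal (2*C) * diam_pow s (U i)" for i
    proof (cases "V i = {}")
      case True then show ?thesis by (simp add: W_def)
    next
      case False
      then have ne: "U i \<noteq> {}" by (auto simp: V_def)
      have "diameter (U i) powr \<beta> \<le> diameter (U i) powr s"
        using U(3)[of i] sb diameter_ge_0[OF U(2)] by (intro powr_mono') auto
      moreover have "diameter (U i) powr \<beta> \<le> 1"
        using U(3)[of i] s sb diameter_ge_0[OF U(2)] by (simp add: powr_le1)
      ultimately have le: "ennreal (diameter (U i) powr \<beta>) \<le> diam_pow s (U i)"
        using ne by (auto simp: diam_pow_def intro!: ennreal_leI)
      have "emeasure lborel (W i) = ennreal (2*C) * ennreal (diameter (U i) powr \<beta>)"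
        using False C by (simp add: W_def flip: ennreal_mult)
      also have "\<dots> \<le> ennreal (2*C) * diam_pow s (U i)" using le by (rule mult_left_mono) simp
      finally show ?thesis .
    qed
    have "{0..<\<tau>} \<subseteq> (\<Union>i. W i)"
    proof
      fix t assume t: "t \<in> {0..<\<tau>}"
      then obtain i where "p t \<in> U i" using U(1) pA by blast
      with t have "t \<in> V i" by (simp add: V_def)
      then show "t \<in> (\<Union>i. W i)" using VW by blast
    qed
    then have "emeasure lborel {0..<\<tau>} \<le> emeasure lborel (\<Union>i. W i)"
      using W by (intro emeasure_mono) auto
    also have "\<dots> \<le> (\<Sum>i. emeasure lborel (W i))"
      using W by (intro emeasure_subadditive_countably) auto
    also have "\<dots> \<le> (\<Sum>i. ennreal (2*C) * diam_pow s (U i))"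
      by (intro suminf_le eW) auto
    also have "\<dots> = ennreal (2*C) * (\<Sum>i. diam_pow s (U i))" by simp
    also have "\<dots> \<le> ennreal (2*C) * ennreal (\<tau> / (4*C))"
      using U(4) by (intro mult_left_mono) auto
    also have "\<dots> = ennreal (\<tau>/2)" using C \<tau> by (simp flip: ennreal_mult)
    finally show False using \<tau> by simp
  qed
qed

section \<open>Covering numbers and lower box dimension\<close>

lemma covering_number_le:
  assumes "finite \<C>" "A \<subseteq> \<Union>\<C>" "\<And>U. U \<in> \<C> \<Longrightarrow> bounded U \<and> diameter U \<le> \<delta>"
  shows "covering_number \<delta> A \<le> card \<C>"
  unfolding covering_number_def using assms by (intro Least_le exI[of _ \<C>]) auto

lemma covering_number_cover:
  fixes A :: "'a::metric_space set"
  assumes "compact A" "\<delta> > 0"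
  shows "\<exists>\<C>. finite \<C> \<and> card \<C> = covering_number \<delta> A \<and> A \<subseteq> \<Union>\<C> \<and>
    (\<forall>U\<in>\<C>. bounded U \<and> diameter U \<le> \<delta>)"
proof -
  let ?P = "\<lambda>n. \<exists>\<C>. finite \<C> \<and> card \<C> = n \<and> A \<subseteq> \<Union>\<C> \<and> (\<forall>U\<in>\<C>. bounded U \<and> diameter U \<le> \<delta>)"
  have "\<exists>n. ?P n"
  proof -
    obtain K where K: "finite K" "K \<subseteq> A" "A \<subseteq> (\<Union>x\<in>K. ball x (\<delta>/2))"
      using compactE_image[OF assms(1), of A "\<lambda>x. ball x (\<delta>/2)"] assms(2)
      by (metis UN_I centre_in_ball half_gt_zero open_ball subsetI)
    have "diameter (ball x (\<delta>/2)) \<le> \<delta>" for x :: 'a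
    proof (rule diameter_le_dist)
      fix y z assume "y \<in> ball x (\<delta>/2)" "z \<in> ball x (\<delta>/2)"
      then show "dist y z \<le> \<delta>" using dist_triangle[of y z x] by (simp add: dist_commute)
    qed (use assms in simp)
    then show ?thesis
      using K by (intro exI[of _ "card ((\<lambda>x. ball x (\<delta>/2)) ` K)"] exI[of _ "(\<lambda>x. ball x (\<delta>/2)) ` K"]) auto
  qed
  from LeastI_ex[OF this] show ?thesis unfolding covering_number_def .
qed

lemma lower_box_dim_lessD:
  assumes "lower_box_dim A < ereal e" "b > 0"
  shows "\<exists>\<delta>. 0 < \<delta> \<and> \<delta> < b \<and> ln (real (covering_number \<delta> A)) / - ln \<delta> < e"
proof (rule ccontr)
  assume *: "\<not> ?thesis"
  have "e \<le> ln (real (covering_number \<delta> A)) / - ln \<delta>" if "0 < \<delta>" "\<delta> < b" for \<delta>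
    using * that by (meson not_le)
  then have "\<forall>\<^sub>F \<delta> in at_right 0. ereal e \<le> ereal (ln (real (covering_number \<delta> A)) / - ln \<delta>)"
    unfolding eventually_at_right_field using assms(2) by (intro exI[of _ b]) (simp del: divide_minus_right)
  then have "ereal e \<le> lower_box_dim A"
    unfolding lower_box_dim_def by (rule Liminf_bounded)
  with assms(1) show False by simp
qed

lemma lower_box_dim_leI:
  assumes "\<And>b. b > 0 \<Longrightarrow> \<exists>\<delta>. 0 < \<delta> \<and> \<delta> < b \<and> ln (real (covering_number \<delta> A)) / - ln \<delta> \<le> e"
  shows "lower_box_dim A \<le> ereal e"
proof (rule ccontr)
  assume "\<not> ?thesis"
  then have "\<forall>\<^sub>F \<delta> in at_right 0. ereal e < ereal (ln (real (covering_number \<delta> A)) / - ln \<delta>)"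
    unfolding lower_box_dim_def not_le by (rule less_LiminfD)
  then obtain b where b: "b > 0" 
    "\<And>\<delta>. 0 < \<delta> \<Longrightarrow> \<delta> < b \<Longrightarrow> e < ln (real (covering_number \<delta> A)) / - ln \<delta>"
    unfolding eventually_at_right_field by auto
  with assms[of b] show False by fastforce
qed

lemma lower_box_dim_nonneg: "0 \<le> lower_box_dim A"
  unfolding lower_box_dim_def
proof (rule Liminf_bounded)
  have "0 \<le> ln (real n)" for n by (cases n) auto
  then show "\<forall>\<^sub>F \<delta> in at_right 0. 0 \<le> ereal (ln (real (covering_number \<delta> A)) / - ln \<delta>)"
    unfolding eventually_at_right_field by (intro exI[of _ 1]) (auto simp: divide_nonneg_neg divide_nonneg_pos)
qed

lemma ln_nat_div_le:
  fixes c :: nat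
  assumes "real c \<le> \<delta> powr - e" "0 < \<delta>" "\<delta> < 1" "0 \<le> e"
  shows "ln (real c) / - ln \<delta> \<le> e"
proof -
  have l: "- ln \<delta> > 0" using assms by simp
  have "ln (real c) \<le> e * - ln \<delta>"
  proof (cases "c = 0")
    case True then show ?thesis using assms l by (simp add: mult_nonneg_nonpos)
  next
    case False
    then have "ln (real c) \<le> ln (\<delta> powr - e)" using assms by (subst ln_le_cancel_iff) auto
    also have "\<dots> = e * - ln \<delta>" using assms by (simp add: ln_powr)
    finally show ?thesis .
  qed
  then show ?thesis using l by (simp only: pos_divide_le_eq)
qed

lemma ln_nat_div_less:
  fixes c :: nat
  assumes "ln (real c) / - ln \<delta> < e" "0 < \<delta>" "\<delta> < 1"
  shows "real c < \<delta> powr - e"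
proof (cases "c = 0")
  case True then show ?thesis using assms by simp
next
  case False
  have l: "- ln \<delta> > 0" using assms by simp
  have "ln (real c) < e * - ln \<delta>" using assms(1) l by (simp only: pos_divide_less_eq)
  also have "\<dots> = ln (\<delta> powr - e)" using assms by (simp add: ln_powr)
  finally show ?thesis using False assms by (subst (asm) ln_less_cancel_iff) auto
qed

text \<open>Again a form suited to measurability. Passing to open covers doubles the diameters,
  which the gap between two exponents absorbs.\<close>

lemma lower_box_dim_less_iff:
  fixes A :: "'a::metric_space set"
  assumes A: "compact A"
  shows "lower_box_dim A < ereal d \<longleftrightarrow> (\<exists>e\<in>\<rat>. 0 < e \<and> e < d \<and> (\<forall>n. \<exists>\<C> \<delta>. A \<subseteq> \<Union>\<C> \<and>
     (finite \<C> \<and> (\<forall>U\<in>\<C>. open U \<and> bounded U \<and> diameter U \<le> \<delta>) \<and> 0 < \<delta> \<and> \<delta> < 1 \<and>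
      \<delta> < 1 / real (Suc n) \<and> real (card \<C>) < \<delta> powr - e)))" (is "?L \<longleftrightarrow> ?R")
proof
  assume ?L
  then obtain e' where e': "lower_box_dim A < ereal e'" "e' < d"
    using ereal_dense2 by (metis less_ereal.simps(1))
  have e0: "e' > 0" using e'(1) lower_box_dim_nonneg[of A] 
    by (metis ereal_less(2) order_le_less_trans)
  obtain e where e: "e \<in> \<rat>" "e' < e" "e < d" using Rats_dense_in_real[OF e'(2)] by blast
  have "\<exists>\<C> \<delta>. A \<subseteq> \<Union>\<C> \<and>
     (finite \<C> \<and> (\<forall>U\<in>\<C>. open U \<and> bounded U \<and> diameter U \<le> \<delta>) \<and> 0 < \<delta> \<and> \<delta> < 1 \<and>
      \<delta> < 1 / real (Suc n) \<and> real (card \<C>) < \<delta> powr - e)" for n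
  proof -
    \<comment> \<open>The exponential bound is \<open>x powr - e' \<le> (2 * x) powr - e\<close>
      solved for \<open>x\<close>; the bound 1/2 keeps \<open>2 * x\<close> below 1.\<close>
    define b where "b = min (1/2) (min (1 / real (Suc n) / 2) (exp (- (e * ln 2 / (e - e')))))"
    have "b > 0" by (simp add: b_def)
    from lower_box_dim_lessD[OF e'(1) this] obtain x where
      x: "0 < x" "x < b" "ln (real (covering_number x A)) / - ln x < e'" by blast
    have x': "x < 1/2" "x < 1 / real (Suc n) / 2" "x < exp (- (e * ln 2 / (e - e')))"
      using x(2) by (simp_all only: b_def min_less_iff_conj)
    have half: "2 * x < q" if "x < q / 2" for q using that by simp
    note x1 = half[OF x'(1)] half[OF x'(2)] x'(3)
    obtain \<C> where C: "finite \<C>" "card \<C> = covering_number x A" "A \<subseteq> \<Union>\<C>"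
      "\<forall>U\<in>\<C>. bounded U \<and> diameter U \<le> x"
      using covering_number_cover[OF A x(1)] by (elim exE conjE)
    have "\<exists>V. open V \<and> bounded V \<and> U \<subseteq> V \<and> diameter V \<le> 2 * x" if U: "U \<in> \<C>" for U
    proof -
      obtain V where "open V" "bounded V" "U \<subseteq> V" "diameter V \<le> diameter U + x"
        using open_enlargement[of U x thesis] bspec[OF C(4) U] x(1) by blast
      then show ?thesis using bspec[OF C(4) U] by (intro exI[of _ V]) auto
    qed
    then obtain V where V: "\<And>U. U \<in> \<C> \<Longrightarrow> open (V U) \<and> bounded (V U) \<and> U \<subseteq> V U \<and> diameter (V U) \<le> 2 * x"
      by metis
    have cov: "A \<subseteq> \<Union>(V ` \<C>)"
    proof
      fix a assume "a \<in> A"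
      then obtain U where "U \<in> \<C>" "a \<in> U" using C(3) by blast
      then show "a \<in> \<Union>(V ` \<C>)" using V by blast
    qed
    have "real (card (V ` \<C>)) \<le> real (covering_number x A)"
      using C card_image_le[OF C(1), of V] by simp
    also have "\<dots> < x powr - e'"
      using ln_nat_div_less[OF x(3)] x(1) x1(1) by simp
    also have "x powr - e' \<le> (2 * x) powr - e"
    proof -
      have "ln x < - (e * ln 2 / (e - e'))" using x1(3) x(1)
        by (metis exp_gt_zero ln_exp ln_less_cancel_iff)
      then have "e * ln 2 / (e - e') < - ln x" by simp
      then have "e * ln 2 < - ln x * (e - e')" using e by (simp add: pos_divide_less_eq)
      then have "- e' * ln x \<le> - e * ln (2 * x)" using x(1) by (simp add: ln_mult algebra_simps)
      then show ?thesis using x(1) by (simp add: powr_def)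
    qed
    finally have "real (card (V ` \<C>)) < (2 * x) powr - e" .
    then show ?thesis
      using cov C(1) V x1 x(1) by (intro exI[of _ "V ` \<C>"] exI[of _ "2 * x"]) auto
  qed
  then show ?R using e e0 by (intro bexI[of _ e] conjI allI) auto
next
  assume ?R
  then obtain e where e: "0 < e" "e < d" and C: "\<And>n. \<exists>\<C> \<delta>. A \<subseteq> \<Union>\<C> \<and>
     (finite \<C> \<and> (\<forall>U\<in>\<C>. open U \<and> bounded U \<and> diameter U \<le> \<delta>) \<and> 0 < \<delta> \<and> \<delta> < 1 \<and>
      \<delta> < 1 / real (Suc n) \<and> real (card \<C>) < \<delta> powr - e)" by auto
  have "lower_box_dim A \<le> ereal e"
  proof (rule lower_box_dim_leI)
    fix b :: real assume "b > 0"
    then obtain n where n: "1 / real (Suc n) < b" using nat_approx_posE by blast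
    from C[of n] obtain \<C> \<delta> where C: "A \<subseteq> \<Union>\<C>" "finite \<C>" 
      "\<forall>U\<in>\<C>. open U \<and> bounded U \<and> diameter U \<le> \<delta>" "0 < \<delta>" "\<delta> < 1"
      "\<delta> < 1 / real (Suc n)" "real (card \<C>) < \<delta> powr - e" by (elim exE conjE)
    have "covering_number \<delta> A \<le> card \<C>" using C by (intro covering_number_le) auto
    then have "real (covering_number \<delta> A) \<le> \<delta> powr - e" using C(7) by linarith
    then have "ln (real (covering_number \<delta> A)) / - ln \<delta> \<le> e"
      using C e by (intro ln_nat_div_le) auto
    with C n show "\<exists>\<delta>. 0 < \<delta> \<and> \<delta> < b \<and> ln (real (covering_number \<delta> A)) / - ln \<delta> \<le> e"
      by (intro exI[of _ \<delta>]) auto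
  qed
  also have "\<dots> < ereal d" using e by simp
  finally show ?L .
qed

lemma hausdorff_dim_le_lower_box_dim:
  fixes A :: "'a::metric_space set"
  assumes A: "compact A"
  shows "hausdorff_dim A \<le> lower_box_dim A"
proof (rule ccontr)
  assume "\<not> ?thesis"
  then obtain t where t: "lower_box_dim A < ereal t" "ereal t < hausdorff_dim A"
    using ereal_dense2[of "lower_box_dim A" "hausdorff_dim A"] by (auto simp: not_le)
  then obtain e where e: "0 < e" "e < t" and C: "\<And>n. \<exists>\<C> \<delta>. A \<subseteq> \<Union>\<C> \<and>
     (finite \<C> \<and> (\<forall>U\<in>\<C>. open U \<and> bounded U \<and> diameter U \<le> \<delta>) \<and> 0 < \<delta> \<and> \<delta> < 1 \<and>
      \<delta> < 1 / real (Suc n) \<and> real (card \<C>) < \<delta> powr - e)"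
    unfolding lower_box_dim_less_iff[OF A] by auto
  have "hausdorff_measure t A = 0"
  proof (rule hausdorff_measure_eq_0I)
    show "t > 0" using e by simp
    fix \<epsilon> :: real assume \<epsilon>: "\<epsilon> > 0"
    \<comment> \<open>Fewer than \<open>\<delta> powr - e\<close> sets cost at most
      \<open>\<delta> powr (t - e)\<close> in total, which is below \<open>\<epsilon>\<close> once
      \<open>\<delta>\<close> is below this number.\<close>
    have "\<epsilon> powr (1 / (t - e)) > 0" using \<epsilon> by simp
    then obtain n where n: "1 / real (Suc n) < \<epsilon> powr (1 / (t - e))" using nat_approx_posE by blast
    from C[of n] obtain \<C> \<delta> where C: "A \<subseteq> \<Union>\<C>" "finite \<C>" 
      "\<forall>U\<in>\<C>. open U \<and> bounded U \<and> diameter U \<le> \<delta>" "0 < \<delta>" "\<delta> < 1"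
      "\<delta> < 1 / real (Suc n)" "real (card \<C>) < \<delta> powr - e" by (elim exE conjE)
    obtain g where g: "bij_betw g {..<card \<C>} \<C>"
      using ex_bij_betw_nat_finite[OF C(2)] by (auto simp: atLeast0LessThan)
    define U where "U i = (if i < card \<C> then g i else {})" for i
    have gC: "g i \<in> \<C>" if "i < card \<C>" for i using g that by (auto simp: bij_betw_def)
    have cov: "A \<subseteq> (\<Union>i. U i)"
    proof
      fix a assume "a \<in> A"
      then obtain V where "V \<in> \<C>" "a \<in> V" using C(1) by blast
      moreover have "\<C> = g ` {..<card \<C>}" using g by (simp add: bij_betw_def)
      ultimately obtain i where "i < card \<C>" "a \<in> g i" by auto
      then show "a \<in> (\<Union>i. U i)" by (auto simp: U_def)
    qed
    have bd: "bounded (U i)" for i using C(3) gC by (simp add: U_def)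
    have le: "diam_pow t (g i) \<le> ennreal (\<delta> powr t)" if "i < card \<C>" for i
      using C(3) gC[OF that] e diameter_ge_0[of "g i"]
      by (auto simp: diam_pow_def intro!: ennreal_leI powr_mono2)
    have "(\<Sum>i. diam_pow t (U i)) = (\<Sum>i<card \<C>. diam_pow t (U i))"
      by (rule suminf_finite) (auto simp: U_def diam_pow_def)
    also have "\<dots> \<le> (\<Sum>i<card \<C>. ennreal (\<delta> powr t))"
      using le by (intro sum_mono) (auto simp: U_def)
    also have "\<dots> = ennreal (real (card \<C>) * \<delta> powr t)" 
      by (simp add: ennreal_mult ennreal_of_nat_eq_real_of_nat)
    also have "\<dots> < ennreal \<epsilon>"
    proof (rule ennreal_lessI[OF \<epsilon>])
      have "real (card \<C>) * \<delta> powr t < \<delta> powr - e * \<delta> powr t"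
        using C by (intro mult_strict_right_mono) auto
      also have "\<dots> = \<delta> powr (t - e)" using C by (simp flip: powr_add)
      also have "\<dots> < (\<epsilon> powr (1 / (t - e))) powr (t - e)"
        using C(4,6) n e by (intro powr_less_mono2) auto
      also have "\<dots> = \<epsilon>" using e \<epsilon> by (simp add: powr_powr)
      finally show "real (card \<C>) * \<delta> powr t < \<epsilon>" .
    qed
    finally show "\<exists>U :: nat \<Rightarrow> 'a set. A \<subseteq> (\<Union>i. U i) \<and> (\<forall>i. bounded (U i)) \<and>
          (\<Sum>i. diam_pow t (U i)) < ennreal \<epsilon>"
      using cov bd by (intro exI[of _ U] conjI allI)
  qed
  then have "hausdorff_dim A \<le> ereal t"
    unfolding hausdorff_dim_def using e by (intro Inf_lower) auto
  with t show False by simp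
qed

section \<open>Measurability in the level\<close>

text \<open>The complement consists of the values on the compact set \<open>F - V\<close>, and is
  therefore closed.\<close>

lemma open_levels_subset:
  fixes f :: "'a::metric_space \<Rightarrow> real"
  assumes "compact F" "continuous_on F f" "open V"
  shows "open {r. {x\<in>F. f x = r} \<subseteq> V}"
proof -
  have "compact (F - V)" using assms by (simp add: compact_diff)
  then have "compact (f ` (F - V))"
    using assms by (meson Diff_subset compact_continuous_image continuous_on_subset)
  then have "closed (f ` (F - V))" by (rule compact_imp_closed)
  moreover have "{r. {x\<in>F. f x = r} \<subseteq> V} = - f ` (F - V)" by auto
  ultimately show ?thesis by (simp add: open_Compl)
qed

lemma open_levels_covered:
  fixes f :: "'a::metric_space \<Rightarrow> real"
  assumes "compact F" "continuous_on F f" "\<And>U. P U \<Longrightarrow> open (V U)"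
  shows "open {r. \<exists>U. {x\<in>F. f x = r} \<subseteq> V U \<and> P U}"
proof -
  have "{r. \<exists>U. {x\<in>F. f x = r} \<subseteq> V U \<and> P U} = (\<Union>U\<in>Collect P. {r. {x\<in>F. f x = r} \<subseteq> V U})" by auto
  then show ?thesis using open_levels_subset[OF assms(1,2) assms(3)] by (simp add: open_UN)
qed

text \<open>Common form of both dimensions: \<open>U\<close> is a cover, \<open>V U\<close> its
  union, and \<open>P e n U\<close> collects the conditions that do not mention the level.\<close>

lemma borel_levels:
  fixes f :: "'a::metric_space \<Rightarrow> real"
  assumes "compact F" "continuous_on F f" "\<And>e n U. e \<in> S \<Longrightarrow> P e n U \<Longrightarrow> open (V U)" "countable S"
  shows "{r. \<exists>e\<in>S. \<forall>n::nat. \<exists>U. {x\<in>F. f x = r} \<subseteq> V U \<and> P e n U} \<in> sets borel"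
proof -
  have "{r. \<exists>e\<in>S. \<forall>n. \<exists>U. {x\<in>F. f x = r} \<subseteq> V U \<and> P e n U} =
    (\<Union>e\<in>S. \<Inter>n. {r. \<exists>U. {x\<in>F. f x = r} \<subseteq> V U \<and> P e n U})" by auto
  moreover have "(\<Inter>n. {r. \<exists>U. {x\<in>F. f x = r} \<subseteq> V U \<and> P e n U}) \<in> sets borel" if "e \<in> S" for e
    using open_levels_covered[OF assms(1,2), of "P e _" V] assms(3)[OF that]
    by (intro sets.countable_INT') auto
  ultimately show ?thesis using assms(4) by (auto intro!: sets.countable_UN')
qed

lemma borel_hausdorff_dim_levels:
  fixes f :: "'a::metric_space \<Rightarrow> real"
  assumes "compact F" "continuous_on F f"
  shows "{r. ereal d \<le> hausdorff_dim {x\<in>F. f x = r}} \<in> sets borel"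
proof -
  have "{r. \<exists>t\<in>\<rat> \<inter> {0<..<d}. \<forall>n. \<exists>U :: nat \<Rightarrow> 'a set. {x\<in>F. f x = r} \<subseteq> (\<Union>i. U i) \<and>
     ((\<forall>i. open (U i) \<and> bounded (U i)) \<and> (\<Sum>i. diam_pow t (U i)) < ennreal (1 / real (Suc n)))} \<in> sets borel"
    by (rule borel_levels[OF assms]) (auto simp: countable_rat)
  also have "{r. \<exists>t\<in>\<rat> \<inter> {0<..<d}. \<forall>n. \<exists>U :: nat \<Rightarrow> 'a set. {x\<in>F. f x = r} \<subseteq> (\<Union>i. U i) \<and>
     ((\<forall>i. open (U i) \<and> bounded (U i)) \<and> (\<Sum>i. diam_pow t (U i)) < ennreal (1 / real (Suc n)))} =
     {r. hausdorff_dim {x\<in>F. f x = r} < ereal d}"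
    unfolding hausdorff_dim_less_iff by (simp add: Bex_def)
  finally have "- {r. hausdorff_dim {x\<in>F. f x = r} < ereal d} \<in> sets borel" by (rule borel_comp)
  then show ?thesis by (simp add: Compl_eq not_less)
qed

lemma compact_level:
  fixes f :: "'a::metric_space \<Rightarrow> real"
  assumes "compact F" "continuous_on F f"
  shows "compact {x\<in>F. f x = r}"
proof -
  have "closedin (top_of_set F) (F \<inter> f -` {r})"
    using assms(2) continuous_closedin_preimage by blast
  then have "compact (F \<inter> f -` {r})" using assms(1) closedin_compact by blast
  moreover have "F \<inter> f -` {r} = {x\<in>F. f x = r}" by auto
  ultimately show ?thesis by simp
qed

lemma borel_lower_box_dim_levels:
  fixes f :: "'a::metric_space \<Rightarrow> real"
  assumes "compact F" "continuous_on F f"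
  shows "{r. ereal d \<le> lower_box_dim {x\<in>F. f x = r}} \<in> sets borel"
proof -
  let ?P = "\<lambda>e n (\<C> :: 'a set set). \<exists>\<delta>. finite \<C> \<and> (\<forall>U\<in>\<C>. open U \<and> bounded U \<and> diameter U \<le> \<delta>) \<and> 0 < \<delta> \<and> \<delta> < 1 \<and>
      \<delta> < 1 / real (Suc n) \<and> real (card \<C>) < \<delta> powr - e"
  have "{r. \<exists>e\<in>\<rat> \<inter> {0<..<d}. \<forall>n. \<exists>\<C>. {x\<in>F. f x = r} \<subseteq> \<Union>\<C> \<and> ?P e n \<C>} \<in> sets borel"
    by (rule borel_levels[OF assms]) (auto simp: countable_rat)
  also have "{r. \<exists>e\<in>\<rat> \<inter> {0<..<d}. \<forall>n. \<exists>\<C>. {x\<in>F. f x = r} \<subseteq> \<Union>\<C> \<and> ?P e n \<C>} =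
     {r. lower_box_dim {x\<in>F. f x = r} < ereal d}"
    unfolding lower_box_dim_less_iff[OF compact_level[OF assms]] by (simp add: Bex_def)
  finally have "- {r. lower_box_dim {x\<in>F. f x = r} < ereal d} \<in> sets borel" by (rule borel_comp)
  then show ?thesis by (simp add: Compl_eq not_less)
qed

section \<open>The geometry of the fractal\<close>

text \<open>Tracing a point of \<open>A\<close> back through \<open>n\<close> maps shows that its
  distance to \<open>S\<close> is at most \<open>c ^ n\<close> times a constant. Of \<open>A\<close>
  only boundedness and self-covering are asked, so that this applies to the fractal inside the unit
  square and also to the set of Cantor lines inside the fractal, which is not closed.\<close>

lemma self_covered_subset:
  fixes \<Phi> :: "('a::euclidean_space \<Rightarrow> 'a) set"
  assumes \<Phi>: "\<And>\<phi>. \<phi> \<in> \<Phi> \<Longrightarrow> \<exists>v. \<phi> = (\<lambda>z. c *\<^sub>R z + v)" and c: "0 \<le> c" "c < 1"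
    and A: "bounded A" "A \<subseteq> (\<Union>\<phi>\<in>\<Phi>. \<phi> ` A)"
    and S: "closed S" "S \<noteq> {}" "\<And>\<phi>. \<phi> \<in> \<Phi> \<Longrightarrow> \<phi> ` S \<subseteq> S"
  shows "A \<subseteq> S"
proof
  obtain s where s: "s \<in> S" using S by blast
  obtain B where B: "\<And>z. z \<in> A \<Longrightarrow> dist s z \<le> B"
    using A(1) unfolding bounded_any_center[of A s] by blast
  have le: "infdist z S \<le> c ^ n * B" if "z \<in> A" for z n
    using that
  proof (induction n arbitrary: z)
    case 0
    have "infdist z S \<le> dist z s" by (rule infdist_le[OF s])
    then show ?case using B[OF 0] by (simp add: dist_commute)
  next
    case (Suc n)
    then obtain \<phi> y where y: "\<phi> \<in> \<Phi>" "y \<in> A" "z = \<phi> y" using A(2) by blast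
    obtain v where v: "\<phi> = (\<lambda>z. c *\<^sub>R z + v)" using \<Phi> y(1) by blast
    obtain l where l: "l \<in> S" "infdist y S = dist y l"
      using infdist_attains_inf[of S y] S by blast
    have "\<phi> l \<in> S" using S(3) l(1) y(1) by blast
    then have "infdist z S \<le> dist (\<phi> y) (\<phi> l)" using y(3) by (simp add: infdist_le)
    also have "\<dots> = c * dist y l"
      using c by (simp add: v dist_norm flip: scaleR_diff_right)
    also have "\<dots> \<le> c * (c ^ n * B)"
      using l(2) Suc.IH[OF y(2)] c by (simp add: mult_left_mono)
    finally show ?case by simp
  qed
  fix z assume z: "z \<in> A"
  have "(\<lambda>n. c ^ n * B) \<longlonglongrightarrow> 0 * B"
    using c by (intro tendsto_intros LIMSEQ_power_zero) auto
  then have "infdist z S \<le> 0"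
    using le[OF z] by (intro LIMSEQ_le_const[where X = "\<lambda>n. c ^ n * B"]) auto
  then have "infdist z S = 0" using infdist_nonneg[of z S] by linarith
  then show "z \<in> S" using in_closed_iff_infdist_zero S by blast
qed

section \<open>Which squares of the tiling are kept\<close>

lemma frontier_rectangle:
  fixes a b c d :: real
  assumes "a < b" "c < d"
  shows "frontier ({a..b} \<times> {c..d}) = {a..b} \<times> {c, d} \<union> {a, b} \<times> {c..d}"
  using assms by (auto simp: frontier_def closure_Times interior_Times)

lemma image_unit_square:
  assumes "c > 0"
  shows "(\<lambda>z. c *\<^sub>R z + v) ` unit_square = {fst v..fst v + c} \<times> {snd v..snd v + c}" (is "?L = ?R")
proof
  show "?L \<subseteq> ?R" using assms by (cases v) (auto simp: unit_square_def mult_left_le)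
  show "?R \<subseteq> ?L"
  proof clarify
    fix x y assume "x \<in> {fst v..fst v + c}" "y \<in> {snd v..snd v + c}"
    then show "(x, y) \<in> ?L"
      using assms by (intro image_eqI[of _ _ "((x - fst v) / c, (y - snd v) / c)"])
        (auto simp: unit_square_def prod_eq_iff field_simps)
  qed
qed

text \<open>For \<open>m \<ge> 1\<close> these are the \<open>i\<close> such that 1/2 is an end
  point of the interval from \<open>i / 2^m\<close> to \<open>(i+1) / 2^m\<close>.\<close>

definition mid_index :: "nat \<Rightarrow> nat \<Rightarrow> bool" where
  "mid_index m i \<longleftrightarrow> i = 2 ^ (m - 1) - 1 \<or> i = 2 ^ (m - 1)"

definition end_index :: "nat \<Rightarrow> nat \<Rightarrow> bool" where
  "end_index m i \<longleftrightarrow> i = 0 \<or> i = 2 ^ m - 1"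

definition cell_map :: "nat \<Rightarrow> nat \<Rightarrow> nat \<Rightarrow> real \<times> real \<Rightarrow> real \<times> real" where
  "cell_map m i j = (\<lambda>z. (1 / 2^m) *\<^sub>R z + (real i / 2^m, real j / 2^m))"

lemma cell_map_image:
  "cell_map m i j ` unit_square =
    {real i / 2^m .. real (i+1) / 2^m} \<times> {real j / 2^m .. real (j+1) / 2^m}"
  unfolding cell_map_def by (subst image_unit_square) (auto simp: add_divide_distrib)

text \<open>For \<open>m = 1\<close> the middle indices 0 and 1 would be end indices, and no square
  would be omitted.\<close>

lemma mid_index_not_end:
  assumes "m \<ge> 2" "mid_index m i" shows "1 \<le> i" "i + 2 \<le> 2 ^ m"
proof -
  have "(2::nat) ^ 1 \<le> 2 ^ (m - 1)" using assms by (intro power_increasing) auto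
  moreover have "(2::nat) ^ m = 2 * 2 ^ (m - 1)" using assms by (simp flip: power_Suc)
  ultimately show "1 \<le> i" "i + 2 \<le> 2 ^ m" using assms(2) by (auto simp: mid_index_def)
qed

lemma not_end_index:
  assumes "j < 2 ^ m" "\<not> end_index m j" shows "1 \<le> j" "j + 2 \<le> 2 ^ m"
  using assms by (auto simp: end_index_def)

lemma mid_index_half:
  assumes "m \<ge> 2" "mid_index m i"
  shows "1/2 = real i / 2^m \<or> 1/2 = real (i+1) / 2^m"
proof -
  have "(2::real) ^ m = 2 * 2 ^ (m - 1)" using assms by (simp flip: power_Suc)
  moreover have "real (2 ^ (m - 1) - 1) = 2 ^ (m - 1) - 1" by (simp add: of_nat_diff)
  ultimately show ?thesis using assms(2) by (auto simp: mid_index_def)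
qed

lemma inner_cell_frontier:
  assumes i: "1 \<le> i" "i + 2 \<le> 2 ^ m" and j: "1 \<le> j" "j + 2 \<le> 2 ^ m"
  shows "frontier (cell_map m i j ` unit_square) \<inter> frontier unit_square = {}"
proof -
  have *: "0 < real k / 2^m \<and> real (k+1) / 2^m < 1" if "1 \<le> k" "k + 2 \<le> 2 ^ m" for k
  proof -
    have "real (k + 2) \<le> real (2^m)" using that(2) by (simp only: of_nat_le_iff)
    then show ?thesis using that by (auto simp: field_simps)
  qed
  have "frontier (cell_map m i j ` unit_square) \<subseteq> cell_map m i j ` unit_square"
    by (rule frontier_subset_closed) (simp add: cell_map_image closed_Times)
  also have "\<dots> \<subseteq> {0<..<1} \<times> {0<..<1}"
  proof -
    have "{real k / 2^m .. real (k+1) / 2^m} \<subseteq> {0<..<1}" if "1 \<le> k" "k + 2 \<le> 2 ^ m" for k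
      using *[OF that] by (intro subsetI) (simp only: atLeastAtMost_iff greaterThanLessThan_iff, linarith)
    then show ?thesis unfolding cell_map_image using i j by (intro Sigma_mono) auto
  qed
  finally show ?thesis
    unfolding unit_square_def frontier_rectangle[OF zero_less_one zero_less_one] by auto
qed

lemma mid_cell_frontier:
  assumes "m \<ge> 2" "i < 2 ^ m" "j < 2 ^ m" "mid_index m i \<or> mid_index m j"
  shows "frontier (cell_map m i j ` unit_square) \<inter> midsegments \<noteq> {}"
proof -
  have lt: "real k / 2^m < real (k+1) / 2^m" for k by (simp add: field_simps)
  have 01: "real k / 2^m \<in> {0..1}" if "k < 2 ^ m" for k
  proof -
    have "real k \<le> real (2^m)" using that by (simp only: of_nat_le_iff)
    then show ?thesis by simp
  qed
  have fr: "frontier (cell_map m i j ` unit_square) =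
      {real i / 2^m .. real (i+1) / 2^m} \<times> {real j / 2^m, real (j+1) / 2^m} \<union>
      {real i / 2^m, real (i+1) / 2^m} \<times> {real j / 2^m .. real (j+1) / 2^m}"
    unfolding cell_map_image by (rule frontier_rectangle[OF lt lt])
  from assms(4) show ?thesis
  proof
    assume "mid_index m i"
    from mid_index_half[OF assms(1) this] lt[of j]
    have "(1/2, real j / 2^m) \<in> frontier (cell_map m i j ` unit_square)" unfolding fr by auto
    moreover have "(1/2, real j / 2^m) \<in> midsegments" using 01[OF assms(3)] by (auto simp: midsegments_def)
    ultimately show ?thesis by blast
  next
    assume "mid_index m j"
    from mid_index_half[OF assms(1) this] lt[of i]
    have "(real i / 2^m, 1/2) \<in> frontier (cell_map m i j ` unit_square)" unfolding fr by auto
    moreover have "(real i / 2^m, 1/2) \<in> midsegments" using 01[OF assms(2)] by (auto simp: midsegments_def)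
    ultimately show ?thesis by blast
  qed
qed

text \<open>A square in a middle column or row survives only by touching the boundary of the unit
  square, which forces its other index to be an end index.\<close>

lemma boxplus_ifs_cases:
  assumes m: "m \<ge> 2" and \<phi>: "\<phi> \<in> boxplus_ifs m"
  obtains i j where "i < 2 ^ m" "j < 2 ^ m" "\<phi> = cell_map m i j"
    "mid_index m i \<Longrightarrow> end_index m j" "mid_index m j \<Longrightarrow> end_index m i"
proof -
  obtain v where v: "\<phi> = (\<lambda>z. (1 / 2^m) *\<^sub>R z + v)" "\<phi> ` unit_square \<in> boxplus_squares m"
    using \<phi> unfolding boxplus_ifs_def by blast
  obtain i j where ij: "i < 2 ^ m" "j < 2 ^ m" "\<phi> ` unit_square =
      {real i / 2^m .. real (i+1) / 2^m} \<times> {real j / 2^m .. real (j+1) / 2^m}"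
    using v(2) unfolding boxplus_squares_def tiling_def by blast
  have "{fst v..fst v + 1 / 2^m} \<times> {snd v..snd v + 1 / 2^m} =
      {real i / 2^m .. real (i+1) / 2^m} \<times> {real j / 2^m .. real (j+1) / 2^m}"
    using ij(3) unfolding v(1) by (subst (asm) image_unit_square) auto
  then have "fst v = real i / 2^m \<and> snd v = real j / 2^m"
    by (auto simp: times_eq_iff Icc_eq_Icc add_divide_distrib)
  then have \<phi>': "\<phi> = cell_map m i j" unfolding v(1) cell_map_def by (cases v) auto
  have kept: "\<not> (frontier (cell_map m i j ` unit_square) \<inter> midsegments \<noteq> {} \<and>
      frontier (cell_map m i j ` unit_square) \<inter> frontier unit_square = {})"
    using v(2) unfolding \<phi>' boxplus_squares_def by blast
  show ?thesis
  proof (rule that[OF ij(1,2) \<phi>'])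
    show "end_index m j" if "mid_index m i"
      using kept mid_cell_frontier[OF m ij(1,2)] that inner_cell_frontier[OF mid_index_not_end[OF m that]]
        not_end_index[OF ij(2)] by blast
    show "end_index m i" if "mid_index m j"
      using kept mid_cell_frontier[OF m ij(1,2)] that inner_cell_frontier[OF _ _ mid_index_not_end[OF m that]]
        not_end_index[OF ij(1)] by blast
  qed
qed

text \<open>The full bottom and top rows of squares; the horizontal Cantor lines pass through these
  rows at every scale.\<close>

lemma cell_map_boundary:
  assumes "i < 2 ^ m" "j < 2 ^ m" "end_index m j"
  shows "cell_map m i j \<in> boxplus_ifs m"
proof -
  have lt: "real k / 2^m < real (k+1) / 2^m" for k by (simp add: field_simps)
  have fr: "frontier (cell_map m i j ` unit_square) =
      {real i / 2^m .. real (i+1) / 2^m} \<times> {real j / 2^m, real (j+1) / 2^m} \<union>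
      {real i / 2^m, real (i+1) / 2^m} \<times> {real j / 2^m .. real (j+1) / 2^m}"
    unfolding cell_map_image by (rule frontier_rectangle[OF lt lt])
  have "real i \<le> real (2^m)" using assms(1) by (simp only: of_nat_le_iff)
  then have i01: "real i / 2^m \<in> {0..1}" by simp
  have "real (2 ^ m - 1) + 1 = 2 ^ m" by (simp add: of_nat_diff)
  then have "real j / 2^m = 0 \<or> real (j+1) / 2^m = 1"
    using assms(3) by (auto simp: end_index_def)
  then obtain y :: real where y: "y = 0 \<or> y = 1" "y \<in> {real j / 2^m, real (j+1) / 2^m}"
    by (metis insertCI)
  have "(real i / 2^m, y) \<in> frontier (cell_map m i j ` unit_square)"
    unfolding fr using y(2) lt[of i] by auto
  moreover have "(real i / 2^m, y) \<in> frontier unit_square"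
    unfolding unit_square_def frontier_rectangle[OF zero_less_one zero_less_one] using y(1) i01 by auto
  ultimately have "cell_map m i j ` unit_square \<in> boxplus_squares m"
    unfolding boxplus_squares_def tiling_def using assms(1,2) cell_map_image by blast
  then show ?thesis unfolding boxplus_ifs_def cell_map_def by blast
qed

lemma boxplus_ifs_form: "\<phi> \<in> boxplus_ifs m \<Longrightarrow> \<exists>v. \<phi> = (\<lambda>z. (1 / 2^m) *\<^sub>R z + v)"
  unfolding boxplus_ifs_def by blast

lemma
  assumes "m \<ge> 1"
  shows compact_boxplus: "compact (boxplus m)" and boxplus_nonempty: "boxplus m \<noteq> {}"
    and boxplus_eq: "boxplus m = (\<Union>\<phi>\<in>boxplus_ifs m. \<phi> ` boxplus m)"
  using is_attractor_boxplus[OF assms] unfolding is_attractor_def by blast+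

lemma boxplus_subset_unit_square:
  assumes m: "m \<ge> 2"
  shows "boxplus m \<subseteq> unit_square"
proof (rule self_covered_subset[OF boxplus_ifs_form])
  show "bounded (boxplus m)" "boxplus m \<subseteq> (\<Union>\<phi>\<in>boxplus_ifs m. \<phi> ` boxplus m)"
    using compact_boxplus boxplus_eq m by (auto simp: compact_imp_bounded)
  show "closed unit_square" "unit_square \<noteq> {}"
    by (auto simp: unit_square_def closed_Times)
  have 1: "real (k+1) / 2^m \<le> 1" if "k < 2^m" for k
  proof -
    have "real (k+1) \<le> real (2^m)" using that by (simp only: of_nat_le_iff)
    then show ?thesis by simp
  qed
  fix \<phi> assume "\<phi> \<in> boxplus_ifs m"
  then obtain i j where "i < 2 ^ m" "j < 2 ^ m" "\<phi> = cell_map m i j"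
    using boxplus_ifs_cases[OF m] by blast
  moreover have "{real k / 2^m .. real (k+1) / 2^m} \<subseteq> {0..1}" if "k < 2 ^ m" for k
    using 1[OF that] by (meson atLeastatMost_subset_iff of_nat_0_le_iff zero_le_divide_iff zero_le_numeral zero_le_power)
  ultimately show "\<phi> ` unit_square \<subseteq> unit_square"
    by (simp only: cell_map_image) (simp add: unit_square_def Sigma_mono)
qed (use m in auto)

lemma self_covered_subset_boxplus:
  assumes m: "m \<ge> 2" and A: "A \<subseteq> unit_square"
    and cov: "\<And>z. z \<in> A \<Longrightarrow> \<exists>i j w. i < 2 ^ m \<and> j < 2 ^ m \<and> end_index m j \<and> w \<in> A \<and> z = cell_map m i j w"
  shows "A \<subseteq> boxplus m"
proof (rule self_covered_subset[OF boxplus_ifs_form])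
  have "bounded unit_square" by (simp add: unit_square_def bounded_Times)
  then show "bounded A" using A bounded_subset by blast
  show "A \<subseteq> (\<Union>\<phi>\<in>boxplus_ifs m. \<phi> ` A)"
    using cov cell_map_boundary by blast
  show "\<phi> ` boxplus m \<subseteq> boxplus m" if "\<phi> \<in> boxplus_ifs m" for \<phi>
    using boxplus_eq[of m] that m by auto
  show "closed (boxplus m)" "boxplus m \<noteq> {}"
    using compact_boxplus[of m] boxplus_nonempty[of m] m by (auto simp: compact_imp_closed)
qed (use m in auto)

section \<open>The Cantor set of complete horizontal lines\<close>

definition bin_digit :: "real \<Rightarrow> real" where
  "bin_digit t = (if t < 1/2 then 0 else 1)"

definition bin_shift :: "real \<Rightarrow> real" where
  "bin_shift t = (if t < 1/2 then 2 * t else 2 * t - 1)"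

text \<open>Replaces the binary digits \<open>0\<close> and \<open>1\<close> of \<open>t\<close> by the base \<open>N\<close> digits \<open>0\<close> and \<open>N - 1\<close>.\<close>

definition cantor_point :: "real \<Rightarrow> real \<Rightarrow> real" where
  "cantor_point N t = (\<Sum>k. bin_digit ((bin_shift ^^ k) t) * ((N - 1) / N * (1 / N) ^ k))"

lemma bin_shift_range: "t \<in> {0..<1} \<Longrightarrow> bin_shift t \<in> {0..<1}"
  by (auto simp: bin_shift_def)

context
  fixes N :: real
  assumes N: "N \<ge> 4"
begin

lemma cantor_weights_sums: "(\<lambda>k. (N - 1) / N * (1 / N) ^ k) sums 1"
proof -
  have "(\<lambda>k. (N - 1) / N * (1 / N) ^ k) sums ((N - 1) / N * (1 / (1 - 1 / N)))"
    using N by (intro sums_mult geometric_sums) auto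
  also have "(N - 1) / N * (1 / (1 - 1 / N)) = 1" using N by (simp add: field_simps)
  finally show ?thesis .
qed

lemma bin_digit_range: "0 \<le> bin_digit t" "bin_digit t \<le> 1"
  by (auto simp: bin_digit_def)

lemma cantor_summable: "summable (\<lambda>k. bin_digit ((bin_shift ^^ k) t) * ((N - 1) / N * (1 / N) ^ k))"
proof (rule summable_comparison_test'[OF sums_summable[OF cantor_weights_sums]])
  fix k :: nat
  show "norm (bin_digit ((bin_shift ^^ k) t) * ((N - 1) / N * (1 / N) ^ k)) \<le> (N - 1) / N * (1 / N) ^ k"
    using N bin_digit_range[of "(bin_shift ^^ k) t"]
    using mult_left_le_one_le[of "(N - 1) / N * (1 / N) ^ k" "bin_digit ((bin_shift ^^ k) t)"]
    by (simp only: real_norm_def abs_mult) simp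
qed

lemma cantor_point_range: "0 \<le> cantor_point N t" "cantor_point N t \<le> 1"
proof -
  have nn: "0 \<le> (N - 1) / N * (1 / N) ^ k" for k using N by simp
  show "0 \<le> cantor_point N t"
    unfolding cantor_point_def
    by (intro suminf_nonneg cantor_summable mult_nonneg_nonneg[OF bin_digit_range(1) nn])
  have "cantor_point N t \<le> (\<Sum>k. (N - 1) / N * (1 / N) ^ k)"
    unfolding cantor_point_def
    by (intro suminf_le cantor_summable sums_summable[OF cantor_weights_sums]
        mult_left_le_one_le[OF nn bin_digit_range])
  then show "cantor_point N t \<le> 1" using sums_unique[OF cantor_weights_sums] by simp
qed

lemma cantor_point_rec: "cantor_point N t = (bin_digit t * (N - 1) + cantor_point N (bin_shift t)) / N"
proof -
  let ?f = "\<lambda>t k. bin_digit ((bin_shift ^^ k) t) * ((N - 1) / N * (1 / N) ^ k)"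
  have "cantor_point N t = ?f t 0 + (\<Sum>k. ?f t (Suc k))"
    unfolding cantor_point_def using suminf_split_head[OF cantor_summable[of t]] by simp
  also have "(\<Sum>k. ?f t (Suc k)) = (\<Sum>k. (1 / N) * ?f (bin_shift t) k)"
    by (intro suminf_cong) (simp add: funpow_swap1)
  also have "\<dots> = (1 / N) * cantor_point N (bin_shift t)"
    unfolding cantor_point_def by (intro suminf_mult cantor_summable)
  finally show ?thesis using N by (simp add: field_simps)
qed

text \<open>If the leading digits agree, shifting both points doubles \<open>s - t\<close> and
  multiplies the separation by \<open>N\<close>; if they differ, they leave a gap of
  \<open>(N - 2) / N\<close>, at least 1/2 as \<open>N \<ge> 4\<close>.\<close>

lemma cantor_point_separation:
  assumes "s \<in> {0..<1}" "t \<in> {0..<1}" "1 / 2 ^ n < \<bar>s - t\<bar>"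
  shows "1 / N ^ n / 2 \<le> \<bar>cantor_point N s - cantor_point N t\<bar>"
  using assms
proof (induction n arbitrary: s t)
  case 0
  then show ?case by auto
next
  case (Suc n)
  have diff: "cantor_point N s - cantor_point N t = ((bin_digit s - bin_digit t) * (N - 1) +
      (cantor_point N (bin_shift s) - cantor_point N (bin_shift t))) / N"
    unfolding cantor_point_rec[of s] cantor_point_rec[of t] by (simp add: diff_divide_distrib[symmetric] algebra_simps)
  show ?case
  proof (cases "bin_digit s = bin_digit t")
    case True
    then have "bin_shift s - bin_shift t = 2 * (s - t)"
      by (auto simp: bin_digit_def bin_shift_def split: if_splits)
    then have "1 / 2 ^ n < \<bar>bin_shift s - bin_shift t\<bar>"
      using Suc.prems(3) by (simp only: abs_mult) (simp add: field_simps)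
    from Suc.IH[OF bin_shift_range[OF Suc.prems(1)] bin_shift_range[OF Suc.prems(2)] this]
    have "1 / N ^ n / 2 / N \<le> \<bar>cantor_point N (bin_shift s) - cantor_point N (bin_shift t)\<bar> / N"
      using N by (intro divide_right_mono) auto
    then show ?thesis using N True unfolding diff by (simp add: abs_divide mult.commute)
  next
    case False
    then have b: "bin_digit s - bin_digit t = 1 \<or> bin_digit s - bin_digit t = - 1"
      by (auto simp: bin_digit_def split: if_splits)
    have "N - 2 \<le> \<bar>(bin_digit s - bin_digit t) * (N - 1) +
      (cantor_point N (bin_shift s) - cantor_point N (bin_shift t))\<bar>"
      using b cantor_point_range[of "bin_shift s"] cantor_point_range[of "bin_shift t"] by auto
    then have "(N - 2) / N \<le> \<bar>cantor_point N s - cantor_point N t\<bar>"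
      using N unfolding diff by (simp add: abs_divide divide_right_mono)
    moreover have "1 / 2 \<le> (N - 2) / N" using N by (simp add: field_simps)
    moreover have "1 / N ^ Suc n \<le> 1" using N by (simp add: divide_le_eq_1 one_le_power del: power_Suc)
    ultimately show ?thesis by (smt (verit) divide_right_mono)
  qed
qed

lemma cantor_point_small:
  assumes "t \<in> {0..<1 / 2 ^ n}"
  shows "cantor_point N t \<le> 1 / N ^ n"
  using assms
proof (induction n arbitrary: t)
  case 0
  then show ?case using cantor_point_range by simp
next
  case (Suc n)
  have "(1::real) / 2 ^ Suc n \<le> 1 / 2" by (simp add: field_simps)
  moreover have "0 \<le> t" "t < 1 / 2 ^ Suc n" using Suc.prems by (simp_all del: power_Suc)
  ultimately have t: "0 \<le> t" "t < 1 / 2" by linarith+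
  have "2 * t \<in> {0..<1 / 2 ^ n}" using Suc.prems by (auto simp: field_simps)
  from Suc.IH[OF this] show ?case
    unfolding cantor_point_rec[of t] using t N
    by (simp add: bin_digit_def bin_shift_def field_simps)
qed

text \<open>The exponent is the dimension \<open>ln 2 / ln N\<close> of the Cantor set. The constant
  4 collects a factor 2 from going one step back from the least separating scale, and at most 2 from
  the 1/2 in \<open>cantor_point_separation\<close>, as \<open>\<beta> \<le> 1\<close>.\<close>

lemma cantor_point_inverse_holder:
  assumes st: "s \<in> {0..<1}" "t \<in> {0..<1}" and \<beta>: "N powr \<beta> = 2" "0 < \<beta>" "\<beta> \<le> 1"
  shows "\<bar>s - t\<bar> \<le> 4 * \<bar>cantor_point N s - cantor_point N t\<bar> powr \<beta>"
proof (cases "s = t")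
  case False
  define P where "P n \<longleftrightarrow> 1 / 2 ^ n < \<bar>s - t\<bar>" for n :: nat
  obtain n0 where "P n0"
    using real_arch_pow_inv[of "\<bar>s - t\<bar>" "1/2"] False by (auto simp: P_def power_divide)
  then have n: "P (LEAST n. P n)" and less: "\<And>k. k < (LEAST n. P n) \<Longrightarrow> \<not> P k"
    by (rule LeastI) (rule not_less_Least)
  have "\<not> P 0" using st by (auto simp: P_def)
  then obtain k where k: "(LEAST n. P n) = Suc k" using n by (metis not0_implies_Suc)
  have 1: "\<bar>s - t\<bar> \<le> 1 / 2 ^ k" using less[of k] k by (simp add: P_def not_less)
  have "1 / N ^ Suc k / 2 \<le> \<bar>cantor_point N s - cantor_point N t\<bar>"
    using n[unfolded k, unfolded P_def] by (intro cantor_point_separation st)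
  then have "(1 / N ^ Suc k / 2) powr \<beta> \<le> \<bar>cantor_point N s - cantor_point N t\<bar> powr \<beta>"
    using \<beta> N by (intro powr_mono2) auto
  moreover have "(1 / N ^ Suc k / 2) powr \<beta> = 1 / 2 ^ Suc k / 2 powr \<beta>"
  proof -
    have "(N ^ Suc k) powr \<beta> = (N powr \<beta>) ^ Suc k"
      using N by (simp add: powr_powr mult.commute flip: powr_realpow del: power_Suc)
    then show ?thesis using N \<beta> by (simp add: powr_divide powr_mult)
  qed
  moreover have "1 / 2 ^ Suc k / 2 powr \<beta> \<ge> 1 / 2 ^ k / 4"
  proof -
    have "2 powr \<beta> \<le> (2::real) powr 1" using \<beta> by (intro powr_mono) auto
    then show ?thesis by (simp add: field_simps)
  qed
  ultimately have "1 / 2 ^ k / 4 \<le> \<bar>cantor_point N s - cantor_point N t\<bar> powr \<beta>"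
    by (metis order_trans)
  then show ?thesis using 1 by simp
qed simp

end

lemma cantor_lines_subset_boxplus:
  assumes m: "m \<ge> 2"
  shows "{0..1::real} \<times> cantor_point (2^m) ` {0..<1} \<subseteq> boxplus m"
proof (rule self_covered_subset_boxplus[OF m])
  have "(2::real) ^ 2 \<le> 2 ^ m" using m by (intro power_increasing) auto
  then have N: "(4::real) \<le> 2 ^ m" by simp
  show "{0..1::real} \<times> cantor_point (2^m) ` {0..<1} \<subseteq> unit_square"
    using cantor_point_range[OF N] by (auto simp: unit_square_def)
  fix z assume "z \<in> {0..1::real} \<times> cantor_point (2^m) ` {0..<1}"
  then obtain x t where z: "z = (x, cantor_point (2^m) t)" "0 \<le> x" "x \<le> 1" "t \<in> {0..<1}" by auto
  have "\<exists>i<2^m. real i \<le> 2^m * x \<and> 2^m * x \<le> real i + 1"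
  \<comment> \<open>For \<open>x = 1\<close> the floor of \<open>2^m * x\<close> is not a column
    index, and the last column is taken.\<close>
  proof (cases "x = 1")
    case True
    have "real (2 ^ m - 1) + 1 = 2 ^ m" by (simp add: of_nat_diff)
    then show ?thesis using True by (intro exI[of _ "2^m - 1"]) auto
  next
    case False
    have f: "0 \<le> \<lfloor>2^m * x\<rfloor>" using z by simp
    have "real (nat \<lfloor>2^m * x\<rfloor>) \<le> 2^m * x" "2^m * x \<le> real (nat \<lfloor>2^m * x\<rfloor>) + 1"
      using f by (simp_all add: of_nat_nat)
    moreover have "nat \<lfloor>2^m * x\<rfloor> < 2 ^ m"
    proof -
      have "2^m * x < 2^m * 1" using z False by (intro mult_strict_left_mono) auto
      then have "\<lfloor>2^m * x\<rfloor> < 2^m" by (simp add: floor_less_iff)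
      then show ?thesis using f by (simp add: nat_less_iff)
    qed
    ultimately show ?thesis by blast
  qed
  then obtain i where i: "i < 2^m" "real i \<le> 2^m * x" "2^m * x \<le> real i + 1" by blast
  define j :: nat where "j = (if t < 1/2 then 0 else 2^m - 1)"
  have j: "j < 2^m" "end_index m j" by (auto simp: j_def end_index_def)
  have rj: "real j = bin_digit t * (2^m - 1)" by (simp add: j_def bin_digit_def of_nat_diff)
  have "z = cell_map m i j (2^m * x - real i, cantor_point (2^m) (bin_shift t))"
    unfolding z(1) cell_map_def cantor_point_rec[OF N, of t]
    by (simp add: rj field_simps)
  moreover have "(2^m * x - real i, cantor_point (2^m) (bin_shift t)) \<in>
    {0..1::real} \<times> cantor_point (2^m) ` {0..<1}" using i bin_shift_range[OF z(4)] by auto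
  ultimately show "\<exists>i j w. i < 2 ^ m \<and> j < 2 ^ m \<and> end_index m j \<and>
      w \<in> {0..1::real} \<times> cantor_point (2^m) ` {0..<1} \<and> z = cell_map m i j w"
    using i(1) j by (intro exI conjI)
qed

lemma hausdorff_dim_levels_boxplus:
  assumes m: "m \<ge> 2" and f: "continuous_on (boxplus m) f" and ne: "f (0, 0) \<noteq> (f (1, 0) :: real)"
  obtains lo hi where "lo < hi"
    "\<And>r. lo < r \<Longrightarrow> r < hi \<Longrightarrow> ereal (1 / real m) \<le> hausdorff_dim {x\<in>boxplus m. f x = r}"
proof -
  let ?F = "boxplus m" and ?N = "(2::real) ^ m" and ?\<beta> = "1 / real m"
  let ?c = "cantor_point (2 ^ m)"
  have "(2::real) ^ 2 \<le> 2 ^ m" using m by (intro power_increasing) auto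
  then have N: "4 \<le> ?N" by simp
  have \<beta>: "?N powr ?\<beta> = 2" "0 < ?\<beta>" "?\<beta> \<le> 1"
    using m by (auto simp: powr_powr simp flip: powr_realpow)
  have inF: "(x, ?c t) \<in> ?F" if "x \<in> {0..1}" "t \<in> {0..<1}" for x t
    using cantor_lines_subset_boxplus[OF m] that by blast
  have c0: "?c 0 = 0"
    unfolding cantor_point_def
  proof -
    have "(bin_shift ^^ k) 0 = 0" for k by (induction k) (auto simp: bin_shift_def)
    then show "(\<Sum>k. bin_digit ((bin_shift ^^ k) 0) * ((2 ^ m - 1) / 2 ^ m * (1 / 2 ^ m) ^ k)) = (0::real)"
      by (simp add: bin_digit_def)
  qed
  have pts: "(0, 0) \<in> ?F" "(1, 0) \<in> ?F" using inF[of _ 0] by (simp_all add: c0)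
  \<comment> \<open>A quarter of the gap: at both ends of a nearby line the values move by less than
    \<open>e\<close>, which leaves an interval of length \<open>2 * e\<close> between
    \<open>lo\<close> and \<open>hi\<close>.\<close>
  define e where "e = \<bar>f (0,0) - f (1,0)\<bar> / 4"
  have e: "e > 0" using ne by (simp add: e_def)
  obtain d0 d1 where d: "d0 > 0" "d1 > 0"
    "\<And>z. z \<in> ?F \<Longrightarrow> dist z (0,0) < d0 \<Longrightarrow> dist (f z) (f (0,0)) < e"
    "\<And>z. z \<in> ?F \<Longrightarrow> dist z (1,0) < d1 \<Longrightarrow> dist (f z) (f (1,0)) < e"
    using f pts e unfolding continuous_on_iff by metis
  obtain n where n: "(1 / ?N) ^ n < min d0 d1"
    using real_arch_pow_inv[of "min d0 d1" "1 / ?N"] d N by auto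
  define \<tau> :: real where "\<tau> = 1 / 2 ^ n"
  have \<tau>: "0 < \<tau>" "\<tau> \<le> 1" by (auto simp: \<tau>_def)
  have near: "\<bar>f (0, ?c t) - f (0,0)\<bar> < e \<and> \<bar>f (1, ?c t) - f (1,0)\<bar> < e" if "t \<in> {0..<\<tau>}" for t
  proof -
    have t: "t \<in> {0..<1}" using that \<tau> by auto
    have "?c t \<le> 1 / ?N ^ n" using cantor_point_small[OF N] that by (simp add: \<tau>_def)
    then have "?c t < min d0 d1" using n by (simp add: power_divide)
    then have "dist (x, ?c t) (x, 0) < min d0 d1" for x :: real
      using cantor_point_range[OF N, of t] by (simp add: dist_Pair_Pair dist_real_def)
    then show ?thesis using d(3,4) inF[of _ t] t by (auto simp: dist_real_def)
  qed
  define lo hi where "lo = min (f (0,0)) (f (1,0)) + e" and "hi = max (f (0,0)) (f (1,0)) - e"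
  have "lo < hi" using ne unfolding lo_def hi_def e_def by (auto simp: min_def max_def abs_if field_simps)
  moreover have "ereal ?\<beta> \<le> hausdorff_dim {x\<in>?F. f x = r}" if r: "lo < r" "r < hi" for r
  proof -
    have "\<exists>x. x \<in> {0..1} \<and> f (x, ?c t) = r" if t: "t \<in> {0..<\<tau>}" for t
    proof -
      let ?S = "{0..1::real} \<times> {?c t}"
      have S: "?S \<subseteq> ?F" using inF t \<tau> by auto
      have "connected ?S" by (simp add: connected_Times)
      then have "connected (f ` ?S)"
        using f S continuous_on_subset connected_continuous_image by blast
      moreover have "f (0, ?c t) \<in> f ` ?S" "f (1, ?c t) \<in> f ` ?S" by auto
      moreover have "f (0, ?c t) \<le> r \<and> r \<le> f (1, ?c t) \<or> f (1, ?c t) \<le> r \<and> r \<le> f (0, ?c t)"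
        using near[OF t] r unfolding lo_def hi_def by (auto simp: min_def max_def split: if_splits)
      ultimately have "r \<in> f ` ?S" using connectedD_interval by blast
      then show ?thesis by auto
    qed
    \<comment> \<open>The selection \<open>x t\<close> may be as irregular as it likes: the second
      coordinate alone gives the inverse Hoelder bound.\<close>
    then obtain x where x: "\<And>t. t \<in> {0..<\<tau>} \<Longrightarrow> x t \<in> {0..1} \<and> f (x t, ?c t) = r" by metis
    show ?thesis
    proof (rule hausdorff_dim_ge_of_holder[OF \<tau>(1), of 4 "\<lambda>t. (x t, ?c t)"])
      show "(x t, ?c t) \<in> {x\<in>?F. f x = r}" if "t \<in> {0..<\<tau>}" for t
        using x[OF that] inF that \<tau> by auto
      fix s t assume st: "s \<in> {0..<\<tau>}" "t \<in> {0..<\<tau>}"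
      have "\<bar>s - t\<bar> \<le> 4 * \<bar>?c s - ?c t\<bar> powr ?\<beta>"
        using st \<tau> by (intro cantor_point_inverse_holder[OF N _ _ \<beta>]) auto
      also have "\<dots> \<le> 4 * dist (x s, ?c s) (x t, ?c t) powr ?\<beta>"
        using \<beta> dist_snd_le[of "(x s, ?c s)" "(x t, ?c t)"]
        by (intro mult_left_mono powr_mono2) (auto simp: dist_real_def)
      finally show "\<bar>s - t\<bar> \<le> 4 * dist (x s, ?c s) (x t, ?c t) powr ?\<beta>" .
    qed simp
  qed
  ultimately show ?thesis using that by blast
qed

section \<open>Generic Hoelder functions\<close>

context
  fixes F :: "'a::metric_space set" and \<alpha> :: real
  assumes F: "compact F" "F \<noteq> {}" and \<alpha>: "\<alpha> > 0"
begin

lemma holder1_continuous: "f \<in> holder1 \<alpha> F \<Longrightarrow> continuous_on F f"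
  unfolding continuous_on_iff
proof clarify
  fix x :: 'a and e :: real assume f: "f \<in> holder1 \<alpha> F" and x: "x \<in> F" and e: "e > 0"
  have "dist (f y) (f x) < e" if y: "y \<in> F" "dist y x < e powr (1 / \<alpha>)" for y
  proof -
    have "\<bar>f y - f x\<bar> \<le> dist y x powr \<alpha>" using f x y by (auto simp: holder1_def)
    also have "\<dots> < (e powr (1 / \<alpha>)) powr \<alpha>" using y \<alpha> by (intro powr_less_mono2) auto
    also have "\<dots> = e" using \<alpha> e by (simp add: powr_powr)
    finally show ?thesis by (simp add: dist_real_def)
  qed
  then show "\<exists>d>0. \<forall>x'\<in>F. dist x' x < d \<longrightarrow> dist (f x') (f x) < e"
    using e by (intro exI[of _ "e powr (1 / \<alpha>)"]) auto
qed

lemma holder1_bounded: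
  assumes "f \<in> holder1 \<alpha> F" obtains B where "B > 0" "\<And>x. x \<in> F \<Longrightarrow> \<bar>f x\<bar> \<le> B"
proof -
  have "compact (f ` F)" using holder1_continuous[OF assms] F by (rule_tac compact_continuous_image)
  then have "bounded (f ` F)" by (rule compact_imp_bounded)
  then show ?thesis using that unfolding bounded_pos by auto
qed

lemma holder1_subset_funspace: "holder1 \<alpha> F \<subseteq> mspace (funspace F euclidean_metric)"
proof
  fix f assume f: "f \<in> holder1 \<alpha> F"
  obtain B where B: "\<And>x. x \<in> F \<Longrightarrow> \<bar>f x\<bar> \<le> B" using holder1_bounded[OF f] by blast
  have "Metric_space.mbounded UNIV dist (f ` F)"
    unfolding Met_TC.mbounded using B by (intro disjI2 conjI exI[of _ 0] exI[of _ B]) (auto simp: dist_real_def)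
  then show "f \<in> mspace (funspace F euclidean_metric)"
    using f by (simp add: Met_TC.fspace_def holder1_def)
qed

text \<open>Non-strict bounds pass between the supremum and the single points without asking whether
  the supremum is attained; hence the closed balls in what follows.\<close>

lemma holder1_dist_le_iff:
  assumes "f \<in> mspace (funspace F euclidean_metric)" "g \<in> mspace (funspace F euclidean_metric)"
  shows "mdist (funspace F euclidean_metric) f g \<le> e \<longleftrightarrow> (\<forall>x\<in>F. \<bar>f x - g x\<bar> \<le> e)"
  using funspace_mdist_le[OF assms F(2)] by (simp add: dist_real_def)

lemma holder1_topology_submetric:
  "holder1_topology \<alpha> F = mtopology_of (submetric (funspace F euclidean_metric) (holder1 \<alpha> F))"
  unfolding holder1_topology_def mtopology_of_submetric ..

lemma topspace_holder1: "topspace (holder1_topology \<alpha> F) = holder1 \<alpha> F"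
  using holder1_subset_funspace by (simp add: holder1_topology_def del: mspace_funspace) blast

lemma openin_holder1:
  "openin (holder1_topology \<alpha> F) U \<longleftrightarrow> U \<subseteq> holder1 \<alpha> F \<and>
    (\<forall>f\<in>U. \<exists>e>0. \<forall>g\<in>holder1 \<alpha> F. (\<forall>x\<in>F. \<bar>f x - g x\<bar> \<le> e) \<longrightarrow> g \<in> U)"
proof -
  let ?m = "submetric (funspace F euclidean_metric) (holder1 \<alpha> F)"
  interpret M: Metric_space "mspace ?m" "mdist ?m" by (rule Metric_space_mspace_mdist)
  have M: "mspace ?m = holder1 \<alpha> F" using holder1_subset_funspace by auto
  have in_ball: "g \<in> M.mcball f e \<longleftrightarrow> f \<in> holder1 \<alpha> F \<and> g \<in> holder1 \<alpha> F \<and> (\<forall>x\<in>F. \<bar>f x - g x\<bar> \<le> e)"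
    for f g e
    unfolding M.in_mcball unfolding M mdist_submetric
    using holder1_dist_le_iff[of f g e] holder1_subset_funspace by blast
  have ball: "M.mcball f e \<subseteq> U \<longleftrightarrow> (\<forall>g\<in>holder1 \<alpha> F. (\<forall>x\<in>F. \<bar>f x - g x\<bar> \<le> e) \<longrightarrow> g \<in> U)"
    if "f \<in> holder1 \<alpha> F" for f e
    using that in_ball[of _ f e] by blast
  have "openin (holder1_topology \<alpha> F) U \<longleftrightarrow> openin M.mtopology U"
    by (simp add: holder1_topology_submetric mtopology_of_def)
  also have "\<dots> \<longleftrightarrow> U \<subseteq> holder1 \<alpha> F \<and> (\<forall>f\<in>U. \<exists>e>0. M.mcball f e \<subseteq> U)"
    using M.openin_mtopology_mcball[of U] unfolding M by blast
  also have "\<dots> \<longleftrightarrow> U \<subseteq> holder1 \<alpha> F \<and>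
    (\<forall>f\<in>U. \<exists>e>0. \<forall>g\<in>holder1 \<alpha> F. (\<forall>x\<in>F. \<bar>f x - g x\<bar> \<le> e) \<longrightarrow> g \<in> U)"
    by (intro conj_cong refl ball_cong ex_cong1 ball) blast
  finally show ?thesis .
qed

lemma holder1_dense_iff:
  assumes "S \<subseteq> holder1 \<alpha> F"
  shows "holder1_topology \<alpha> F closure_of S = topspace (holder1_topology \<alpha> F) \<longleftrightarrow>
    (\<forall>f\<in>holder1 \<alpha> F. \<forall>e>0. \<exists>g\<in>S. \<forall>x\<in>F. \<bar>f x - g x\<bar> \<le> e)"
proof -
  let ?m = "submetric (funspace F euclidean_metric) (holder1 \<alpha> F)"
  interpret M: Metric_space "mspace ?m" "mdist ?m" by (rule Metric_space_mspace_mdist)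
  have M: "mspace ?m = holder1 \<alpha> F" using holder1_subset_funspace by auto
  have ball: "g \<in> M.mcball f e \<longleftrightarrow> (\<forall>x\<in>F. \<bar>f x - g x\<bar> \<le> e)"
    if "f \<in> holder1 \<alpha> F" "g \<in> S" for f g e
    unfolding M.in_mcball unfolding M mdist_submetric
    using that assms holder1_dist_le_iff[of f g e] holder1_subset_funspace by blast
  have "holder1_topology \<alpha> F closure_of S = {f \<in> holder1 \<alpha> F. \<forall>r>0. \<exists>g\<in>S. g \<in> M.mcball f r}"
    using M.metric_closure_of_alt[of S] unfolding holder1_topology_submetric mtopology_of_def M .
  also have "\<dots> = {f \<in> holder1 \<alpha> F. \<forall>r>0. \<exists>g\<in>S. \<forall>x\<in>F. \<bar>f x - g x\<bar> \<le> r}"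
    by (intro Collect_cong conj_cong refl all_cong bex_cong ball)
  finally show ?thesis unfolding topspace_holder1 set_eq_iff mem_Collect_eq by metis
qed

text \<open>The Hoelder condition survives uniform limits, so the space is closed in the complete
  space of bounded functions.\<close>

lemma completely_metrizable_holder1: "completely_metrizable_space (holder1_topology \<alpha> F)"
  unfolding holder1_topology_def
proof (rule completely_metrizable_space_closedin)
  let ?m = "funspace F euclidean_metric :: ('a \<Rightarrow> real) metric"
  interpret M: Metric_space "mspace ?m" "mdist ?m" by (rule Metric_space_mspace_mdist)
  have "Met_TC.mcomplete TYPE(real)" by (simp add: mcomplete_iff_complete complete_UNIV)
  from Met_TC.mcomplete_funspace[OF this, of F]
  have "M.mcomplete"
    by (simp add: mcomplete_of_def Met_TC.Self_def flip: euclidean_metric_def)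
  then show "completely_metrizable_space (mtopology_of ?m)"
    using M.completely_metrizable_space_mtopology by (simp add: mtopology_of_def)
  have "M.mtopology closure_of holder1 \<alpha> F \<subseteq> holder1 \<alpha> F"
  proof
    fix f assume "f \<in> M.mtopology closure_of holder1 \<alpha> F"
    then have fM: "f \<in> mspace ?m" and near: "\<And>r. r > 0 \<Longrightarrow> \<exists>g\<in>holder1 \<alpha> F. g \<in> M.mcball f r"
      unfolding M.metric_closure_of_alt by auto
    have "\<bar>f a - f b\<bar> \<le> dist a b powr \<alpha>" if ab: "a \<in> F" "b \<in> F" for a b
    proof (rule field_le_epsilon)
      fix e :: real assume "e > 0"
      then obtain g where g: "g \<in> holder1 \<alpha> F" "g \<in> M.mcball f (e/2)" using near[of "e/2"] by auto
      then have "\<forall>x\<in>F. \<bar>f x - g x\<bar> \<le> e/2"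
        using holder1_dist_le_iff[of f g "e/2"] by (simp del: mspace_funspace mdist_funspace)
      then have "\<bar>f a - g a\<bar> \<le> e/2" "\<bar>f b - g b\<bar> \<le> e/2" using ab by auto
      moreover have "\<bar>g a - g b\<bar> \<le> dist a b powr \<alpha>" using g ab by (simp add: holder1_def)
      ultimately show "\<bar>f a - f b\<bar> \<le> dist a b powr \<alpha> + e" by linarith
    qed
    then show "f \<in> holder1 \<alpha> F" 
      using funspace_imp_extensional[OF fM] by (simp add: holder1_def)
  qed
  then have "closedin M.mtopology (holder1 \<alpha> F)"
    using holder1_subset_funspace closure_of_subset_eq[of "holder1 \<alpha> F" M.mtopology]
    unfolding M.topspace_mtopology by blast
  then show "closedin (mtopology_of ?m) (holder1 \<alpha> F)" by (simp add: mtopology_of_def)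
qed

lemma Baire_holder1:
  assumes "countable \<G>"
    "\<And>T. T \<in> \<G> \<Longrightarrow> openin (holder1_topology \<alpha> F) T \<and>
      holder1_topology \<alpha> F closure_of T = topspace (holder1_topology \<alpha> F)"
  shows "holder1_topology \<alpha> F closure_of \<Inter>\<G> = topspace (holder1_topology \<alpha> F)"
  using Baire_category[OF disjI1[OF completely_metrizable_holder1] assms] .

lemma holder1_nonempty: "holder1 \<alpha> F \<noteq> {}"
proof -
  have "restrict (\<lambda>x. 0) F \<in> holder1 \<alpha> F" by (auto simp: holder1_def)
  then show ?thesis by blast
qed

lemma generic_level_set_dim_ge:
  assumes "openin (holder1_topology \<alpha> F) U"
    "holder1_topology \<alpha> F closure_of U = topspace (holder1_topology \<alpha> F)"
    "\<And>f. f \<in> U \<Longrightarrow> c \<le> level_set_dim dm F f"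
  shows "c \<le> generic_level_set_dim dm \<alpha> F"
proof -
  have "U \<in> dense_gdeltas \<alpha> F"
    unfolding dense_gdeltas_def using assms by (simp add: open_imp_gdelta_in)
  then have "(INF f\<in>U. level_set_dim dm F f) \<le> generic_level_set_dim dm \<alpha> F"
    unfolding generic_level_set_dim_def by (rule SUP_upper)
  moreover have "c \<le> (INF f\<in>U. level_set_dim dm F f)" using assms(3) by (rule INF_greatest)
  ultimately show ?thesis by order
qed

text \<open>The definition takes a supremum over dense G-delta sets, so each of them has to be
  defeated: by Baire's theorem it contains a function lying in all \<open>U n\<close>, and this
  function bounds the infimum.\<close>

lemma generic_level_set_dim_le:
  assumes U: "\<And>n :: nat. openin (holder1_topology \<alpha> F) (U n)"
    "\<And>n. holder1_topology \<alpha> F closure_of U n = topspace (holder1_topology \<alpha> F)"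
    and le: "\<And>f. f \<in> holder1 \<alpha> F \<Longrightarrow> (\<And>n. f \<in> U n) \<Longrightarrow> level_set_dim dm F f \<le> c"
  shows "generic_level_set_dim dm \<alpha> F \<le> c"
  unfolding generic_level_set_dim_def
proof (rule SUP_least)
  let ?X = "holder1_topology \<alpha> F"
  fix G assume "G \<in> dense_gdeltas \<alpha> F"
  then have G: "gdelta_in ?X G" "?X closure_of G = topspace ?X" by (auto simp: dense_gdeltas_def)
  then obtain \<U> where \<U>: "countable \<U>" "\<And>T. T \<in> \<U> \<Longrightarrow> openin ?X T" "\<Inter>\<U> = G"
    unfolding gdelta_in_alt intersection_of_def by auto
  have "?X closure_of \<Inter>(\<U> \<union> range U) = topspace ?X"
  proof (rule Baire_holder1)
    show "countable (\<U> \<union> range U)" using \<U> by auto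
    fix T assume T: "T \<in> \<U> \<union> range U"
    show "openin ?X T \<and> ?X closure_of T = topspace ?X"
    proof (cases "T \<in> \<U>")
      case True
      then have "G \<subseteq> T" using \<U> by blast
      then have "topspace ?X \<subseteq> ?X closure_of T" using G(2) closure_of_mono by metis
      then have "?X closure_of T = topspace ?X"
        by (rule subset_antisym[OF closure_of_subset_topspace])
      with \<U>(2)[OF True] show ?thesis ..
    next
      case False
      then show ?thesis using T U by auto
    qed
  qed
  moreover have "topspace ?X \<noteq> {}" using holder1_nonempty topspace_holder1 by simp
  ultimately have "\<Inter>(\<U> \<union> range U) \<noteq> {}" by (metis closure_of_empty)
  then obtain f where f: "f \<in> G" "\<And>n. f \<in> U n" using \<U>(3) by auto
  have "f \<in> holder1 \<alpha> F" using f(1) G(1) topspace_holder1 by (auto simp: gdelta_in_alt)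
  then have "level_set_dim dm F f \<le> c" using f(2) by (rule le)
  then show "(INF f\<in>G. level_set_dim dm F f) \<le> c" using f(1) by (meson INF_lower2)
qed

end

text \<open>Measurability matters here: \<open>emeasure\<close> is 0 on a non-measurable set, so
  that containing an interval would not give positive measure.\<close>

lemma level_set_dim_ge:
  assumes "lo < hi" "\<And>r. lo < r \<Longrightarrow> r < hi \<Longrightarrow> c \<le> dm {x\<in>F. f x = r}"
    "{r. c \<le> dm {x\<in>F. f x = r}} \<in> sets borel"
  shows "c \<le> level_set_dim dm F f"
proof -
  let ?E = "{r. c \<le> dm {x\<in>F. f x = r}}"
  have "emeasure lborel {lo<..<hi} \<le> emeasure lborel ?E"
    using assms by (intro emeasure_mono) auto
  moreover have "emeasure lborel {lo<..<hi} > 0" using assms(1) by simp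
  ultimately have "emeasure lebesgue ?E > 0"
    using assms(3) by simp
  then show ?thesis unfolding level_set_dim_def by (intro Sup_upper) simp
qed

text \<open>For arbitrary \<open>dm\<close> the sets of levels may not be Borel; completeness of
  Lebesgue measure makes them null all the same.\<close>

lemma level_set_dim_le:
  assumes "AE r in lborel. dm {x\<in>F. f x = r} \<le> c"
  shows "level_set_dim dm F f \<le> c"
  unfolding level_set_dim_def
proof (rule Sup_least, clarify, rule ccontr)
  fix d assume d: "0 < emeasure lebesgue {r. d \<le> dm {x\<in>F. f x = r}}" "\<not> d \<le> c"
  have "AE r in lebesgue. dm {x\<in>F. f x = r} \<le> c" using assms by (rule AE_completion)
  then have "AE r in lebesgue. r \<notin> {r. d \<le> dm {x\<in>F. f x = r}}"
    by eventually_elim (use d in \<open>auto simp: not_le\<close>)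
  then obtain N where N: "N \<in> null_sets lebesgue" "{r. d \<le> dm {x\<in>F. f x = r}} \<subseteq> N"
    unfolding eventually_ae_filter by auto
  have "{r. d \<le> dm {x\<in>F. f x = r}} \<in> null_sets lebesgue"
    by (rule null_sets_completion_subset[OF N(2,1)])
  with d(1) show False by (simp add: null_sets_def)
qed

text \<open>Keeping \<open>dm\<close> abstract handles both dimensions at once.\<close>

lemma generic_level_set_dim_boxplus_ge:
  fixes dm :: "(real \<times> real) set \<Rightarrow> ereal"
  assumes m: "m \<ge> 2" and \<alpha>: "0 < \<alpha>" "\<alpha> \<le> 1"
    and dm: "\<And>A. compact A \<Longrightarrow> hausdorff_dim A \<le> dm A"
      "\<And>(f :: real \<times> real \<Rightarrow> real) d. continuous_on (boxplus m) f \<Longrightarrow> {r. ereal d \<le> dm {x\<in>boxplus m. f x = r}} \<in> sets borel"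
  shows "ereal (1 / real m) \<le> generic_level_set_dim dm \<alpha> (boxplus m)"
proof -
  let ?F = "boxplus m"
  have F: "compact ?F" "?F \<noteq> {}" using compact_boxplus boxplus_nonempty m by auto
  have "(2::real) ^ 2 \<le> 2 ^ m" using m by (intro power_increasing) auto
  then have N: "(4::real) \<le> 2 ^ m" by simp
  have pts: "(0, 0) \<in> ?F" "(1, 0) \<in> ?F"
  proof -
    have "cantor_point (2 ^ m) 0 = 0"
      using cantor_point_rec[OF N, of 0] N by (auto simp: bin_digit_def bin_shift_def field_simps)
    moreover have "(x, cantor_point (2 ^ m) 0) \<in> ?F" if "x \<in> {0..1}" for x
      using cantor_lines_subset_boxplus[OF m] that by force
    ultimately show "(0, 0) \<in> ?F" "(1, 0) \<in> ?F" by force+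
  qed
  define U where "U = {f \<in> holder1 \<alpha> ?F. f (0, 0) \<noteq> f (1, 0)}"
  have sub: "U \<subseteq> holder1 \<alpha> ?F" by (auto simp: U_def)
  show ?thesis
  proof (rule generic_level_set_dim_ge[OF F \<alpha>(1)])
    show "openin (holder1_topology \<alpha> ?F) U"
      unfolding openin_holder1[OF F \<alpha>(1)]
    proof (intro conjI ballI)
      fix f assume f: "f \<in> U"
      \<comment> \<open>Two errors of size \<open>e\<close> cannot close a gap of
        \<open>3 * e\<close>.\<close>
      define e where "e = \<bar>f (0, 0) - f (1, 0)\<bar> / 3"
      have "g (0, 0) \<noteq> g (1, 0)" if "\<forall>x\<in>?F. \<bar>f x - g x\<bar> \<le> e" for g
      proof
        assume g: "g (0, 0) = g (1, 0)"
        have "\<bar>f (0, 0) - f (1, 0)\<bar> \<le> \<bar>f (0, 0) - g (0, 0)\<bar> + \<bar>f (1, 0) - g (1, 0)\<bar>"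
          unfolding g by linarith
        also have "\<dots> \<le> e + e" by (intro add_mono bspec[OF that] pts)
        finally show False using f by (auto simp: e_def U_def)
      qed
      moreover have "e > 0" using f by (auto simp: e_def U_def)
      ultimately show "\<exists>e>0. \<forall>g\<in>holder1 \<alpha> ?F. (\<forall>x\<in>?F. \<bar>f x - g x\<bar> \<le> e) \<longrightarrow> g \<in> U"
        by (intro exI[of _ e] conjI ballI impI) (simp_all add: U_def)
    qed (auto simp: U_def)
    show "holder1_topology \<alpha> ?F closure_of U = topspace (holder1_topology \<alpha> ?F)"
    proof (unfold holder1_dense_iff[OF F \<alpha>(1) sub], intro ballI allI impI)
      fix f and e :: real assume f: "f \<in> holder1 \<alpha> ?F" and e: "e > 0"
      show "\<exists>g\<in>U. \<forall>x\<in>?F. \<bar>f x - g x\<bar> \<le> e"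
      proof (cases "f (0, 0) = f (1, 0)")
        case True
        obtain B where B: "B > 0" "\<And>x. x \<in> ?F \<Longrightarrow> \<bar>f x\<bar> \<le> B"
          using holder1_bounded[OF F \<alpha>(1) f] by blast
        \<comment> \<open>A convex combination of \<open>f\<close> with \<open>h\<close> stays
          Hoelder with constant 1. It differs from \<open>f\<close> by
          \<open>\<eta> * (f - h)\<close>, where \<open>f - h\<close> is bounded by
          \<open>B + 1\<close>.\<close>
        define \<eta> where "\<eta> = min 1 (e / (B + 1))"
        have "\<eta> \<le> e / (B + 1)" by (simp add: \<eta>_def)
        then have \<eta>3: "\<eta> * (B + 1) \<le> e" using B(1) by (simp add: pos_le_divide_eq)
        have \<eta>12: "0 < \<eta>" "\<eta> \<le> 1" using e B(1) by (simp_all add: \<eta>_def)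
        note \<eta> = \<eta>12 \<eta>3
        define h :: "real \<times> real \<Rightarrow> real" where "h z = fst z / 2" for z
        have F1: "0 \<le> fst z" "fst z \<le> 1" if "z \<in> ?F" for z
          using boxplus_subset_unit_square[OF m] that by (auto simp: unit_square_def)
        have h: "\<bar>h a - h b\<bar> \<le> dist a b powr \<alpha>" if "a \<in> ?F" "b \<in> ?F" for a b
        proof -
          have "\<bar>h a - h b\<bar> \<le> \<bar>fst a - fst b\<bar>" by (simp add: h_def)
          also have "\<dots> = \<bar>fst a - fst b\<bar> powr 1" by simp
          \<comment> \<open>First coordinates differ by at most 1, and there a smaller exponent
            gives a larger power.\<close>
          also have "\<dots> \<le> \<bar>fst a - fst b\<bar> powr \<alpha>"
            using F1[OF that(1)] F1[OF that(2)] \<alpha> by (intro powr_mono') auto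
          also have "\<dots> \<le> dist a b powr \<alpha>"
            using \<alpha> dist_fst_le[of a b] by (intro powr_mono2) (auto simp: dist_real_def)
          finally show ?thesis .
        qed
        define g where "g = restrict (\<lambda>z. (1 - \<eta>) * f z + \<eta> * h z) ?F"
        have "g \<in> holder1 \<alpha> ?F"
          unfolding holder1_def
        proof (intro CollectI conjI ballI)
          fix a b assume ab: "a \<in> ?F" "b \<in> ?F"
          have "\<bar>f a - f b\<bar> \<le> dist a b powr \<alpha>" using f ab by (simp add: holder1_def)
          then have "\<bar>(1 - \<eta>) * (f a - f b)\<bar> \<le> (1 - \<eta>) * dist a b powr \<alpha>"
            using \<eta> by (simp add: abs_mult mult_left_mono)
          moreover have "\<bar>\<eta> * (h a - h b)\<bar> \<le> \<eta> * dist a b powr \<alpha>"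
            using h[OF ab] \<eta> by (simp add: abs_mult mult_left_mono)
          moreover have "g a - g b = (1 - \<eta>) * (f a - f b) + \<eta> * (h a - h b)"
            using ab by (simp add: g_def algebra_simps)
          ultimately show "\<bar>g a - g b\<bar> \<le> dist a b powr \<alpha>" by (simp add: algebra_simps)
        qed (simp add: g_def)
        moreover have "g (0, 0) \<noteq> g (1, 0)" using True pts \<eta>(1) by (simp add: g_def h_def)
        ultimately have "g \<in> U" by (simp add: U_def)
        moreover have "\<bar>f x - g x\<bar> \<le> e" if x: "x \<in> ?F" for x
        proof -
          have "\<bar>f x - g x\<bar> = \<eta> * \<bar>f x - h x\<bar>"
          proof -
            have "f x - g x = \<eta> * (f x - h x)" using x by (simp add: g_def algebra_simps)
            then show ?thesis using \<eta>(1) by (simp add: abs_mult)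
          qed
          also have "\<dots> \<le> \<eta> * (B + 1)"
            using B(2)[OF x] F1[OF x] \<eta> by (intro mult_left_mono) (auto simp: h_def)
          finally show ?thesis using \<eta>(3) by linarith
        qed
        ultimately show ?thesis by blast
      next
        case False
        then show ?thesis using f e by (intro bexI[of _ f]) (auto simp: U_def)
      qed
    qed
    fix f assume f: "f \<in> U"
    then have c: "continuous_on ?F f" using holder1_continuous[OF F \<alpha>(1)] by (auto simp: U_def)
    obtain lo hi where lh: "lo < hi"
      "\<And>r. lo < r \<Longrightarrow> r < hi \<Longrightarrow> ereal (1 / real m) \<le> hausdorff_dim {x\<in>?F. f x = r}"
      using hausdorff_dim_levels_boxplus[OF m c] f by (auto simp: U_def)
    show "ereal (1 / real m) \<le> level_set_dim dm ?F f"
    proof (rule level_set_dim_ge[OF lh(1)])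
      fix r assume "lo < r" "r < hi"
      then have "ereal (1 / real m) \<le> hausdorff_dim {x\<in>?F. f x = r}" by (rule lh(2))
      also have "\<dots> \<le> dm {x\<in>?F. f x = r}" by (rule dm(1)[OF compact_level[OF F(1) c]])
      finally show "ereal (1 / real m) \<le> dm {x\<in>?F. f x = r}" .
    qed (rule dm(2)[OF c])
  qed
qed

section \<open>The staircase function\<close>

text \<open>
  The staircase is constant on each column of width \<open>2\<^sup>-\<^sup>m\<close> other than the two middle ones, and
  it rises by \<open>1/2\<close> in each of those. The starting function is flat near both ends, so that two points
  at distance at most \<open>2\<^sup>-\<^sup>m / 2\<close> never feel both middle columns at once.
\<close>

primrec stair :: "nat \<Rightarrow> nat \<Rightarrow> real \<Rightarrow> real" where
  "stair m 0 x = max 0 (min 1 (2 * x - 1/2))"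
| "stair m (Suc k) x = (stair m k (2^m * x - (2^(m-1) - 1)) + stair m k (2^m * x - 2^(m-1))) / 2"

text \<open>The staircase continued to the whole line, one copy above each unit interval, so that a
  single formula serves all cells of a grid.\<close>

definition stretch :: "nat \<Rightarrow> nat \<Rightarrow> real \<Rightarrow> real" where
  "stretch m k x = of_int \<lfloor>x\<rfloor> + stair m k (x - of_int \<lfloor>x\<rfloor>)"

text \<open>The columns of width 2^(-m k) that carry the rise of the staircase. They are closed,
  because points of the fractal may lie on their sides.\<close>

definition active :: "nat \<Rightarrow> nat \<Rightarrow> nat \<Rightarrow> bool" where
  "active m k a \<longleftrightarrow> (\<exists>x y. real a \<le> 2^(m*k) * x \<and> 2^(m*k) * x \<le> real a + 1 \<and>
     real a \<le> 2^(m*k) * y \<and> 2^(m*k) * y \<le> real a + 1 \<and> stair m k x \<noteq> stair m k y)"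

context
  fixes m :: nat
  assumes m: "m \<ge> 2"
begin

lemma four_le_power: "(4::real) \<le> 2 ^ m"
  using power_increasing[of 2 m "2::real"] m by simp

lemma power_eq_double: "(2::real) ^ m = 2 * 2 ^ (m - 1)"
  using m by (simp flip: power_Suc)

lemma stair_eq_0: "x \<le> 1/4 \<Longrightarrow> stair m k x = 0"
proof (induction k arbitrary: x)
  case (Suc k)
  have "2 ^ m * x \<le> 2 ^ m * (1/4)" using Suc.prems by (intro mult_left_mono) auto
  then have "2 ^ m * x - (2 ^ (m - 1) - 1) \<le> 1/4" "2 ^ m * x - 2 ^ (m - 1) \<le> 1/4"
    using four_le_power power_eq_double by linarith+
  then show ?case using Suc.IH by simp
qed simp

lemma stair_eq_1: "x \<ge> 3/4 \<Longrightarrow> stair m k x = 1"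
proof (induction k arbitrary: x)
  case (Suc k)
  have "2 ^ m * x \<ge> 2 ^ m * (3/4)" using Suc.prems by (intro mult_left_mono) auto
  then have "2 ^ m * x - (2 ^ (m - 1) - 1) \<ge> 3/4" "2 ^ m * x - 2 ^ (m - 1) \<ge> 3/4"
    using four_le_power power_eq_double by linarith+
  then show ?case using Suc.IH by simp
qed simp

lemma stair_range: "0 \<le> stair m k x" "stair m k x \<le> 1"
proof -
  have "0 \<le> stair m k x \<and> stair m k x \<le> 1"
  proof (induction k arbitrary: x)
    case (Suc k)
    from Suc[of "2^m * x - (2^(m-1) - 1)"] Suc[of "2^m * x - 2^(m-1)"] show ?case
      by simp
  qed auto
  then show "0 \<le> stair m k x" "stair m k x \<le> 1" by auto
qed

lemma powr_inverse_m:
  shows "(2 ^ m) powr (1 / real m) = (2::real)" "0 < 1 / real m" "1 / real m \<le> 1"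
  using m by (auto simp: powr_powr simp flip: powr_realpow)

text \<open>One refinement magnifies by \<open>2^m\<close> and halves the values, which fixes the
  exponent. The induction preserves the constant as long as only one of the two summands varies; the
  value 4 makes the bound trivial when the magnified distance exceeds 1/2.\<close>

lemma stair_holder: "\<bar>stair m k x - stair m k y\<bar> \<le> 4 * \<bar>x - y\<bar> powr (1 / real m)"
proof -
  let ?\<beta> = "1 / real m"
  have "\<bar>stair m k x - stair m k y\<bar> \<le> 4 * \<bar>x - y\<bar> powr ?\<beta>" if "x \<le> y" for x y
    using that
  proof (induction k arbitrary: x y)
    case 0
    show ?case
    proof (cases "\<bar>x - y\<bar> \<le> 1")
      case True
      have "\<bar>stair m 0 x - stair m 0 y\<bar> \<le> 2 * \<bar>x - y\<bar> powr 1"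
        by (auto simp: max_def min_def abs_if)
      also have "\<bar>x - y\<bar> powr 1 \<le> \<bar>x - y\<bar> powr ?\<beta>"
        using True powr_inverse_m by (intro powr_mono') auto
      finally show ?thesis by (smt (verit) powr_ge_zero)
    next
      case False
      then have "1 \<le> \<bar>x - y\<bar> powr ?\<beta>" using powr_inverse_m by (intro ge_one_powr_ge_zero) auto
      then show ?thesis using stair_range[of 0 x] stair_range[of 0 y] by linarith
    qed
  next
    case (Suc k)
    define A u v where "A = (2::real) ^ (m - 1)" and "u = 2^m * x - (A - 1)" and "v = 2^m * y - (A - 1)"
    have st: "stair m (Suc k) x = (stair m k u + stair m k (u - 1)) / 2"
      "stair m (Suc k) y = (stair m k v + stair m k (v - 1)) / 2"
      by (simp_all add: u_def v_def A_def algebra_simps)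
    have uv: "v - u = 2^m * \<bar>x - y\<bar>" using Suc.prems by (simp add: u_def v_def algebra_simps)
    have uv0: "u \<le> v" using Suc.prems by (simp add: u_def v_def)
    have scale: "\<bar>u - v\<bar> powr ?\<beta> = 2 * \<bar>x - y\<bar> powr ?\<beta>"
      using uv uv0 powr_inverse_m(1) by (simp add: abs_minus_commute[of u] powr_mult)
    show ?case
    proof (cases "v - u \<le> 1/2")
      case True
      have "\<bar>stair m (Suc k) x - stair m (Suc k) y\<bar> \<le> (4 * \<bar>u - v\<bar> powr ?\<beta>) / 2"
      \<comment> \<open>Either both points lie before the rise of the second summand or, as
        \<open>v - u \<le> 1/2\<close>, both lie behind that of the first.\<close>
      proof (cases "v \<le> 5/4")
        case True
        then have "stair m k (u - 1) = 0" "stair m k (v - 1) = 0" using uv0 by (auto intro!: stair_eq_0)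
        then show ?thesis using Suc.IH[OF uv0] unfolding st by simp
      next
        case False
        then have "stair m k u = 1" "stair m k v = 1" using uv0 True by (auto intro!: stair_eq_1)
        moreover have "\<bar>stair m k (u - 1) - stair m k (v - 1)\<bar> \<le> 4 * \<bar>u - v\<bar> powr ?\<beta>"
          using Suc.IH[of "u - 1" "v - 1"] uv0 by simp
        moreover have "\<bar>(1 + p) / 2 - (1 + q) / 2\<bar> = \<bar>p - q\<bar> / 2" for p q :: real
          by (simp flip: diff_divide_distrib)
        ultimately show ?thesis unfolding st by (simp only:) (rule divide_right_mono, assumption, simp)
      qed
      then show ?thesis using scale by simp
    next
      case False
      have "(1/2) powr 1 \<le> (1/2::real) powr ?\<beta>"
        using powr_inverse_m by (intro powr_mono') auto
      also have "\<dots> \<le> \<bar>u - v\<bar> powr ?\<beta>" using False powr_inverse_m by (intro powr_mono2) auto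
      finally have "1 \<le> 4 * \<bar>x - y\<bar> powr ?\<beta>" using scale by simp
      then show ?thesis using stair_range[of "Suc k" x] stair_range[of "Suc k" y] by linarith
    qed
  qed
  from this[of x y] this[of y x] show ?thesis
    by (cases "x \<le> y") (simp_all add: abs_minus_commute)
qed

lemma stretch_near: "\<bar>stretch m k x - x\<bar> \<le> 1"
  using stair_range[of k "x - of_int \<lfloor>x\<rfloor>"] unfolding stretch_def by linarith

text \<open>The formula of the cell at \<open>p\<close> reaches 1/4 beyond both ends because the
  staircase is flat there; in particular the pieces fit together at the integers.\<close>

lemma stretch_eq:
  assumes "of_int p - 1/4 \<le> x" "x \<le> of_int p + 5/4"
  shows "stretch m k x = of_int p + stair m k (x - of_int p)"
proof -
  have "\<lfloor>x\<rfloor> = p - 1 \<or> \<lfloor>x\<rfloor> = p \<or> \<lfloor>x\<rfloor> = p + 1" using assms by linarith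
  then show ?thesis
  proof (elim disjE)
    assume f: "\<lfloor>x\<rfloor> = p - 1"
    then have "stair m k (x - of_int (p - 1)) = 1" "stair m k (x - of_int p) = 0"
      using assms by (auto intro!: stair_eq_1 stair_eq_0) linarith+
    then show ?thesis unfolding stretch_def f by simp
  next
    assume f: "\<lfloor>x\<rfloor> = p + 1"
    then have "stair m k (x - of_int (p + 1)) = 0" "stair m k (x - of_int p) = 1"
      using assms by (auto intro!: stair_eq_1 stair_eq_0) linarith+
    then show ?thesis unfolding stretch_def f by simp
  qed (simp add: stretch_def)
qed

lemma stretch_holder:
  assumes "\<bar>x - y\<bar> \<le> 1/2"
  shows "\<bar>stretch m k x - stretch m k y\<bar> \<le> 4 * \<bar>x - y\<bar> powr (1 / real m)"
proof -
  \<comment> \<open>Chosen such that the interval of length 3/2 in \<open>stretch_eq\<close>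
    contains both points, which are at most 1/2 apart.\<close>
  define p where "p = \<lfloor>min x y + 1/4\<rfloor>"
  have "of_int p \<le> min x y + 1/4" "min x y + 1/4 < of_int p + 1" unfolding p_def by linarith+
  then have "of_int p - 1/4 \<le> x" "x \<le> of_int p + 5/4" "of_int p - 1/4 \<le> y" "y \<le> of_int p + 5/4"
    using assms by linarith+
  then have "stretch m k x - stretch m k y = stair m k (x - of_int p) - stair m k (y - of_int p)"
    by (simp add: stretch_eq)
  then show ?thesis using stair_holder[of k "x - of_int p" "y - of_int p"] by simp
qed

lemma stair_inactive:
  assumes "\<not> active m k a"
    "real a \<le> 2^(m*k) * x" "2^(m*k) * x \<le> real a + 1"
    "real a \<le> 2^(m*k) * y" "2^(m*k) * y \<le> real a + 1"
  shows "stair m k x = stair m k y"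
  using assms unfolding active_def by blast

text \<open>The leading digit decides which summands of the recursion vary: before the middle
  columns both are 0, behind them both are 1, and in a middle column one is constant and the other
  is a copy of the previous staircase.\<close>

lemma active_digits:
  assumes a: "a < 2 ^ (m*k)" and act: "active m (Suc k) (i * 2 ^ (m*k) + a)"
  shows "mid_index m i \<and> active m k a"
proof -
  let ?M = "(2::real) ^ (m*k)" and ?A = "(2::real) ^ (m - 1)"
  obtain x y where x: "real (i * 2 ^ (m*k) + a) \<le> 2^(m * Suc k) * x" "2^(m * Suc k) * x \<le> real (i * 2 ^ (m*k) + a) + 1"
    and y: "real (i * 2 ^ (m*k) + a) \<le> 2^(m * Suc k) * y" "2^(m * Suc k) * y \<le> real (i * 2 ^ (m*k) + a) + 1"
    and xy: "stair m (Suc k) x \<noteq> stair m (Suc k) y"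
    using act unfolding active_def by blast
  have step: "real a \<le> ?M * w \<and> ?M * w \<le> real a + 1 \<and> 0 \<le> w \<and> w \<le> 1 \<and>
      stair m (Suc k) z = (stair m k (w + (real i - ?A + 1)) + stair m k (w + (real i - ?A))) / 2"
    if z: "real (i * 2 ^ (m*k) + a) \<le> 2^(m * Suc k) * z" "2^(m * Suc k) * z \<le> real (i * 2 ^ (m*k) + a) + 1"
      and w: "w = 2^m * z - real i" for z w
  proof -
    have M: "?M > 0" by simp
    have Mw: "?M * w = 2^(m * Suc k) * z - real i * ?M"
      by (simp add: w algebra_simps power_add)
    have 1: "real a \<le> ?M * w" "?M * w \<le> real a + 1" using z unfolding Mw by simp_all
    have "0 \<le> ?M * w" using 1(1) by linarith
    then have "0 \<le> w" using M by (simp add: zero_le_mult_iff)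
    have "real (a + 1) \<le> real (2 ^ (m*k))" using a by (simp only: of_nat_le_iff)
    then have "real a + 1 \<le> ?M" by simp
    then have "?M * w \<le> ?M * 1" using 1(2) by linarith
    then have "w \<le> 1" using M by (simp only: mult_le_cancel_left_pos)
    then show ?thesis using 1 \<open>0 \<le> w\<close> by (simp add: w algebra_simps)
  qed
  define u v where "u = 2^m * x - real i" and "v = 2^m * y - real i"
  note u = step[OF x u_def] and v = step[OF y v_def]
  from u v have u01: "0 \<le> u" "u \<le> 1" and v01: "0 \<le> v" "v \<le> 1" by blast+
  from u have ux: "stair m (Suc k) x = (stair m k (u + (real i - ?A + 1)) + stair m k (u + (real i - ?A))) / 2" by blast
  from v have vy: "stair m (Suc k) y = (stair m k (v + (real i - ?A + 1)) + stair m k (v + (real i - ?A))) / 2" by blast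
  have pow: "real (2 ^ (m - 1) - 1) = ?A - 1" "real (2 ^ (m - 1)) = ?A" by (simp_all add: of_nat_diff)
  have "mid_index m i"
  proof (rule ccontr)
    assume "\<not> mid_index m i"
    then have "i < 2 ^ (m - 1) - 1 \<or> i > 2 ^ (m - 1)" unfolding mid_index_def by linarith
    then have "real i + 1 \<le> ?A - 1 \<or> real i \<ge> ?A + 1"
      using pow by (metis Suc_eq_plus1 Suc_leI of_nat_1 of_nat_add of_nat_le_iff)
    then have "stair m (Suc k) x = stair m (Suc k) y"
    proof
      assume i: "real i + 1 \<le> ?A - 1"
      have z: "stair m k (w + (real i - ?A + 1)) = 0" "stair m k (w + (real i - ?A)) = 0" if "w \<le> 1" for w
        using i that by (auto intro!: stair_eq_0)
      show ?thesis unfolding ux vy z[OF u01(2)] z[OF v01(2)] ..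
    next
      assume i: "real i \<ge> ?A + 1"
      have z: "stair m k (w + (real i - ?A + 1)) = 1" "stair m k (w + (real i - ?A)) = 1" if "0 \<le> w" for w
        using i that by (auto intro!: stair_eq_1)
      show ?thesis unfolding ux vy z[OF u01(1)] z[OF v01(1)] ..
    qed
    with xy show False by simp
  qed
  then have ri: "real i = ?A - 1 \<or> real i = ?A" using pow unfolding mid_index_def by metis
  have "stair m k u \<noteq> stair m k v"
    using ri
  proof
    assume i: "real i = ?A - 1"
    have "stair m k (u - 1) = 0" "stair m k (v - 1) = 0" using u01 v01 by (auto intro!: stair_eq_0)
    then show ?thesis using xy unfolding ux vy i by auto
  next
    assume i: "real i = ?A"
    have "stair m k (u + 1) = 1" "stair m k (v + 1) = 1" using u01 v01 by (auto intro!: stair_eq_1)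
    then show ?thesis using xy unfolding ux vy i by auto
  qed
  then have "active m k a" unfolding active_def using u v by blast
  with \<open>mid_index m i\<close> show ?thesis by blast
qed

end

section \<open>Counting squares\<close>

text \<open>By \<open>boxplus_ifs_cases\<close> these pairs include the indices of all kept squares,
  the direction that covers of the fractal require.\<close>

definition boxplus_digits :: "nat \<Rightarrow> (nat \<times> nat) set" where
  "boxplus_digits m = {(i, j). i < 2 ^ m \<and> j < 2 ^ m \<and>
     (mid_index m i \<longrightarrow> end_index m j) \<and> (mid_index m j \<longrightarrow> end_index m i)}"

text \<open>The new digit pair is the leading one, to match the recursion of \<open>stair\<close> in
  \<open>active_digits\<close>.\<close>

primrec boxplus_cells :: "nat \<Rightarrow> nat \<Rightarrow> (nat \<times> nat) set" where
  "boxplus_cells m 0 = {(0, 0)}"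
| "boxplus_cells m (Suc k) = (\<lambda>((i, j), (a, b)). (i * 2 ^ (m*k) + a, j * 2 ^ (m*k) + b)) `
     (boxplus_digits m \<times> boxplus_cells m k)"

lemma finite_boxplus_digits: "finite (boxplus_digits m)"
  by (rule finite_subset[of _ "{..<2^m} \<times> {..<2^m}"]) (auto simp: boxplus_digits_def)

lemma finite_boxplus_cells: "finite (boxplus_cells m k)"
  by (induction k) (auto simp: finite_boxplus_digits)

text \<open>Reflection in the diagonal reduces counting active rows to counting active
  columns.\<close>

lemma boxplus_cells_swap: "(a, b) \<in> boxplus_cells m k \<Longrightarrow> (b, a) \<in> boxplus_cells m k"
proof (induction k arbitrary: a b)
  case (Suc k)
  then obtain i j a' b' where *: "(i, j) \<in> boxplus_digits m" "(a', b') \<in> boxplus_cells m k"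
    "a = i * 2 ^ (m*k) + a'" "b = j * 2 ^ (m*k) + b'" by auto
  have "(j, i) \<in> boxplus_digits m" using *(1) by (auto simp: boxplus_digits_def)
  then show ?case
    unfolding boxplus_cells.simps using Suc.IH[OF *(2)] *
    by (intro image_eqI[of _ _ "((j, i), (b', a'))"]) auto
qed simp

lemma boxplus_cells_less: "(a, b) \<in> boxplus_cells m k \<Longrightarrow> a < 2 ^ (m*k)"
proof (induction k arbitrary: a b)
  case (Suc k)
  then obtain i j a' b' where *: "(i, j) \<in> boxplus_digits m" "(a', b') \<in> boxplus_cells m k"
    "a = i * 2 ^ (m*k) + a'" by auto
  have "a < (i + 1) * 2 ^ (m*k)" using Suc.IH[OF *(2)] *(3) by simp
  also have "\<dots> \<le> 2 ^ m * 2 ^ (m*k)"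
    using *(1) by (intro mult_right_mono) (auto simp: boxplus_digits_def)
  finally show ?case by (simp add: power_add)
qed simp

context
  fixes m :: nat
  assumes m: "m \<ge> 2"
begin

lemma boxplus_digitsE:
  assumes "z \<in> boxplus m"
  obtains i j w where "(i, j) \<in> boxplus_digits m" "w \<in> boxplus m"
    "2 ^ m * fst z = real i + fst w" "2 ^ m * snd z = real j + snd w"
proof -
  have "z \<in> (\<Union>\<phi>\<in>boxplus_ifs m. \<phi> ` boxplus m)" using assms boxplus_eq[of m] m by simp
  then obtain \<phi> w where \<phi>: "\<phi> \<in> boxplus_ifs m" "w \<in> boxplus m" "z = \<phi> w" by blast
  obtain i j where ij: "i < 2 ^ m" "j < 2 ^ m" "\<phi> = cell_map m i j"
    "mid_index m i \<Longrightarrow> end_index m j" "mid_index m j \<Longrightarrow> end_index m i"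
    using boxplus_ifs_cases[OF m \<phi>(1)] by metis
  have "(i, j) \<in> boxplus_digits m" using ij by (simp add: boxplus_digits_def)
  moreover have "2 ^ m * fst z = real i + fst w" "2 ^ m * snd z = real j + snd w"
    unfolding \<phi>(3) ij(3) cell_map_def by (simp_all add: field_simps)
  ultimately show ?thesis using \<phi>(2) that by blast
qed

lemma boxplus_cells_cover:
  assumes "z \<in> boxplus m"
  shows "\<exists>(a, b)\<in>boxplus_cells m k.
    real a \<le> 2^(m*k) * fst z \<and> 2^(m*k) * fst z \<le> real a + 1 \<and>
    real b \<le> 2^(m*k) * snd z \<and> 2^(m*k) * snd z \<le> real b + 1"
  using assms
proof (induction k arbitrary: z)
  case 0
  then show ?case using boxplus_subset_unit_square[OF m] by (auto simp: unit_square_def)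
next
  case (Suc k)
  obtain i j w where w: "(i, j) \<in> boxplus_digits m" "w \<in> boxplus m"
    "2 ^ m * fst z = real i + fst w" "2 ^ m * snd z = real j + snd w"
    using boxplus_digitsE[OF Suc.prems] by metis
  obtain a b where ab: "(a, b) \<in> boxplus_cells m k"
    "real a \<le> 2^(m*k) * fst w" "2^(m*k) * fst w \<le> real a + 1"
    "real b \<le> 2^(m*k) * snd w" "2^(m*k) * snd w \<le> real b + 1"
    using Suc.IH[OF w(2)] by auto
  have eq: "2 ^ (m * Suc k) * x = 2 ^ (m*k) * (2 ^ m * x)" for x :: real
    by (simp add: power_add)
  have "(i * 2 ^ (m*k) + a, j * 2 ^ (m*k) + b) \<in> boxplus_cells m (Suc k)"
    unfolding boxplus_cells.simps using w(1) ab(1)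
    by (intro image_eqI[of _ _ "((i, j), (a, b))"]) auto
  moreover have "2 ^ (m * Suc k) * fst z = 2 ^ (m*k) * real i + 2 ^ (m*k) * fst w"
    "2 ^ (m * Suc k) * snd z = 2 ^ (m*k) * real j + 2 ^ (m*k) * snd w"
    by (simp_all only: eq w(3,4) distrib_left)
  ultimately show ?case
    by (elim rev_bexI) (use ab(2-) in \<open>simp add: mult.commute del: mult_Suc_right\<close>)
qed

text \<open>Within a block of the grid the fractal is contained in a copy of the whole. Which blocks
  occur is not recorded, as their number only enters a constant.\<close>

lemma boxplus_blocks_cover:
  assumes "z \<in> boxplus m"
  shows "\<exists>p q w. p < 2^(m*l) \<and> q < 2^(m*l) \<and> w \<in> boxplus m \<and>
    2^(m*l) * fst z = real p + fst w \<and> 2^(m*l) * snd z = real q + snd w"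
  using assms
proof (induction l arbitrary: z)
  case 0
  then show ?case by auto
next
  case (Suc k)
  obtain i j w where w: "(i, j) \<in> boxplus_digits m" "w \<in> boxplus m"
    "2 ^ m * fst z = real i + fst w" "2 ^ m * snd z = real j + snd w"
    using boxplus_digitsE[OF Suc.prems] by metis
  obtain p q u where u: "p < 2^(m*k)" "q < 2^(m*k)" "u \<in> boxplus m"
    "2^(m*k) * fst w = real p + fst u" "2^(m*k) * snd w = real q + snd u"
    using Suc.IH[OF w(2)] by auto
  have eq: "2 ^ (m * Suc k) * x = 2 ^ (m*k) * (2 ^ m * x)" for x :: real
    by (simp add: power_add)
  have less: "i * 2 ^ (m*k) + p < 2 ^ (m * Suc k)" if "i < 2 ^ m" "p < 2 ^ (m*k)" for i p :: nat
  proof -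
    have "i * 2 ^ (m*k) + p < (i + 1) * 2 ^ (m*k)" using that by simp
    also have "\<dots> \<le> 2 ^ m * 2 ^ (m*k)" using that by (intro mult_right_mono) auto
    finally show ?thesis by (simp add: power_add)
  qed
  have "2 ^ (m * Suc k) * fst z = real (i * 2 ^ (m*k) + p) + fst u"
    "2 ^ (m * Suc k) * snd z = real (j * 2 ^ (m*k) + q) + snd u"
    by (simp_all only: eq w(3,4) distrib_left u(4,5)) simp_all
  moreover have "i * 2 ^ (m*k) + p < 2 ^ (m * Suc k)" "j * 2 ^ (m*k) + q < 2 ^ (m * Suc k)"
    using w(1) u(1,2) by (auto simp: boxplus_digits_def simp del: mult_Suc_right intro: less)
  ultimately show ?case using u(3) by blast
qed

text \<open>An active column runs through middle digits only, and each of them leaves two digits for the row.\<close>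

lemma card_active_cells: "card {(a, b)\<in>boxplus_cells m k. active m k a} \<le> 4 ^ k"
proof (induction k)
  case 0
  have "{(a, b)\<in>boxplus_cells m 0. active m 0 a} \<subseteq> {(0, 0)}" by auto
  then have "card {(a, b)\<in>boxplus_cells m 0. active m 0 a} \<le> card {(0::nat, 0::nat)}"
    by (intro card_mono) auto
  then show ?case by simp
next
  case (Suc k)
  let ?f = "\<lambda>((i, j), (a, b)). (i * 2 ^ (m*k) + a, j * 2 ^ (m*k) + b)"
  let ?D = "{2 ^ (m - 1) - 1, 2 ^ (m - 1)} \<times> {0, 2 ^ m - 1} :: (nat \<times> nat) set"
  let ?A = "{(a, b)\<in>boxplus_cells m k. active m k a}"
  have fin: "finite ?A" by (rule finite_subset[OF _ finite_boxplus_cells[of m k]]) auto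
  have "{(a, b)\<in>boxplus_cells m (Suc k). active m (Suc k) a} \<subseteq> ?f ` (?D \<times> ?A)"
  proof clarify
    fix x y assume xy: "(x, y) \<in> boxplus_cells m (Suc k)" "active m (Suc k) x"
    then obtain i j a b where *: "(i, j) \<in> boxplus_digits m" "(a, b) \<in> boxplus_cells m k"
      "x = i * 2 ^ (m*k) + a" "y = j * 2 ^ (m*k) + b" by auto
    have "mid_index m i \<and> active m k a"
      using active_digits[OF m boxplus_cells_less[OF *(2)]] xy(2) *(3) by simp
    moreover from this have "end_index m j" using *(1) by (simp add: boxplus_digits_def)
    ultimately show "(x, y) \<in> ?f ` (?D \<times> ?A)"
      using * by (intro image_eqI[of _ _ "((i, j), (a, b))"]) (auto simp: mid_index_def end_index_def)
  qed
  then have "card {(a, b)\<in>boxplus_cells m (Suc k). active m (Suc k) a} \<le> card (?f ` (?D \<times> ?A))"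
    using fin by (intro card_mono) auto
  also have "\<dots> \<le> card (?D \<times> ?A)" using fin by (intro card_image_le) auto
  also have "\<dots> = card ?D * card ?A" by (rule card_cartesian_product)
  also have "\<dots> \<le> 4 * 4 ^ k"
    using Suc.IH by (intro mult_mono) (auto simp: card_cartesian_product card_insert_if)
  finally show ?case by simp
qed

lemma card_active_cells':
  "card {(a, b)\<in>boxplus_cells m k. active m k a \<or> active m k b} \<le> 2 * 4 ^ k"
proof -
  let ?A = "{(a, b)\<in>boxplus_cells m k. active m k a}"
  have fin: "finite ?A" by (rule finite_subset[OF _ finite_boxplus_cells[of m k]]) auto
  have "{(a, b)\<in>boxplus_cells m k. active m k a \<or> active m k b} \<subseteq> ?A \<union> prod.swap ` ?A"
  proof
    fix z assume "z \<in> {(a, b)\<in>boxplus_cells m k. active m k a \<or> active m k b}"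
    then obtain a b where ab: "z = (a, b)" "(a, b) \<in> boxplus_cells m k" "active m k a \<or> active m k b"
      by auto
    have "(a, b) \<in> prod.swap ` ?A" if "active m k b"
      using that boxplus_cells_swap[OF ab(2)] by (intro image_eqI[of _ _ "(b, a)"]) auto
    with ab show "z \<in> ?A \<union> prod.swap ` ?A" by blast
  qed
  then have "card {(a, b)\<in>boxplus_cells m k. active m k a \<or> active m k b} \<le> card (?A \<union> prod.swap ` ?A)"
    using fin by (intro card_mono) auto
  also have "\<dots> \<le> card ?A + card (prod.swap ` ?A)" by (rule card_Un_le)
  also have "\<dots> \<le> card ?A + card ?A" using card_image_le[OF fin] by simp
  finally show ?thesis using card_active_cells[of k] by simp
qed

end

section \<open>Lipschitz approximation\<close>

text \<open>
  The infimal convolution of \<open>f\<close> with the concave modulus \<open>t \<mapsto> min (K t) (t powr \<alpha>)\<close>, where the two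
  branches meet at \<open>t = T\<close>.
\<close>

lemma holder_lipschitz_approx:
  fixes F :: "'a::metric_space set" and f :: "'a \<Rightarrow> real"
  assumes F: "F \<noteq> {}" and \<alpha>: "0 < \<alpha>" "\<alpha> \<le> 1" and T: "0 < T"
    and f: "\<And>a b. a \<in> F \<Longrightarrow> b \<in> F \<Longrightarrow> \<bar>f a - f b\<bar> \<le> dist a b powr \<alpha>"
    and B: "\<And>x. x \<in> F \<Longrightarrow> \<bar>f x\<bar> \<le> B"
  shows "\<exists>g. (\<forall>x y. \<bar>g x - g y\<bar> \<le> T powr (\<alpha> - 1) * dist x y) \<and>
    (\<forall>x y. \<bar>g x - g y\<bar> \<le> dist x y powr \<alpha>) \<and> (\<forall>x\<in>F. \<bar>g x - f x\<bar> \<le> T powr \<alpha>)"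
proof -
  define K where "K = T powr (\<alpha> - 1)"
  \<comment> \<open>In factored form \<open>w t / t\<close> is visibly nonincreasing, as
    \<open>\<alpha> \<le> 1\<close>. This gives subadditivity, and with it the triangle inequality
    for \<open>w (dist x y)\<close>.\<close>
  define w where "w t = t * min K (t powr (\<alpha> - 1))" for t
  have K: "K > 0" using T by (simp add: K_def)
  have w_nonneg: "0 \<le> w t" if "0 \<le> t" for t using that K by (simp add: w_def)
  have tp: "t * t powr (\<alpha> - 1) = t powr \<alpha>" if "0 \<le> t" for t
    using that by (cases "t = 0") (simp_all add: powr_diff)
  have w_eq: "w t = min (K * t) (t powr \<alpha>)" if "0 \<le> t" for t
    using that tp[OF that] unfolding w_def
    by (metis min_mult_distrib_left mult.commute)
  have w_mono: "w s \<le> w t" if "0 \<le> s" "s \<le> t" for s t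
  proof -
    have "min (K * s) (s powr \<alpha>) \<le> min (K * t) (t powr \<alpha>)"
      using that K \<alpha> by (intro min.mono mult_left_mono powr_mono2) auto
    then show ?thesis using that by (simp add: w_eq)
  qed
  have w_add: "w (s + t) \<le> w s + w t" if "0 \<le> s" "0 \<le> t" for s t
  proof -
    have part: "s * min K ((s + t) powr (\<alpha> - 1)) \<le> w s" if "0 \<le> s" "0 \<le> t" for s t
    proof (cases "s = 0")
      case False
      then have "(s + t) powr (\<alpha> - 1) \<le> s powr (\<alpha> - 1)" using that \<alpha> by (intro powr_mono2') auto
      then show ?thesis unfolding w_def using that by (intro mult_left_mono min.mono) auto
    qed (simp add: w_def)
    have "w (s + t) = s * min K ((s + t) powr (\<alpha> - 1)) + t * min K ((t + s) powr (\<alpha> - 1))"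
      by (simp add: w_def algebra_simps)
    also have "\<dots> \<le> w s + w t" using that by (intro add_mono part)
    finally show ?thesis .
  qed
  \<comment> \<open>The infimum runs over \<open>F\<close> but is taken at every point of the space,
    since the collapse may move points off the fractal.\<close>
  define g where "g x = (INF y\<in>F. f y + w (dist x y))" for x
  have bdd: "bdd_below ((\<lambda>y. f y + w (dist x y)) ` F)" for x
  proof (rule bdd_belowI2)
    fix y assume "y \<in> F"
    then show "- B \<le> f y + w (dist x y)" using B[of y] w_nonneg[of "dist x y"] by auto
  qed
  have g_le: "g x \<le> g y + w (dist x y)" for x y
  proof -
    have "g x - w (dist x y) \<le> g y"
      unfolding g_def[of y]
    proof (rule cINF_greatest[OF F])
      fix z assume z: "z \<in> F"
      have "g x \<le> f z + w (dist x z)" unfolding g_def by (rule cINF_lower[OF bdd z])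
      also have "w (dist x z) \<le> w (dist x y + dist y z)" by (intro w_mono dist_triangle) simp
      also have "\<dots> \<le> w (dist x y) + w (dist y z)" by (intro w_add) auto
      finally show "g x - w (dist x y) \<le> f z + w (dist y z)" by simp
    qed
    then show ?thesis by simp
  qed
  have g_w: "\<bar>g x - g y\<bar> \<le> w (dist x y)" for x y
    using g_le[of x y] g_le[of y x] by (simp add: dist_commute)
  have near: "\<bar>g x - f x\<bar> \<le> T powr \<alpha>" if x: "x \<in> F" for x
  proof -
    have "g x \<le> f x + w (dist x x)" unfolding g_def by (rule cINF_lower[OF bdd x])
    then have 1: "g x \<le> f x" by (simp add: w_def)
    have "f x - T powr \<alpha> \<le> g x"
      unfolding g_def
    proof (rule cINF_greatest[OF F])
      fix y assume y: "y \<in> F"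
      have "\<bar>f x - f y\<bar> \<le> dist x y powr \<alpha>" by (rule f[OF x y])
      \<comment> \<open>From \<open>T\<close> on \<open>w\<close> agrees with the power, and below
        \<open>T\<close> the power itself is at most \<open>T powr \<alpha>\<close>.\<close>
      moreover have "dist x y powr \<alpha> - w (dist x y) \<le> T powr \<alpha>"
      proof (cases "dist x y \<le> T")
        case True
        then have "dist x y powr \<alpha> \<le> T powr \<alpha>" using \<alpha> by (intro powr_mono2) auto
        then show ?thesis using w_nonneg[of "dist x y"] by simp
      next
        case False
        then have "dist x y powr (\<alpha> - 1) \<le> K" unfolding K_def using T \<alpha> by (intro powr_mono2') auto
        then have "w (dist x y) = dist x y powr \<alpha>" using tp[of "dist x y"] by (simp add: w_def min_absorb2)
        then show ?thesis by simp
      qed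
      ultimately show "f x - T powr \<alpha> \<le> f y + w (dist x y)" by linarith
    qed
    with 1 show ?thesis by simp
  qed
  show ?thesis
  proof (intro exI[of _ g] conjI allI ballI)
    fix x y
    show "\<bar>g x - g y\<bar> \<le> T powr (\<alpha> - 1) * dist x y"
      using order_trans[OF g_w[of x y], of "K * dist x y"] by (simp add: w_eq K_def)
    show "\<bar>g x - g y\<bar> \<le> dist x y powr \<alpha>"
      using order_trans[OF g_w[of x y], of "dist x y powr \<alpha>"] by (simp add: w_eq)
  qed (rule near)
qed

section \<open>Collapsing the cells of a grid\<close>

lemma dist_le_sum_coords:
  fixes z w :: "real \<times> real"
  shows "dist z w \<le> \<bar>fst z - fst w\<bar> + \<bar>snd z - snd w\<bar>"
  by (cases z, cases w) (simp add: dist_Pair_Pair dist_real_def sqrt_sum_squares_le_sum_abs)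

text \<open>On \<open>\<boxplus>\<close>, all but few small squares of each cell of the grid are mapped to a point.\<close>

definition collapse :: "nat \<Rightarrow> nat \<Rightarrow> real \<Rightarrow> real \<times> real \<Rightarrow> real \<times> real" where
  "collapse m k M z = (stretch m k (M * fst z) / M, stretch m k (M * snd z) / M)"

context
  fixes m :: nat
  assumes m: "m \<ge> 2"
begin

lemma collapse_near:
  assumes "M > 0" shows "dist (collapse m k M z) z \<le> 2 / M"
proof -
  have "\<bar>stretch m k (M * x) / M - x\<bar> \<le> 1 / M" for x
  proof -
    have "stretch m k (M * x) / M - x = (stretch m k (M * x) - M * x) / M"
      using assms by (simp add: field_simps)
    then show ?thesis using stretch_near[OF m, of k "M * x"] assms by (simp add: abs_divide divide_right_mono)
  qed
  from this[of "fst z"] this[of "snd z"] dist_le_sum_coords[of "collapse m k M z" z]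
  show ?thesis by (simp add: collapse_def)
qed

lemma collapse_holder:
  assumes M: "M > 0" and d: "\<bar>M * fst z - M * fst w\<bar> \<le> d" "\<bar>M * snd z - M * snd w\<bar> \<le> d" "d \<le> 1/2"
  shows "dist (collapse m k M z) (collapse m k M w) \<le> 8 * d powr (1 / real m) / M"
proof -
  have "\<bar>stretch m k (M * x) / M - stretch m k (M * y) / M\<bar> \<le> 4 * d powr (1 / real m) / M"
    if "\<bar>M * x - M * y\<bar> \<le> d" for x y
  proof -
    have "\<bar>stretch m k (M * x) - stretch m k (M * y)\<bar> \<le> 4 * \<bar>M * x - M * y\<bar> powr (1 / real m)"
      using that d(3) by (intro stretch_holder[OF m]) auto
    also have "\<dots> \<le> 4 * d powr (1 / real m)" using that by (intro mult_left_mono powr_mono2) auto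
    finally show ?thesis using M by (simp add: abs_divide divide_right_mono flip: diff_divide_distrib)
  qed
  from this[OF d(1)] this[OF d(2)] dist_le_sum_coords[of "collapse m k M z" "collapse m k M w"]
  show ?thesis by (simp add: collapse_def)
qed

text \<open>Within half a cell the exponent 1/m of the collapse beats \<open>\<alpha>\<close>, and
  the second bound in \<open>M\<close> makes the constant small. Farther apart, the collapse changes
  \<open>g\<close> by at most \<open>2 * K / M\<close> at each of the two points, and the factor
  \<open>1 - \<epsilon>\<close> makes room for that.\<close>

lemma collapse_holder1:
  fixes g :: "real \<times> real \<Rightarrow> real"
  assumes K: "0 < K" and g: "\<And>x y. \<bar>g x - g y\<bar> \<le> K * dist x y" "\<And>x y. \<bar>g x - g y\<bar> \<le> dist x y powr \<alpha>"
    and \<alpha>: "0 < \<alpha>" "\<alpha> < 1 / real m" and \<epsilon>: "0 < \<epsilon>" "\<epsilon> \<le> 1"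
    and M: "M \<ge> 1" "8 * K * M powr (\<alpha> - 1) \<le> \<epsilon>"
  shows "\<bar>(1 - \<epsilon>) * g (collapse m k M a) - (1 - \<epsilon>) * g (collapse m k M b)\<bar> \<le> dist a b powr \<alpha>"
proof -
  let ?d = "dist a b" and ?T = "collapse m k M"
  have M0: "M > 0" using M by simp
  have Mp: "M powr (\<alpha> - 1) = M powr \<alpha> / M" using M0 by (simp add: powr_diff)
  have fac: "\<bar>(1 - \<epsilon>) * g (?T a) - (1 - \<epsilon>) * g (?T b)\<bar> = (1 - \<epsilon>) * \<bar>g (?T a) - g (?T b)\<bar>"
    using \<epsilon> by (simp add: abs_mult flip: right_diff_distrib)
  show ?thesis
  proof (cases "M * ?d \<le> 1/2")
    case True
    have "\<bar>M * fst a - M * fst b\<bar> \<le> M * ?d" "\<bar>M * snd a - M * snd b\<bar> \<le> M * ?d"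
      using M0 dist_fst_le[of a b] dist_snd_le[of a b]
      by (simp_all add: abs_mult dist_real_def flip: right_diff_distrib)
    then have "dist (?T a) (?T b) \<le> 8 * (M * ?d) powr (1 / real m) / M"
      using True by (intro collapse_holder[OF M0])
    \<comment> \<open>As \<open>M * ?d \<le> 1\<close>, lowering the exponent to
      \<open>\<alpha>\<close> increases the power; this is where
      \<open>\<alpha> < 1 / real m\<close> enters.\<close>
    also have "\<dots> \<le> 8 * (M * ?d) powr \<alpha> / M"
      using True \<alpha> M0 by (intro divide_right_mono mult_left_mono powr_mono') auto
    also have "\<dots> = 8 * M powr (\<alpha> - 1) * ?d powr \<alpha>" using M0 by (simp add: powr_mult Mp)
    finally have "K * dist (?T a) (?T b) \<le> K * (8 * M powr (\<alpha> - 1) * ?d powr \<alpha>)"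
      using K by (intro mult_left_mono) auto
    also have "\<dots> = (8 * K * M powr (\<alpha> - 1)) * ?d powr \<alpha>" by simp
    also have "\<dots> \<le> 1 * ?d powr \<alpha>" using M(2) \<epsilon> by (intro mult_right_mono) auto
    finally have "\<bar>g (?T a) - g (?T b)\<bar> \<le> ?d powr \<alpha>" using g(1)[of "?T a" "?T b"] by linarith
    moreover have "(1 - \<epsilon>) * \<bar>g (?T a) - g (?T b)\<bar> \<le> 1 * \<bar>g (?T a) - g (?T b)\<bar>"
      using \<epsilon> by (intro mult_right_mono) auto
    ultimately show ?thesis unfolding fac by (metis mult_1 order_trans)
  next
    case False
    have "\<bar>g (?T c) - g c\<bar> \<le> 2 * K / M" for c
    proof -
      have "\<bar>g (?T c) - g c\<bar> \<le> K * dist (?T c) c" by (rule g(1))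
      also have "\<dots> \<le> K * (2 / M)" using K collapse_near[OF M0] by (intro mult_left_mono) auto
      finally show ?thesis by (simp add: mult.commute)
    qed
    from this[of a] this[of b] g(2)[of a b]
    have "\<bar>g (?T a) - g (?T b)\<bar> \<le> ?d powr \<alpha> + 4 * K / M" by linarith
    then have "(1 - \<epsilon>) * \<bar>g (?T a) - g (?T b)\<bar> \<le> (1 - \<epsilon>) * (?d powr \<alpha> + 4 * K / M)"
      using \<epsilon> by (intro mult_left_mono) auto
    also have "\<dots> \<le> (1 - \<epsilon>) * ?d powr \<alpha> + 4 * K / M"
      using mult_left_le_one_le[of "4 * K / M" "1 - \<epsilon>"] \<epsilon> K M0 by (simp add: distrib_left)
    \<comment> \<open>Here \<open>?d\<close> exceeds \<open>1 / (2 * M)\<close>, so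
      \<open>(M * ?d) powr \<alpha>\<close> is at least 1/2.\<close>
    also have "4 * K / M \<le> \<epsilon> * ?d powr \<alpha>"
    proof -
      have "(1/2) powr 1 \<le> (1/2::real) powr \<alpha>" using \<alpha> m
        by (intro powr_mono') (auto intro: order.trans[of _ "1 / real m"])
      also have "\<dots> \<le> (M * ?d) powr \<alpha>" using False \<alpha> by (intro powr_mono2) auto
      also have "\<dots> = M powr \<alpha> * ?d powr \<alpha>" using M0 by (simp add: powr_mult)
      finally have "1/2 \<le> M powr \<alpha> * ?d powr \<alpha>" by simp
      then have "(8 * K / M) * (1/2) \<le> (8 * K / M) * (M powr \<alpha> * ?d powr \<alpha>)"
        using K M0 by (intro mult_left_mono) auto
      also have "\<dots> = (8 * K * M powr (\<alpha> - 1)) * ?d powr \<alpha>" by (simp add: Mp)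
      also have "\<dots> \<le> \<epsilon> * ?d powr \<alpha>" using M(2) by (intro mult_right_mono) auto
      finally show ?thesis by simp
    qed
    finally show ?thesis unfolding fac by (simp add: algebra_simps)
  qed
qed

end

text \<open>Markov's inequality for the number of intervals of radius \<open>w\<close> around the
  \<open>v i\<close> that contain \<open>r\<close>; the integral of this number is
  \<open>card J * (2 * w)\<close>.\<close>

lemma few_intervals:
  fixes v :: "'i \<Rightarrow> real"
  assumes J: "finite J" and w: "0 \<le> w" and N: "0 < N" and le: "real (card J) * (2 * w) \<le> N * \<eta>"
  shows "\<exists>R\<in>sets borel. emeasure lborel R \<le> ennreal \<eta> \<and>
    (\<forall>r. r \<notin> R \<longrightarrow> real (card {i\<in>J. \<bar>v i - r\<bar> \<le> w}) \<le> N)"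
proof -
  define u :: "real \<Rightarrow> ennreal" where "u r = (\<Sum>i\<in>J. indicator {v i - w .. v i + w} r)" for r
  have u: "u \<in> borel_measurable lborel" unfolding u_def by measurable
  have u_card: "u r = ennreal (real (card {i\<in>J. \<bar>v i - r\<bar> \<le> w}))" for r
  proof -
    have "u r = (\<Sum>i\<in>J. if \<bar>v i - r\<bar> \<le> w then 1 else 0)"
      unfolding u_def by (intro sum.cong) (auto simp: indicator_def)
    also have "\<dots> = of_nat (card {i\<in>J. \<bar>v i - r\<bar> \<le> w})" using J by (simp flip: sum.inter_filter)
    finally show ?thesis by (simp add: ennreal_of_nat_eq_real_of_nat)
  qed
  have int: "(\<integral>\<^sup>+ r. u r \<partial>lborel) = ennreal (real (card J) * (2 * w))"
  proof -
    have "(\<integral>\<^sup>+ r. u r \<partial>lborel) = (\<Sum>i\<in>J. emeasure lborel {v i - w .. v i + w})"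
      unfolding u_def by (subst nn_integral_sum) auto
    also have "\<dots> = (\<Sum>i\<in>J. ennreal (2 * w))" using w by (intro sum.cong) auto
    finally show ?thesis using w by (simp add: ennreal_mult ennreal_of_nat_eq_real_of_nat)
  qed
  let ?R = "{r \<in> UNIV. 1 \<le> ennreal (1 / N) * u r}"
  have "emeasure lborel ?R \<le> ennreal (1 / N) * (\<integral>\<^sup>+ r. u r * indicator UNIV r \<partial>lborel)"
    using u by (intro nn_integral_Markov_inequality) auto
  also have "\<dots> = ennreal (1 / N * (real (card J) * (2 * w)))"
    by (subst ennreal_mult) (use N w int in simp_all)
  also have "\<dots> \<le> ennreal \<eta>" using le N by (intro ennreal_leI) (simp add: field_simps)
  finally have "emeasure lborel ?R \<le> ennreal \<eta>" .
  moreover have "?R \<in> sets borel"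
  proof -
    have "?R = {r \<in> space lborel. 1 \<le> ennreal (1 / N) * u r}" by simp
    also have "\<dots> \<in> sets lborel" using u by measurable
    finally show ?thesis by simp
  qed
  moreover have "real (card {i\<in>J. \<bar>v i - r\<bar> \<le> w}) \<le> N" if "r \<notin> ?R" for r
  proof -
    have "ennreal (1 / N * real (card {i\<in>J. \<bar>v i - r\<bar> \<le> w})) < 1"
      using that N by (simp add: u_card not_le flip: ennreal_mult)
    then have "1 / N * real (card {i\<in>J. \<bar>v i - r\<bar> \<le> w}) < 1"
      using ennreal_less_iff[of "1 / N * real (card {i\<in>J. \<bar>v i - r\<bar> \<le> w})" 1] N by simp
    then show ?thesis using N by (simp add: field_simps)
  qed
  ultimately show ?thesis by blast
qed

section \<open>The level sets of a collapsed function\<close>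

context
  fixes m :: nat
  assumes m: "m \<ge> 2"
begin

text \<open>\<open>(p, q)\<close> is a cell of the grid of mesh \<open>1 / M\<close>, and
  \<open>(a, b)\<close> a square in it whose side is 2^(-m k) times that of the cell.\<close>

definition small_square :: "real \<Rightarrow> nat \<Rightarrow> (nat \<times> nat) \<times> (nat \<times> nat) \<Rightarrow> (real \<times> real) set" where
  "small_square M k = (\<lambda>((p, q), (a, b)). {z.
     real a \<le> 2^(m*k) * (M * fst z - real p) \<and> 2^(m*k) * (M * fst z - real p) \<le> real a + 1 \<and>
     real b \<le> 2^(m*k) * (M * snd z - real q) \<and> 2^(m*k) * (M * snd z - real q) \<le> real b + 1})"

lemma small_square_coords:
  assumes "z \<in> small_square M k i" "w \<in> small_square M k i"
  shows "\<bar>M * fst z - M * fst w\<bar> \<le> 1 / 2^(m*k)" "\<bar>M * snd z - M * snd w\<bar> \<le> 1 / 2^(m*k)"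
proof -
  have *: "\<bar>x - y\<bar> \<le> 1 / 2^(m*k)"
    if "a \<le> 2^(m*k) * (x - p)" "2^(m*k) * (x - p) \<le> a + 1"
      "a \<le> 2^(m*k) * (y - p)" "2^(m*k) * (y - p) \<le> a + 1" for a p x y :: real
  proof -
    have "\<bar>2^(m*k) * (x - p) - 2^(m*k) * (y - p)\<bar> \<le> 1" using that by linarith
    moreover have "2^(m*k) * (x - p) - 2^(m*k) * (y - p) = 2^(m*k) * (x - y)" by (simp add: algebra_simps)
    ultimately have "2^(m*k) * \<bar>x - y\<bar> \<le> 1" by (simp add: abs_mult)
    then show ?thesis by (simp add: field_simps)
  qed
  obtain p q a b where i: "i = ((p, q), (a, b))" by (metis prod.collapse)
  show "\<bar>M * fst z - M * fst w\<bar> \<le> 1 / 2^(m*k)"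
    by (rule *[of "real a" _ "real p"]) (use assms in \<open>simp_all add: i small_square_def\<close>)
  show "\<bar>M * snd z - M * snd w\<bar> \<le> 1 / 2^(m*k)"
    by (rule *[of "real b" _ "real q"]) (use assms in \<open>simp_all add: i small_square_def\<close>)
qed

lemma small_square_diameter:
  assumes "M > 0"
  shows "bounded (small_square M k i) \<and> diameter (small_square M k i) \<le> 2 / (2^(m*k) * M)"
proof -
  have d: "dist z w \<le> 2 / (2^(m*k) * M)" if "z \<in> small_square M k i" "w \<in> small_square M k i" for z w
  proof -
    have *: "\<bar>x - y\<bar> \<le> 1 / (2^(m*k) * M)" if "\<bar>M * x - M * y\<bar> \<le> 1 / 2^(m*k)" for x y
    proof -
      have "M * \<bar>x - y\<bar> \<le> 1 / 2^(m*k)" using that assms by (simp add: abs_mult flip: right_diff_distrib)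
      then show ?thesis using assms by (simp add: field_simps)
    qed
    show ?thesis
      using *[OF small_square_coords(1)[OF that]] *[OF small_square_coords(2)[OF that]] dist_le_sum_coords[of z w]
      unfolding one_add_one[symmetric] add_divide_distrib by linarith
  qed
  have "bounded (small_square M k i)"
  proof (cases "small_square M k i = {}")
    case False
    then obtain z where "z \<in> small_square M k i" by blast
    then show ?thesis unfolding bounded_def using d by meson
  next
    case True
    then show ?thesis by (metis bounded_empty)
  qed
  then show ?thesis using d assms by (intro conjI diameter_le_dist) auto
qed

lemma small_square_cover:
  assumes "z \<in> boxplus m"
  shows "\<exists>i\<in>({..<2^(m*l)} \<times> {..<2^(m*l)}) \<times> boxplus_cells m k. z \<in> small_square (2^(m*l)) k i"
proof -
  obtain p q w where pq: "p < 2^(m*l)" "q < 2^(m*l)" "w \<in> boxplus m"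
    "2^(m*l) * fst z = real p + fst w" "2^(m*l) * snd z = real q + snd w"
    using boxplus_blocks_cover[OF m assms, of l] by blast
  obtain a b where ab: "(a, b) \<in> boxplus_cells m k"
    "real a \<le> 2^(m*k) * fst w" "2^(m*k) * fst w \<le> real a + 1"
    "real b \<le> 2^(m*k) * snd w" "2^(m*k) * snd w \<le> real b + 1"
    using boxplus_cells_cover[OF m pq(3), of k] by auto
  have "z \<in> small_square (2^(m*l)) k ((p, q), (a, b))"
    unfolding small_square_def using ab pq by simp
  then show ?thesis using pq(1,2) ab(1) by (intro bexI[of _ "((p, q), (a, b))"]) auto
qed

lemma collapse_inactive:
  assumes i: "i = ((p, q), (a, b))" and ab: "(a, b) \<in> boxplus_cells m k"
    and inact: "\<not> active m k a" "\<not> active m k b"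
    and zw: "z \<in> small_square M k i" "w \<in> small_square M k i"
  shows "collapse m k M z = collapse m k M w"
proof -
  have *: "stretch m k x = stretch m k y"
    if c: "c < 2^(m*k)" "\<not> active m k c" and
      x: "real c \<le> 2^(m*k) * (x - real p)" "2^(m*k) * (x - real p) \<le> real c + 1" and
      y: "real c \<le> 2^(m*k) * (y - real p)" "2^(m*k) * (y - real p) \<le> real c + 1" for c p x y
  proof -
    have range: "0 \<le> u \<and> u \<le> 1" if u: "real c \<le> 2^(m*k) * u" "2^(m*k) * u \<le> real c + 1" for u :: real
    proof -
      have "2^(m*k) * 0 \<le> 2^(m*k) * u" using u(1) by simp
      then have "0 \<le> u" by (subst (asm) mult_le_cancel_left_pos) simp_all
      moreover have "real (c + 1) \<le> real (2^(m*k))" using c by (simp only: of_nat_le_iff)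
      then have "real c + 1 \<le> 2^(m*k)" by simp
      then have "2^(m*k) * u \<le> 2^(m*k) * 1" using u(2) by linarith
      then have "u \<le> 1" by (subst (asm) mult_le_cancel_left_pos) simp_all
      ultimately show ?thesis by simp
    qed
    \<comment> \<open>At the right end of the cell the floor is already \<open>p + 1\<close>, hence
      \<open>stretch_eq\<close> instead of the definition.\<close>
    have "stretch m k u = real p + stair m k (u - real p)" if "0 \<le> u - real p \<and> u - real p \<le> 1" for u
      using stretch_eq[OF m, of "int p" u k] that by simp
    then show ?thesis
      using range[OF x] range[OF y] stair_inactive[OF m c(2) x y] by simp
  qed
  have "a < 2^(m*k)" "b < 2^(m*k)"
    using boxplus_cells_less[OF ab] boxplus_cells_less[OF boxplus_cells_swap[OF ab]] by auto
  note less = this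
  have "stretch m k (M * fst z) = stretch m k (M * fst w)"
    by (rule *[of a _ p, OF less(1) inact(1)]) (use zw in \<open>simp_all add: i small_square_def\<close>)
  moreover have "stretch m k (M * snd z) = stretch m k (M * snd w)"
    by (rule *[of b _ q, OF less(2) inact(2)]) (use zw in \<open>simp_all add: i small_square_def\<close>)
  ultimately show ?thesis unfolding collapse_def by simp
qed

lemma collapse_osc:
  fixes g :: "real \<times> real \<Rightarrow> real"
  assumes K: "0 < K" and g: "\<And>x y. \<bar>g x - g y\<bar> \<le> K * dist x y"
    and c: "0 \<le> c" "c \<le> 1" and M: "M > 0" and k: "k \<ge> 1"
    and zw: "z \<in> small_square M k i" "w \<in> small_square M k i"
  shows "\<bar>c * g (collapse m k M z) - c * g (collapse m k M w)\<bar> \<le> 8 * K / 2^k / M"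
proof -
  \<comment> \<open>\<open>k \<ge> 1\<close> makes the square at most half as wide as a cell, as
    \<open>collapse_holder\<close> demands.\<close>
  have "m * 1 \<le> m * k" using k by (intro mult_left_mono) auto
  then have "(2::real) ^ 1 \<le> 2 ^ (m*k)" using m by (intro power_increasing) auto
  then have half: "1 / 2^(m*k) \<le> (1/2 :: real)" by (simp add: field_simps)
  have pw: "(1 / 2^(m*k)) powr (1 / real m) = 1 / (2::real)^k"
  proof -
    have "((2::real)^(m*k)) powr (1 / real m) = ((2^m) powr (1 / real m)) ^ k"
      by (simp add: power_mult powr_powr mult.commute flip: powr_realpow)
    then show ?thesis using powr_inverse_m(1)[OF m] by (simp add: powr_divide)
  qed
  have "dist (collapse m k M z) (collapse m k M w) \<le> 8 * (1 / 2^(m*k)) powr (1 / real m) / M"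
    using half by (intro collapse_holder[OF m M] small_square_coords[OF zw])
  then have "K * dist (collapse m k M z) (collapse m k M w) \<le> K * (8 * (1 / 2^k) / M)"
    unfolding pw using K by (intro mult_left_mono) auto
  then have "\<bar>g (collapse m k M z) - g (collapse m k M w)\<bar> \<le> 8 * K / 2^k / M"
    using g[of "collapse m k M z" "collapse m k M w"] by (simp add: mult.commute)
  moreover have "\<bar>c * g (collapse m k M z) - c * g (collapse m k M w)\<bar> \<le>
      \<bar>g (collapse m k M z) - g (collapse m k M w)\<bar>"
    using c by (simp add: abs_mult mult_left_le_one_le flip: right_diff_distrib)
  ultimately show ?thesis by (rule order_trans[rotated])
qed

text \<open>At most \<open>2 * M^2 * 4^k\<close> active squares with oscillation of order
  \<open>K / (2^k * M)\<close> give a total length of order \<open>K * M * 2^k\<close>, to which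
  Markov's inequality applies. An inactive square carries one value only, which is excluded together
  with a neighbourhood; so these squares never enter the cover.\<close>

lemma collapse_level_sets:
  fixes g :: "real \<times> real \<Rightarrow> real"
  assumes K: "0 < K" and g: "\<And>x y. \<bar>g x - g y\<bar> \<le> K * dist x y"
    and c: "0 \<le> c" "c \<le> 1" and M: "M = 2^(m*l)" and \<eta>: "\<eta> > 0" and k: "k \<ge> 1"
  shows "\<exists>\<delta>>0. \<exists>R\<in>sets borel. emeasure lborel R \<le> ennreal \<eta> \<and> (\<forall>r. r \<notin> R \<longrightarrow> (\<exists>\<C>. finite \<C> \<and>
    {z\<in>boxplus m. \<bar>c * g (collapse m k M z) - r\<bar> \<le> \<delta>} \<subseteq> \<Union>\<C> \<and>
    real (card \<C>) \<le> 128 * K * M / \<eta> * 2^k \<and>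
    (\<forall>U\<in>\<C>. bounded U \<and> diameter U \<le> 2 / (2^(m*k) * M))))"
proof -
  define f where "f z = c * g (collapse m k M z)" for z
  define J :: "((nat \<times> nat) \<times> (nat \<times> nat)) set" where "J = ({..<2^(m*l)} \<times> {..<2^(m*l)}) \<times> boxplus_cells m k"
  define Jact :: "((nat \<times> nat) \<times> (nat \<times> nat)) set" where "Jact = ({..<2^(m*l)} \<times> {..<2^(m*l)}) \<times>
    {(a, b)\<in>boxplus_cells m k. active m k a \<or> active m k b}"
  define S where "S = small_square M k"
  \<comment> \<open>Arbitrary for an empty square, but \<open>v_osc\<close> and
    \<open>v_inact\<close> only concern squares that contain a point.\<close>
  define v where "v i = f (SOME z. z \<in> S i)" for i
  define osc where "osc = 8 * K / 2^k / M"
  have M0: "M > 0" by (simp add: M)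
  have fin: "finite J" by (simp add: J_def finite_boxplus_cells)
  have sub: "Jact \<subseteq> J" by (auto simp: J_def Jact_def)
  have finA: "finite Jact" using fin sub finite_subset by blast
  have osc: "osc > 0" using K M0 by (simp add: osc_def)
  have v_osc: "\<bar>f z - v i\<bar> \<le> osc" if z: "z \<in> S i" for z i
    unfolding f_def v_def osc_def
    using collapse_osc[OF K g c M0 k] z someI[of "\<lambda>z. z \<in> S i", OF z] by (simp add: S_def)
  have v_inact: "f z = v i" if z: "z \<in> S i" and i: "i \<in> J - Jact" for z i
  proof -
    obtain p q a b where pq: "i = ((p, q), (a, b))" by (metis prod.collapse)
    have "(a, b) \<in> boxplus_cells m k" "\<not> active m k a" "\<not> active m k b"
      using i by (auto simp: pq J_def Jact_def)
    from collapse_inactive[OF pq this] z someI[of "\<lambda>z. z \<in> S i", OF z]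
    show ?thesis unfolding f_def v_def S_def by metis
  qed
  have cardA: "real (card Jact) \<le> M\<^sup>2 * (2 * 4^k)"
  proof -
    have "card Jact = 2^(m*l) * 2^(m*l) * card {(a, b)\<in>boxplus_cells m k. active m k a \<or> active m k b}"
      by (simp add: Jact_def card_cartesian_product)
    also have "real \<dots> \<le> M\<^sup>2 * (2 * 4^k)"
    proof -
      have "real (card {(a, b)\<in>boxplus_cells m k. active m k a \<or> active m k b}) \<le> real (2 * 4^k)"
        using card_active_cells'[OF m, of k] by (simp only: of_nat_le_iff)
      then show ?thesis by (simp add: M power2_eq_square mult_left_mono)
    qed
    finally show ?thesis .
  qed
  \<comment> \<open>The first term lets the radius \<open>2 * osc\<close> absorb both the
    oscillation and \<open>\<delta>\<close>; the second bounds the length of the neighbourhoods in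
    \<open>R1\<close> by \<open>\<eta> / 2\<close>.\<close>
  define \<delta> where "\<delta> = min osc (\<eta> / (4 * (real (card J) + 1)))"
  have \<delta>: "\<delta> > 0" "\<delta> \<le> osc" using osc \<eta> by (auto simp: \<delta>_def intro!: divide_pos_pos)
  define R1 where "R1 = (\<Union>i\<in>J. {v i - \<delta> .. v i + \<delta>})"
  have R1: "R1 \<in> sets borel" unfolding R1_def using fin by (intro sets.finite_UN) auto
  have "emeasure lborel R1 \<le> (\<Sum>i\<in>J. emeasure lborel {v i - \<delta> .. v i + \<delta>})"
    unfolding R1_def using fin by (intro emeasure_subadditive_finite) auto
  also have "\<dots> = ennreal (real (card J) * (2 * \<delta>))"
    using \<delta>(1) by (simp add: ennreal_mult ennreal_of_nat_eq_real_of_nat)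
  also have "\<dots> \<le> ennreal (\<eta> / 2)"
  proof (rule ennreal_leI)
    have "\<delta> \<le> \<eta> / (4 * (real (card J) + 1))" by (simp add: \<delta>_def)
    then have "\<delta> * (4 * (real (card J) + 1)) \<le> \<eta>" by (simp add: pos_le_divide_eq)
    then show "real (card J) * (2 * \<delta>) \<le> \<eta> / 2" using \<delta>(1) by (simp add: algebra_simps)
  qed
  finally have mR1: "emeasure lborel R1 \<le> ennreal (\<eta> / 2)" .
  \<comment> \<open>Solves \<open>64 * K * M * 2^k = N * (\<eta> / 2)\<close>, the left hand side
    being the length of \<open>2 * M^2 * 4^k\<close> intervals of radius
    \<open>2 * osc\<close>.\<close>
  define N where "N = 128 * K * M / \<eta> * 2^k"
  have N: "N > 0" using K M0 \<eta> by (simp add: N_def)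
  have "real (card Jact) * (2 * (2 * osc)) \<le> (M\<^sup>2 * (2 * 4^k)) * (2 * (2 * osc))"
    using cardA osc by (intro mult_right_mono) auto
  also have "\<dots> = 64 * K * M * 2^k"
  proof -
    have "(4::real)^k = 2^k * 2^k" by (simp flip: power_mult_distrib)
    then show ?thesis using M0 by (simp add: osc_def power2_eq_square field_simps)
  qed
  also have "\<dots> = N * (\<eta> / 2)" using \<eta> by (simp add: N_def)
  finally obtain R2 where R2: "R2 \<in> sets borel" "emeasure lborel R2 \<le> ennreal (\<eta> / 2)"
    "\<And>r. r \<notin> R2 \<Longrightarrow> real (card {i\<in>Jact. \<bar>v i - r\<bar> \<le> 2 * osc}) \<le> N"
    using few_intervals[OF finA, of "2 * osc" N "\<eta> / 2" v] osc N by auto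
  have "emeasure lborel (R1 \<union> R2) \<le> emeasure lborel R1 + emeasure lborel R2"
    using R1 R2(1) by (intro emeasure_subadditive) auto
  also have "\<dots> \<le> ennreal (\<eta> / 2) + ennreal (\<eta> / 2)" by (intro add_mono mR1 R2(2))
  also have "\<dots> = ennreal \<eta>" using \<eta> by (simp flip: ennreal_plus)
  finally have mR: "emeasure lborel (R1 \<union> R2) \<le> ennreal \<eta>" .
  have cover: "\<exists>\<C>. finite \<C> \<and> {z\<in>boxplus m. \<bar>f z - r\<bar> \<le> \<delta>} \<subseteq> \<Union>\<C> \<and> real (card \<C>) \<le> N \<and>
    (\<forall>U\<in>\<C>. bounded U \<and> diameter U \<le> 2 / (2^(m*k) * M))" if r: "r \<notin> R1 \<union> R2" for r
  proof -
    let ?I = "{i\<in>Jact. \<bar>v i - r\<bar> \<le> 2 * osc}"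
    have finI: "finite ?I" using finA by simp
    have "card (S ` ?I) \<le> card ?I" by (rule card_image_le[OF finI])
    then have cardI: "real (card (S ` ?I)) \<le> N" using R2(3)[of r] r by simp
    have "z \<in> \<Union>(S ` ?I)" if z: "z \<in> boxplus m" "\<bar>f z - r\<bar> \<le> \<delta>" for z
    proof -
      obtain i where i: "i \<in> J" "z \<in> S i"
        using small_square_cover[OF z(1), of l k] unfolding J_def S_def M by blast
      have "i \<in> Jact"
      proof (rule ccontr)
        assume "i \<notin> Jact"
        then have "f z = v i" using v_inact[OF i(2)] i(1) by blast
        then have "r \<in> {v i - \<delta> .. v i + \<delta>}" using z(2) by auto
        then show False using r i(1) by (auto simp: R1_def)
      qed
      moreover have "\<bar>v i - r\<bar> \<le> 2 * osc" using v_osc[OF i(2)] z(2) \<delta>(2) by linarith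
      ultimately show ?thesis using i(2) by blast
    qed
    then have sub: "{z\<in>boxplus m. \<bar>f z - r\<bar> \<le> \<delta>} \<subseteq> \<Union>(S ` ?I)" by blast
    have "\<forall>U\<in>S ` ?I. bounded U \<and> diameter U \<le> 2 / (2^(m*k) * M)"
      using small_square_diameter[OF M0] by (simp add: S_def)
    then show ?thesis using finI cardI sub by (intro exI[of _ "S ` ?I"]) simp
  qed
  show ?thesis
    using \<delta>(1) R1 R2(1) mR cover unfolding f_def N_def
    by (intro exI[of _ \<delta>] conjI bexI[of _ "R1 \<union> R2"] allI impI) simp_all
qed

end

section \<open>Generic level sets are small\<close>

text \<open>One good scale for each \<open>n\<close> suffices for a lower limit. The measures
  \<open>(1/2) ^ n\<close> are summable, so by Borel-Cantelli almost every level avoids the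
  exceptional sets from some \<open>n\<close> on.\<close>

definition small_levels :: "nat \<Rightarrow> (real \<times> real \<Rightarrow> real) \<Rightarrow> nat \<Rightarrow> bool" where
  "small_levels m f n \<longleftrightarrow> (\<exists>R\<in>sets borel. emeasure lborel R \<le> ennreal ((1/2) ^ n) \<and>
     (\<forall>r. r \<notin> R \<longrightarrow> (\<exists>\<delta>. 0 < \<delta> \<and> \<delta> < 1 / real (Suc n) \<and>
       ln (real (covering_number \<delta> {x\<in>boxplus m. f x = r})) / - ln \<delta> \<le> 1 / real m + 1 / real (Suc n))))"

lemma small_levels_AE:
  assumes "\<And>n. small_levels m f n"
  shows "AE r in lborel. lower_box_dim {x\<in>boxplus m. f x = r} \<le> ereal (1 / real m)"
proof -
  let ?P = "\<lambda>n r. \<exists>\<delta>. 0 < \<delta> \<and> \<delta> < 1 / real (Suc n) \<and>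
       ln (real (covering_number \<delta> {x\<in>boxplus m. f x = r})) / - ln \<delta> \<le> 1 / real m + 1 / real (Suc n)"
  have "\<forall>n. \<exists>R. R \<in> sets borel \<and> emeasure lborel R \<le> ennreal ((1/2) ^ n) \<and> (\<forall>r. r \<notin> R \<longrightarrow> ?P n r)"
    using assms unfolding small_levels_def Bex_def by (rule allI)
  from choice[OF this] obtain R where R': "\<forall>n. R n \<in> sets borel \<and>
      emeasure lborel (R n) \<le> ennreal ((1/2) ^ n) \<and> (\<forall>r. r \<notin> R n \<longrightarrow> ?P n r)" by (rule exE)
  have R: "R n \<in> sets borel" "emeasure lborel (R n) \<le> ennreal ((1/2) ^ n)" for n
    using R' by simp_all
  have small: "?P n r" if "r \<notin> R n" for n r
    using spec[OF R', of n] that by (elim conjE allE[of _ r] impE)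
  have "AE r in lborel. eventually (\<lambda>n. r \<in> space lborel - R n) sequentially"
  proof (rule borel_cantelli_AE1)
    show "R n \<in> sets lborel" for n using R(1) by simp
    show fin: "emeasure lborel (R n) < \<infinity>" for n
      using R(2)[of n] by (simp add: order_le_less_trans)
    show "summable (\<lambda>n. measure lborel (R n))"
    proof (rule summable_comparison_test'[of "\<lambda>n. (1/2::real) ^ n"])
      fix n
      have "measure lborel (R n) \<le> (1/2) ^ n"
        unfolding measure_def using R(2)[of n] by (intro enn2real_leI) auto
      then show "norm (measure lborel (R n)) \<le> (1/2) ^ n" by simp
    qed simp
  qed
  then show ?thesis
  proof eventually_elim
    fix r assume "eventually (\<lambda>n. r \<in> space lborel - R n) sequentially"
    then obtain n0 where n0: "\<And>n. n \<ge> n0 \<Longrightarrow> r \<notin> R n"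
      unfolding eventually_sequentially by auto
    show "lower_box_dim {x\<in>boxplus m. f x = r} \<le> ereal (1 / real m)"
    proof (rule ereal_le_epsilon2)
      fix e :: real assume e: "0 < e"
      have "lower_box_dim {x\<in>boxplus m. f x = r} \<le> ereal (1 / real m + e)"
      proof (rule lower_box_dim_leI)
        fix b :: real assume b: "b > 0"
        then have "min b e > 0" using e by simp
        then obtain n1 where n1: "1 / real (Suc n1) < min b e" using nat_approx_posE by blast
        define n where "n = max n0 n1"
        have "1 / real (Suc n) \<le> 1 / real (Suc n1)" by (simp add: n_def frac_le)
        then have n: "1 / real (Suc n) < b" "1 / real (Suc n) < e" using n1 by linarith+
        have "r \<notin> R n" using n0 by (simp add: n_def)
        from small[OF this] obtain \<delta> where "0 < \<delta>" "\<delta> < 1 / real (Suc n)"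
          "ln (real (covering_number \<delta> {x\<in>boxplus m. f x = r})) / - ln \<delta> \<le> 1 / real m + 1 / real (Suc n)"
          by (elim exE conjE)
        then show "\<exists>\<delta>. 0 < \<delta> \<and> \<delta> < b \<and>
            ln (real (covering_number \<delta> {x\<in>boxplus m. f x = r})) / - ln \<delta> \<le> 1 / real m + e"
          using n by (intro exI[of _ \<delta>] conjI) linarith+
      qed
      then show "lower_box_dim {x\<in>boxplus m. f x = r} \<le> ereal (1 / real m) + ereal e" by simp
    qed
  qed
qed

text \<open>The factor \<open>2 ^ k\<close> is \<open>(2 ^ (m * k)) powr (1 / m)\<close>; all constants are absorbed by \<open>e\<close>.\<close>

lemma scale_exists:
  fixes A e M \<kappa> :: real
  assumes m: "m \<ge> 2" and A: "A > 0" and e: "e > 0" and M: "M \<ge> 1" and \<kappa>: "\<kappa> > 0"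
  shows "\<exists>k\<ge>1. 2 / (2^(m*k) * M) < \<kappa> \<and> 2 / (2^(m*k) * M) < 1 \<and>
    A * 2^k \<le> (2 / (2^(m*k) * M)) powr - (1 / real m + e)"
proof -
  \<comment> \<open>The three terms make \<open>D\<close> exceed
    \<open>(2 * A) powr (1 / e)\<close>, \<open>1 / \<kappa>\<close> and 1, where
    \<open>1 / D\<close> is the scale in question.\<close>
  define C where "C = 2 * max ((2 * A) powr (1 / e)) (max (1 / \<kappa>) 1)"
  obtain k where k: "C < 2 ^ k" using real_arch_pow[of 2 C] by auto
  have C: "C \<ge> 2" "C \<ge> 2 * (2 * A) powr (1 / e)" "C \<ge> 2 / \<kappa>" unfolding C_def by (auto simp: max_def)
  have k1: "k \<ge> 1" using k C(1) by (cases k) auto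
  define D where "D = 2^(m*k) * M / 2"
  have "1 * k \<le> m * k" using m by (intro mult_right_mono) auto
  then have "(2::real) ^ k \<le> 2 ^ (m*k)" by (intro power_increasing) auto
  also have "\<dots> \<le> 2 ^ (m*k) * M" using M by simp
  finally have D: "C < 2 * D" using k by (simp add: D_def)
  then have D1: "D > 1" "D > (2 * A) powr (1 / e)" "D > 1 / \<kappa>" using C by auto
  have inv: "2 / (2^(m*k) * M) = 1 / D" by (simp add: D_def)
  have "A * 2^k \<le> D powr (1 / real m + e)"
  proof -
    have "2 * A = ((2 * A) powr (1 / e)) powr e" using A e by (simp add: powr_powr)
    also have "\<dots> \<le> D powr e" using D1 e by (intro powr_mono2) auto
    finally have 1: "2 * A \<le> D powr e" .
    have "(2 ^ (m*k)) powr (1 / real m) = (((2::real)^m) powr (1 / real m)) ^ k"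
      by (simp add: power_mult powr_powr mult.commute flip: powr_realpow)
    then have "2 ^ k = (2 ^ (m*k)) powr (1 / real m)" using powr_inverse_m(1)[OF m] by simp
    also have "\<dots> \<le> (2 * D) powr (1 / real m)" using M by (intro powr_mono2) (auto simp: D_def)
    also have "\<dots> = 2 powr (1 / real m) * D powr (1 / real m)" using D1 by (simp add: powr_mult)
    also have "\<dots> \<le> 2 powr 1 * D powr (1 / real m)"
      using powr_inverse_m[OF m] by (intro mult_right_mono powr_mono) auto
    finally have 2: "2 ^ k \<le> 2 * D powr (1 / real m)" by simp
    have "(2 * A) * 2 ^ k \<le> D powr e * (2 * D powr (1 / real m))"
      using 1 2 A by (intro mult_mono) auto
    then show ?thesis by (simp add: powr_add mult.commute)
  qed
  also have "\<dots> = (1 / D) powr - (1 / real m + e)"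
  proof -
    have "D powr s = (1 / D) powr - s" for s using D1 by (simp add: powr_divide powr_minus)
    then show ?thesis .
  qed
  finally have "A * 2^k \<le> (1 / D) powr - (1 / real m + e)" .
  moreover have "1 / D < \<kappa>" "1 / D < 1" using D1 \<kappa> by (auto simp: field_simps)
  ultimately show ?thesis using k1 by (intro exI[of _ k] conjI) (simp_all only: inv)
qed

lemma small_levels_dense:
  assumes m: "m \<ge> 2" and \<alpha>: "0 < \<alpha>" "\<alpha> < 1 / real m"
    and f: "f \<in> holder1 \<alpha> (boxplus m)" and e: "e > 0"
  shows "\<exists>f0\<in>holder1 \<alpha> (boxplus m). (\<forall>x\<in>boxplus m. \<bar>f x - f0 x\<bar> \<le> e) \<and>
    (\<exists>\<rho>>0. \<forall>h. (\<forall>x\<in>boxplus m. \<bar>f0 x - h x\<bar> \<le> \<rho>) \<longrightarrow> small_levels m h n)"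
proof -
  let ?F = "boxplus m"
  have F: "compact ?F" "?F \<noteq> {}" using compact_boxplus boxplus_nonempty m by auto
  have \<alpha>1: "\<alpha> \<le> 1" "\<alpha> < 1" using \<alpha> powr_inverse_m(3)[OF m] by linarith+
  obtain B where B: "B > 0" "\<And>x. x \<in> ?F \<Longrightarrow> \<bar>f x\<bar> \<le> B" using holder1_bounded[OF F \<alpha>(1) f] by blast
  \<comment> \<open>Three errors of at most \<open>e/3\<close> are allowed: the Lipschitz
    approximation, the collapse (at most \<open>\<epsilon>\<close>) and the factor
    \<open>1 - \<epsilon>\<close> (at most \<open>\<epsilon> * (B + 2)\<close>).\<close>
  define \<epsilon> where "\<epsilon> = min 1 (e / (3 * (B + 2)))"
  have \<epsilon>01: "0 < \<epsilon>" "\<epsilon> \<le> 1" using e B by (auto simp: \<epsilon>_def)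
  have "\<epsilon> \<le> e / (3 * (B + 2))" by (simp add: \<epsilon>_def)
  then have \<epsilon>B: "\<epsilon> * (3 * (B + 2)) \<le> e" using B by (simp add: pos_le_divide_eq)
  define T where "T = (min 1 (e/3)) powr (1 / \<alpha>)"
  have T0: "T > 0" using e by (simp add: T_def)
  have T\<alpha>: "T powr \<alpha> = min 1 (e/3)" using e \<alpha> by (simp add: T_def powr_powr)
  have fh: "\<bar>f a - f b\<bar> \<le> dist a b powr \<alpha>" if "a \<in> ?F" "b \<in> ?F" for a b
    using f that by (simp add: holder1_def)
  define K where "K = T powr (\<alpha> - 1)"
  have K: "K > 0" using T0 by (simp add: K_def)
  have approx: "\<exists>g. (\<forall>x y. \<bar>g x - g y\<bar> \<le> T powr (\<alpha> - 1) * dist x y) \<and>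
      (\<forall>x y. \<bar>g x - g y\<bar> \<le> dist x y powr \<alpha>) \<and> (\<forall>x\<in>?F. \<bar>g x - f x\<bar> \<le> T powr \<alpha>)"
    by (rule holder_lipschitz_approx[OF F(2) \<alpha>(1) \<alpha>1(1) T0 fh B(2)])
  obtain g where g': "\<forall>x y. \<bar>g x - g y\<bar> \<le> K * dist x y" "\<forall>x y. \<bar>g x - g y\<bar> \<le> dist x y powr \<alpha>"
    "\<forall>x\<in>?F. \<bar>g x - f x\<bar> \<le> T powr \<alpha>"
    using approx unfolding K_def by (elim exE conjE)
  note g = g'(1,2)[rule_format] bspec[OF g'(3)]
  \<comment> \<open>Since \<open>\<alpha> < 1\<close>, refining the grid sends
    \<open>M powr (\<alpha> - 1)\<close> to 0 while \<open>K\<close> is already fixed.\<close>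
  have "(2^m) powr (\<alpha> - 1) < (2^m) powr (0::real)"
    using \<alpha>1 m four_le_power[OF m] by (intro powr_less_mono) linarith+
  then obtain l where l: "((2^m) powr (\<alpha> - 1)) ^ l < \<epsilon> / (8 * K)"
    using real_arch_pow_inv[of "\<epsilon> / (8 * K)" "(2^m) powr (\<alpha> - 1)"] \<epsilon>01 K by auto
  define M where "M = (2::real)^(m*l)"
  have M: "M \<ge> 1" by (simp add: M_def)
  have "M powr (\<alpha> - 1) = ((2^m) powr (\<alpha> - 1)) ^ l"
    unfolding M_def by (simp add: power_mult powr_powr mult_ac flip: powr_realpow)
  then have MK: "8 * K * M powr (\<alpha> - 1) \<le> \<epsilon>" using l K by (simp add: field_simps)
  \<comment> \<open>The constant of \<open>collapse_level_sets\<close> for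
    \<open>\<eta> = (1/2) ^ n\<close>. It is fixed before \<open>k\<close>, which can therefore
    absorb it.\<close>
  define A where "A = 128 * K * M / (1/2) ^ n"
  have A: "A > 0" using K M by (simp add: A_def)
  obtain k where k: "k \<ge> 1" "2 / (2^(m*k) * M) < 1 / real (Suc n)" "2 / (2^(m*k) * M) < 1"
    "A * 2^k \<le> (2 / (2^(m*k) * M)) powr - (1 / real m + 1 / real (Suc n))"
    using scale_exists[OF m A, of "1 / real (Suc n)" M "1 / real (Suc n)"] M by auto
  define f1 where "f1 z = (1 - \<epsilon>) * g (collapse m k M z)" for z
  define f0 where "f0 = restrict f1 ?F"
  have "f0 \<in> holder1 \<alpha> ?F"
    unfolding holder1_def f0_def f1_def
    using collapse_holder1[OF m K g(1,2) \<alpha> \<epsilon>01 M MK] by simp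
  moreover have "\<bar>f x - f0 x\<bar> \<le> e" if x: "x \<in> ?F" for x
  proof -
    have "\<bar>g (collapse m k M x) - g x\<bar> \<le> \<epsilon>"
    proof -
      have "\<bar>g (collapse m k M x) - g x\<bar> \<le> K * dist (collapse m k M x) x" by (rule g(1))
      also have "\<dots> \<le> K * (2 / M)" using K M collapse_near[OF m] by (intro mult_left_mono) auto
      also have "\<dots> = 2 * K * M powr -1" using M by (simp add: powr_minus_divide)
      also have "\<dots> \<le> 8 * K * M powr (\<alpha> - 1)" using K M \<alpha> by (intro mult_mono powr_mono) auto
      finally show ?thesis using MK by linarith
    qed
    moreover have gx: "\<bar>g x - f x\<bar> \<le> e/3" "\<bar>g x - f x\<bar> \<le> 1" using g(3)[OF x] T\<alpha> by auto
    moreover have "\<bar>\<epsilon> * g (collapse m k M x)\<bar> \<le> \<epsilon> * (B + 2)"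
    proof -
      have "\<bar>g (collapse m k M x)\<bar> \<le> B + 2"
        using calculation(1) gx(2) B(2)[OF x] \<epsilon>01 by linarith
      then show ?thesis using \<epsilon>01 by (simp add: abs_mult mult_left_mono)
    qed
    moreover have "f x - f0 x = (f x - g x) + (g x - g (collapse m k M x)) + \<epsilon> * g (collapse m k M x)"
      using x by (simp add: f0_def f1_def algebra_simps)
    moreover have "\<epsilon> \<le> e/3" "\<epsilon> * (B + 2) \<le> e/3"
    proof -
      show 1: "\<epsilon> * (B + 2) \<le> e/3" using \<epsilon>B by (simp add: algebra_simps)
      have "\<epsilon> * 1 \<le> \<epsilon> * (B + 2)" using \<epsilon>01 B by (intro mult_left_mono) auto
      then show "\<epsilon> \<le> e/3" using 1 by simp
    qed
    ultimately show ?thesis by linarith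
  qed
  moreover have "\<exists>\<rho>>0. \<forall>h. (\<forall>x\<in>?F. \<bar>f0 x - h x\<bar> \<le> \<rho>) \<longrightarrow> small_levels m h n"
  proof -
    have \<epsilon>': "0 \<le> 1 - \<epsilon>" "1 - \<epsilon> \<le> 1" using \<epsilon>01 by auto
    have half: "(1/2::real) ^ n > 0" by simp
    obtain \<rho> R where \<rho>: "\<rho> > 0" and R: "R \<in> sets borel" "emeasure lborel R \<le> ennreal ((1/2) ^ n)"
      and cov: "\<And>r. r \<notin> R \<Longrightarrow> \<exists>\<C>. finite \<C> \<and> {z\<in>?F. \<bar>f1 z - r\<bar> \<le> \<rho>} \<subseteq> \<Union>\<C> \<and>
        real (card \<C>) \<le> A * 2^k \<and> (\<forall>U\<in>\<C>. bounded U \<and> diameter U \<le> 2 / (2^(m*k) * M))"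
      using collapse_level_sets[OF m K g(1) \<epsilon>' M_def half k(1)] unfolding f1_def A_def by blast
    have "small_levels m h n" if h: "\<forall>x\<in>?F. \<bar>f0 x - h x\<bar> \<le> \<rho>" for h
      unfolding small_levels_def
    proof (intro bexI[OF _ R(1)] conjI R(2) allI impI)
      fix r assume "r \<notin> R"
      from cov[OF this] obtain \<C> where C: "finite \<C>" "{z\<in>?F. \<bar>f1 z - r\<bar> \<le> \<rho>} \<subseteq> \<Union>\<C>"
        "real (card \<C>) \<le> A * 2^k" "\<forall>U\<in>\<C>. bounded U \<and> diameter U \<le> 2 / (2^(m*k) * M)"
        by (elim exE conjE)
      let ?\<delta> = "2 / (2^(m*k) * M)"
      \<comment> \<open>This is why thickened level sets were covered: one cover serves every
        \<open>h\<close> within \<open>\<rho>\<close> of the collapsed function.\<close>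
      have "{x\<in>?F. h x = r} \<subseteq> {z\<in>?F. \<bar>f1 z - r\<bar> \<le> \<rho>}" using h by (auto simp: f0_def)
      then have "covering_number ?\<delta> {x\<in>?F. h x = r} \<le> card \<C>"
        using C by (intro covering_number_le) auto
      then have "real (covering_number ?\<delta> {x\<in>?F. h x = r}) \<le> ?\<delta> powr - (1 / real m + 1 / real (Suc n))"
        using C(3) k(4) by linarith
      then have "ln (real (covering_number ?\<delta> {x\<in>?F. h x = r})) / - ln ?\<delta> \<le> 1 / real m + 1 / real (Suc n)"
        using M k(3) by (intro ln_nat_div_le) auto
      then show "\<exists>\<delta>. 0 < \<delta> \<and> \<delta> < 1 / real (Suc n) \<and>
          ln (real (covering_number \<delta> {x\<in>?F. h x = r})) / - ln \<delta> \<le> 1 / real m + 1 / real (Suc n)"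
        using k(2) M by (intro exI[of _ ?\<delta>] conjI) auto
    qed
    with \<rho> show ?thesis by blast
  qed
  ultimately show ?thesis by blast
qed

lemma generic_level_set_dim_boxplus_le:
  fixes dm :: "(real \<times> real) set \<Rightarrow> ereal"
  assumes m: "m \<ge> 2" and \<alpha>: "0 < \<alpha>" "\<alpha> < 1 / real m"
    and dm: "\<And>A. compact A \<Longrightarrow> dm A \<le> lower_box_dim A"
  shows "generic_level_set_dim dm \<alpha> (boxplus m) \<le> ereal (1 / real m)"
proof -
  let ?F = "boxplus m"
  have F: "compact ?F" "?F \<noteq> {}" using compact_boxplus boxplus_nonempty m by auto
  \<comment> \<open>Stability under small perturbations is built in and makes \<open>U n\<close>
    open: a neighbour at distance \<open>\<rho> / 2\<close> inherits the radius
    \<open>\<rho> / 2\<close>.\<close>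
  define U where "U n = {f \<in> holder1 \<alpha> ?F.
    \<exists>\<rho>>0. \<forall>h. (\<forall>x\<in>?F. \<bar>f x - h x\<bar> \<le> \<rho>) \<longrightarrow> small_levels m h n}" for n
  have sub: "U n \<subseteq> holder1 \<alpha> ?F" for n by (auto simp: U_def)
  show ?thesis
  proof (rule generic_level_set_dim_le[OF F \<alpha>(1), of U])
    show "openin (holder1_topology \<alpha> ?F) (U n)" for n
      unfolding openin_holder1[OF F \<alpha>(1)]
    proof (intro conjI ballI sub)
      fix f assume "f \<in> U n"
      then obtain \<rho> where \<rho>: "\<rho> > 0" "\<And>h. (\<forall>x\<in>?F. \<bar>f x - h x\<bar> \<le> \<rho>) \<Longrightarrow> small_levels m h n"
        by (auto simp: U_def)
      have "g \<in> U n" if g: "g \<in> holder1 \<alpha> ?F" "\<forall>x\<in>?F. \<bar>f x - g x\<bar> \<le> \<rho> / 2" for g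
      proof -
        have "small_levels m h n" if h: "\<forall>x\<in>?F. \<bar>g x - h x\<bar> \<le> \<rho> / 2" for h
        proof (rule \<rho>(2), rule ballI)
          fix x assume "x \<in> ?F"
          then show "\<bar>f x - h x\<bar> \<le> \<rho>" using bspec[OF g(2), of x] bspec[OF h, of x] by linarith
        qed
        moreover have "\<rho> / 2 > 0" using \<rho>(1) by simp
        ultimately show ?thesis using g(1) unfolding U_def by blast
      qed
      moreover have "\<rho> / 2 > 0" using \<rho>(1) by simp
      ultimately show "\<exists>e>0. \<forall>g\<in>holder1 \<alpha> ?F. (\<forall>x\<in>?F. \<bar>f x - g x\<bar> \<le> e) \<longrightarrow> g \<in> U n" by blast
    qed
    show "holder1_topology \<alpha> ?F closure_of U n = topspace (holder1_topology \<alpha> ?F)" for n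
    proof (unfold holder1_dense_iff[OF F \<alpha>(1) sub], intro ballI allI impI)
      fix f and e :: real assume "f \<in> holder1 \<alpha> ?F" "e > 0"
      from small_levels_dense[OF m \<alpha> this, of n] obtain f0 where
        "f0 \<in> holder1 \<alpha> ?F" "\<forall>x\<in>?F. \<bar>f x - f0 x\<bar> \<le> e"
        "\<exists>\<rho>>0. \<forall>h. (\<forall>x\<in>?F. \<bar>f0 x - h x\<bar> \<le> \<rho>) \<longrightarrow> small_levels m h n" by (elim bexE conjE)
      then show "\<exists>g\<in>U n. \<forall>x\<in>?F. \<bar>f x - g x\<bar> \<le> e" unfolding U_def by (intro bexI[of _ f0]) simp_all
    qed
    fix f assume f: "f \<in> holder1 \<alpha> ?F" "\<And>n. f \<in> U n"
    have c: "continuous_on ?F f" by (rule holder1_continuous[OF F \<alpha>(1) f(1)])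
    have "small_levels m f n" for n
    proof -
      obtain \<rho> where "\<rho> > 0" "\<And>h. (\<forall>x\<in>?F. \<bar>f x - h x\<bar> \<le> \<rho>) \<Longrightarrow> small_levels m h n"
        using f(2)[of n] by (auto simp: U_def)
      then show ?thesis by simp
    qed
    from small_levels_AE[OF this]
    have "AE r in lborel. dm {x\<in>?F. f x = r} \<le> ereal (1 / real m)"
      by eventually_elim (rule order_trans[OF dm[OF compact_level[OF F(1) c]]])
    then show "level_set_dim dm ?F f \<le> ereal (1 / real m)" by (rule level_set_dim_le)
  qed
qed

theorem theorem5p5:
  fixes m :: nat and \<alpha> :: real
  assumes "m \<ge> 2" and "0 < \<alpha>" and "\<alpha> < 1 / real m"
  shows "D_star \<alpha> (boxplus m) = ereal (1 / real m) \<and>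
         D_lbox_star \<alpha> (boxplus m) = ereal (1 / real m)"
proof -
  have "compact (boxplus m)" using compact_boxplus assms(1) by simp
  note borel = borel_hausdorff_dim_levels[OF this] borel_lower_box_dim_levels[OF this]
  have "\<alpha> \<le> 1" using assms powr_inverse_m(3)[OF assms(1)] by linarith
  note ge = generic_level_set_dim_boxplus_ge[OF assms(1,2) this]
  note le = generic_level_set_dim_boxplus_le[OF assms]
  show ?thesis
    unfolding D_star_def D_lbox_star_def
    using ge[OF order_refl borel(1)] ge[OF hausdorff_dim_le_lower_box_dim borel(2)]
      le[OF hausdorff_dim_le_lower_box_dim] le[OF order_refl]
    by (intro conjI antisym)
qed

end
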